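(* Let $U\subseteq\mathbb R^d$ be open and let $\mathbf g=\mathbf g_{jk}(x)$ be a smooth Riemannian metric on $U$ with inverse $(\mathbf g^{-1})^{jk}$. Below, $\varphi$ is a function, $\mathbf u^j$ a vector field, $\boldsymbol\omega_j$ a one-form, $\mathbf h^{jk},\boldsymbol\pi^{jk}$ are symmetric $2$-tensors, and $\widehat{\mathbf h}^{jk},\widehat{\boldsymbol\pi}^{jk}$ are symmetric $2$-tensors that are trace-free with respect to $\mathbf g$. Every matrix-valued differential operator $\mathcal P$ on $U$ with smooth coefficients having one of the following principal parts satisfies (FC) for all $x\in U$ and $\xi\in\mathbb C^d\setminus\{0\}$, the principal symbol $p^*(x,\xi)$ of $\mathcal P^*$ is injective. 1. ($d\ge1$) $\mathcal P_{\mathrm{prin}}\mathbf u=\partial_j\mathbf u^j$, equivalently $\mathcal P^*_{\mathrm{prin}}\varphi=-\partial_j\varphi$; here $(p^* )_j=-i\xi_j$. 2. ($d\ge1$) $\mathcal P_{\mathrm{prin}}\mathbf h=\partial_j\partial_k\mathbf h^{jk}$, equivalently $\mathcal P^*_{\mathrm{prin}}\varphi=\partial_j\partial_k\varphi$; here $(p^* )_{jk}=-\xi_j\xi_k$. 3. ($d\ge2$) $\mathcal P_{\mathrm{prin}}\widehat{\mathbf h}=\partial_j\partial_k\widehat{\mathbf h}^{jk}$, equivalently $\mathcal P^*_{\mathrm{prin}}\varphi=\partial_j\partial_k\varphi-\frac1d\mathbf g_{jk}(\mathbf g^{-1})^{\ell m}\partial_\ell\partial_m\varphi$; here $(p^*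 )_{jk}=-\xi_j\xi_k+\frac1d\mathbf g_{jk}(x)(\mathbf g^{-1})^{\ell m}(x)\xi_\ell\xi_m$. 4. ($d\ge1$) $(\mathcal P_{\mathrm{prin}}\mathbf h)^j=\partial_k\mathbf h^{jk}$, equivalently $(\mathcal P^*_{\mathrm{prin}}\boldsymbol\omega)_{jk}=-\frac12(\partial_j\boldsymbol\omega_k+\partial_k\boldsymbol\omega_j)$; here $(p^* )_{jk}{}^\ell=-\frac i2(\xi_j\delta_k^\ell+\xi_k\delta_j^\ell)$. 5. ($d\ge3$) $(\mathcal P_{\mathrm{prin}}\widehat{\mathbf h})^j=\partial_k\widehat{\mathbf h}^{jk}$, equivalently $(\mathcal P^*_{\mathrm{prin}}\boldsymbol\omega)_{jk}=-\frac12(\partial_j\boldsymbol\omega_k+\partial_k\boldsymbol\omega_j)+\frac1d\mathbf g_{jk}(\mathbf g^{-1})^{\ell m}\partial_\ell\boldsymbol\omega_m$; here $(p^* )_{jk}{}^\ell=-\frac i2(\xi_j\delta_k^\ell+\xi_k\delta_j^\ell)+\frac id\mathbf g_{jk}(x)(\mathbf g^{-1})^{\ell m}(x)\xi_m$. 6. ($d\ge1$) $\mathcal P_{\mathrm{prin}}(\mathbf h,\boldsymbol\pi)=(\partial_j\partial_k\mathbf h^{jk},\partial_{k'}\boldsymbol\pi^{j'k'})$, equivalently $\mathcal P^*_{\mathrm{prin}}(\varphi,\boldsymbol\omega)=\big(\partial_j\partial_k\varphi,-\frac12(\partial_{j'}\boldsymbol\omega_{k'}+\partial_{k'}\boldsymbol\omega_{j'})\big)$;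 here $p^*$ is block-diagonal with the symbols in items 2 and 4 as blocks. 7. ($d\ge3$) $\mathcal P_{\mathrm{prin}}(\mathbf h,\widehat{\boldsymbol\pi})=(\partial_j\partial_k\mathbf h^{jk},\partial_{k'}\widehat{\boldsymbol\pi}^{j'k'})$; here $p^*$ is block-diagonal with the symbols in items 2 and 5 as blocks.
   Context: For an $r_0\times s_0$-matrix-valued differential operator $\mathcal P$ with formal adjoint $(\mathcal P^*\varphi)_K=\sum_\alpha c[\mathcal P^*]_K{}^{(\alpha,J)}(x)\partial^\alpha\varphi_J$ ($1\le J\le r_0$, $1\le K\le s_0$; adjoint with respect to the $L^2(dx)$ pairing), let $m_K$ be the order of $\varphi\mapsto(\mathcal P^*\varphi)_K$. The principal part keeps, for each $K$, only the terms with $|\alpha|=m_K$: $(\mathcal P^*_{\mathrm{prin}}\varphi)_K=\sum_{|\alpha|=m_K}c[\mathcal P^*]_K{}^{(\alpha,J)}\partial^\alpha\varphi_J$, $(\mathcal P_{\mathrm{prin}}u)^J=\sum_K\sum_{|\alpha|=m_K}c[\mathcal P]^{(\alpha,J)}_K\partial^\alpha u^K$, and the principal symbol of $\mathcal P^*$ is $(p^* )_K{}^J(x,\xi)=\sum_{|\alpha|=m_K}c[\mathcal P^*]_K{}^{(\alpha,J)}(x)i^{|\alpha|}\xi^\alpha$ (so $m_K$ may differ between components, e.g. $2$ and $1$ in items 6, 7). Vector fields, one-forms and (trace-free) symmetric tensors are regarded as vector-valued functions through their components; injectivity of $p^*(x,\xi)$ is as a linear map on the (complex) space of values of $\varphi$,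 $\boldsymbol\omega$ or $(\varphi,\boldsymbol\omega)$. *)

theory Defs
  imports "HOL-Analysis.Analysis"
begin

section \<open>Partial derivatives, multi-indices, smooth functions\<close>

definition pd :: "'d::finite \<Rightarrow> (real^'d \<Rightarrow> 'a::real_normed_vector) \<Rightarrow> real^'d \<Rightarrow> 'a" where
  "pd i f x = vector_derivative (\<lambda>t. f (x + t *\<^sub>R axis i 1)) (at 0)"

text \<open>For open \<open>U\<close> this is the usual class of infinitely differentiable functions: every
  iterated partial derivative, taken in any order, is again (Frechet) differentiable on \<open>U\<close>.
  The values of \<open>f\<close> outside \<open>U\<close> are irrelevant.\<close>
definition smooth_on :: "(real^'d::finite) set \<Rightarrow> (real^'d \<Rightarrow> 'a::real_normed_vector) \<Rightarrow> bool" where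
  "smooth_on U f \<longleftrightarrow> (\<forall>is. (foldr pd is f) differentiable_on U)"

type_synonym 'd mindex = "'d \<Rightarrow> nat"

definition mabs :: "'d::finite mindex \<Rightarrow> nat" where
  "mabs \<alpha> = (\<Sum>i\<in>UNIV. \<alpha> i)"

definition mpow :: "complex^'d::finite \<Rightarrow> 'd mindex \<Rightarrow> complex" where
  "mpow \<xi> \<alpha> = (\<Prod>i\<in>UNIV. (\<xi> $ i) ^ \<alpha> i)"

text \<open>The index type carries no order, so the order in which the partial derivatives are taken in
  \<open>\<partial>\<^sup>\<alpha>\<close> is an arbitrary fixed one; it is immaterial for smooth functions.\<close>
definition coords :: "'d::finite list" where
  "coords = (SOME is. distinct is \<and> set is = UNIV)"

definition mpd :: "'d::finite mindex \<Rightarrow> (real^'d \<Rightarrow> 'a::real_normed_vector) \<Rightarrow> real^'d \<Rightarrow> 'a" where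
  "mpd \<alpha> f = foldr (\<lambda>i. pd i ^^ \<alpha> i) coords f"


section \<open>Matrix-valued differential operators\<close>

text \<open>A coefficient family \<open>C\<close> stands for the operator \<open>\<Sum>\<^sub>\<alpha> C\<^sub>\<alpha>(x) \<partial>\<^sup>\<alpha>\<close>. The input components are
  indexed by \<open>'k\<close> and the output components by \<open>'j\<close>, so \<open>C \<alpha> x $ J $ K\<close> is the coefficient of
  \<open>\<partial>\<^sup>\<alpha> u\<^sup>K\<close> in the output component \<open>J\<close>.\<close>
type_synonym ('d, 'k, 'j) coeffs = "'d mindex \<Rightarrow> real^'d \<Rightarrow> complex^'k^'j"

definition active :: "(real^'d::finite) set \<Rightarrow> ('d, 'k::finite, 'j::finite) coeffs \<Rightarrow> 'd mindex set" where
  "active U C = {\<alpha>. \<exists>x\<in>U. C \<alpha> x \<noteq> 0}"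

definition smooth_coeffs :: "(real^'d::finite) set \<Rightarrow> ('d, 'k::finite, 'j::finite) coeffs \<Rightarrow> bool" where
  "smooth_coeffs U C \<longleftrightarrow> finite (active U C) \<and> (\<forall>\<alpha>. smooth_on U (C \<alpha>))"

definition apply_coeffs :: "(real^'d::finite) set \<Rightarrow> ('d, 'k::finite, 'j::finite) coeffs
    \<Rightarrow> (real^'d \<Rightarrow> complex^'k) \<Rightarrow> real^'d \<Rightarrow> complex^'j" where
  "apply_coeffs U C u x =
     (\<chi> J. \<Sum>\<alpha>\<in>active U C. \<Sum>K\<in>UNIV. C \<alpha> x $ J $ K * mpd \<alpha> (\<lambda>y. u y $ K) x)"

text \<open>A fibre assignment \<open>E\<close> records pointwise linear constraints on the components, such as
  symmetry or vanishing trace; unconstrained functions have \<open>E x = UNIV\<close>.\<close>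
definition sections :: "(real^'d::finite) set \<Rightarrow> (real^'d \<Rightarrow> (complex^'k::finite) set)
    \<Rightarrow> (real^'d \<Rightarrow> complex^'k) set" where
  "sections U E = {u. smooth_on U u \<and> (\<forall>x\<in>U. u x \<in> E x)}"

definition test_sections :: "(real^'d::finite) set \<Rightarrow> (real^'d \<Rightarrow> (complex^'k::finite) set)
    \<Rightarrow> (real^'d \<Rightarrow> complex^'k) set" where
  "test_sections U E =
     {u \<in> sections U E. \<exists>S. compact S \<and> S \<subseteq> U \<and> (\<forall>x. x \<notin> S \<longrightarrow> u x = 0)}"

text \<open>An operator on \<open>E\<close>-valued functions is a map on such functions, because its coefficients
  are not unique when \<open>E\<close> is a proper subspace.\<close>
definition represents :: "(real^'d::finite) set \<Rightarrow> (real^'d \<Rightarrow> (complex^'k::finite) set)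
    \<Rightarrow> ('d, 'k, 'j::finite) coeffs \<Rightarrow> ((real^'d \<Rightarrow> complex^'k) \<Rightarrow> real^'d \<Rightarrow> complex^'j) \<Rightarrow> bool" where
  "represents U E C P \<longleftrightarrow>
     smooth_coeffs U C \<and> (\<forall>u\<in>sections U E. \<forall>x\<in>U. P u x = apply_coeffs U C u x)"

definition diff_op :: "(real^'d::finite) set \<Rightarrow> (real^'d \<Rightarrow> (complex^'k::finite) set)
    \<Rightarrow> ((real^'d \<Rightarrow> complex^'k) \<Rightarrow> real^'d \<Rightarrow> complex^'j::finite) \<Rightarrow> bool" where
  "diff_op U E P \<longleftrightarrow> (\<exists>C. represents U E C P)"

text \<open>\<open>Q\<close> is the coefficient family of the formal adjoint of \<open>P\<close> for the \<open>L\<^sup>2(dx)\<close> pairing. The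
  adjoint takes values in \<open>E'\<close>, which in the applications is the dual of \<open>E\<close>: without this
  requirement the identity would determine the adjoint only modulo the annihilator of \<open>E\<close>. The
  adjoint acts on unconstrained functions, hence its coefficients on \<open>U\<close> are unique.\<close>
definition formal_adjoint :: "(real^'d::finite) set \<Rightarrow> (real^'d \<Rightarrow> (complex^'k::finite) set)
    \<Rightarrow> (real^'d \<Rightarrow> (complex^'k) set) \<Rightarrow> ((real^'d \<Rightarrow> complex^'k) \<Rightarrow> real^'d \<Rightarrow> complex^'j::finite)
    \<Rightarrow> ('d, 'j, 'k) coeffs \<Rightarrow> bool" where
  "formal_adjoint U E E' P Q \<longleftrightarrow>
     smooth_coeffs U Q \<and>
     (\<forall>\<phi>. smooth_on U \<phi> \<longrightarrow> (\<forall>x\<in>U. apply_coeffs U Q \<phi> x \<in> E' x)) \<and>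
     (\<forall>u\<in>test_sections U E. \<forall>\<phi>\<in>test_sections U (\<lambda>x. UNIV).
        (LINT x:U|lborel. (\<Sum>J\<in>UNIV. P u x $ J * cnj (\<phi> x $ J))) =
        (LINT x:U|lborel. (\<Sum>K\<in>UNIV. u x $ K * cnj (apply_coeffs U Q \<phi> x $ K))))"


section \<open>Principal parts and the principal symbol\<close>

text \<open>The order \<open>m\<^sub>K\<close> of the component \<open>K\<close> of the operator \<open>Q\<close>; it is \<open>0\<close> if that component
  vanishes identically (\<open>Sup {} = 0\<close> on \<open>nat\<close>).\<close>
definition row_order :: "(real^'d::finite) set \<Rightarrow> ('d, 'j::finite, 'k::finite) coeffs \<Rightarrow> 'k \<Rightarrow> nat" where
  "row_order U Q K = Sup {mabs \<alpha> | \<alpha>. \<exists>x\<in>U. Q \<alpha> x $ K \<noteq> 0}"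

definition adjoint_prin :: "(real^'d::finite) set \<Rightarrow> ('d, 'j::finite, 'k::finite) coeffs
    \<Rightarrow> (real^'d \<Rightarrow> complex^'j) \<Rightarrow> real^'d \<Rightarrow> complex^'k" where
  "adjoint_prin U Q \<phi> x =
     (\<chi> K. \<Sum>\<alpha> | mabs \<alpha> = row_order U Q K. \<Sum>J\<in>UNIV. Q \<alpha> x $ K $ J * mpd \<alpha> (\<lambda>y. \<phi> y $ J) x)"

text \<open>\<open>has_prin U E Q P R\<close>: the principal part of \<open>P\<close>, whose adjoint is \<open>Q\<close>, is \<open>R\<close>. The orders
  \<open>m\<^sub>K\<close> are those of the components of the adjoint. For constrained functions the
  coefficients may be any admissible ones without terms above the orders \<open>m\<^sub>K\<close>; for
  unconstrained functions they are unique and have no such terms anyway.\<close>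
definition has_prin :: "(real^'d::finite) set \<Rightarrow> (real^'d \<Rightarrow> (complex^'k::finite) set)
    \<Rightarrow> ('d, 'j::finite, 'k) coeffs \<Rightarrow> ((real^'d \<Rightarrow> complex^'k) \<Rightarrow> real^'d \<Rightarrow> complex^'j)
    \<Rightarrow> ((real^'d \<Rightarrow> complex^'k) \<Rightarrow> real^'d \<Rightarrow> complex^'j) \<Rightarrow> bool" where
  "has_prin U E Q P R \<longleftrightarrow>
     (\<exists>C. represents U E C P \<and>
        (\<forall>\<alpha> J K. \<forall>x\<in>U. C \<alpha> x $ J $ K \<noteq> 0 \<longrightarrow> mabs \<alpha> \<le> row_order U Q K) \<and>
        (\<forall>u\<in>sections U E. \<forall>x\<in>U. R u x =
           (\<chi> J. \<Sum>K\<in>UNIV. \<Sum>\<alpha> | mabs \<alpha> = row_order U Q K.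
              C \<alpha> x $ J $ K * mpd \<alpha> (\<lambda>y. u y $ K) x)))"

definition adjoint_has_prin :: "(real^'d::finite) set \<Rightarrow> ('d, 'j::finite, 'k::finite) coeffs
    \<Rightarrow> ((real^'d \<Rightarrow> complex^'j) \<Rightarrow> real^'d \<Rightarrow> complex^'k) \<Rightarrow> bool" where
  "adjoint_has_prin U Q R \<longleftrightarrow> (\<forall>\<phi>. smooth_on U \<phi> \<longrightarrow> (\<forall>x\<in>U. adjoint_prin U Q \<phi> x = R \<phi> x))"

definition prin_symbol :: "(real^'d::finite) set \<Rightarrow> ('d, 'j::finite, 'k::finite) coeffs
    \<Rightarrow> real^'d \<Rightarrow> complex^'d \<Rightarrow> complex^'j^'k" where
  "prin_symbol U Q x \<xi> =
     (\<chi> K J. \<Sum>\<alpha> | mabs \<alpha> = row_order U Q K. Q \<alpha> x $ K $ J * \<i> ^ mabs \<alpha> * mpow \<xi> \<alpha>)"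

text \<open>\<open>Q\<close> is the formal adjoint of the operator under consideration.\<close>
definition FC :: "(real^'d::finite) set \<Rightarrow> ('d, 'j::finite, 'k::finite) coeffs \<Rightarrow> bool" where
  "FC U Q \<longleftrightarrow> (\<forall>x\<in>U. \<forall>\<xi>. \<xi> \<noteq> 0 \<longrightarrow> inj (\<lambda>v. prin_symbol U Q x \<xi> *v v))"


section \<open>Metrics and tensors\<close>

definition riemannian_metric :: "(real^'d::finite) set \<Rightarrow> (real^'d \<Rightarrow> real^'d^'d) \<Rightarrow> bool" where
  "riemannian_metric U g \<longleftrightarrow> smooth_on U g \<and>
     (\<forall>x\<in>U. transpose (g x) = g x \<and> (\<forall>v. v \<noteq> 0 \<longrightarrow> v \<bullet> (g x *v v) > 0))"

definition ginv :: "(real^'d \<Rightarrow> real^'d^'d) \<Rightarrow> real^'d::finite \<Rightarrow> real^'d^'d" where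
  "ginv g x = matrix_inv (g x)"

text \<open>A 2-tensor has its components indexed by all pairs \<open>(j, k)\<close>. Scalar functions are regarded
  as functions with values in \<open>complex^1\<close>, and pairs as functions indexed by a sum type.\<close>

definition sym_tensors :: "(complex^('d::finite \<times> 'd)) set" where
  "sym_tensors = {h. \<forall>j k. h $ (j, k) = h $ (k, j)}"

definition tracefree_up :: "(real^'d \<Rightarrow> real^'d^'d) \<Rightarrow> real^'d::finite \<Rightarrow> (complex^('d \<times> 'd)) set" where
  "tracefree_up g x =
     {h \<in> sym_tensors. (\<Sum>j\<in>UNIV. \<Sum>k\<in>UNIV. complex_of_real (g x $ j $ k) * h $ (j, k)) = 0}"

definition tracefree_down :: "(real^'d \<Rightarrow> real^'d^'d) \<Rightarrow> real^'d::finite \<Rightarrow> (complex^('d \<times> 'd)) set" where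
  "tracefree_down g x =
     {h \<in> sym_tensors. (\<Sum>j\<in>UNIV. \<Sum>k\<in>UNIV. complex_of_real (ginv g x $ j $ k) * h $ (j, k)) = 0}"

definition vpair :: "complex^'a::finite \<Rightarrow> complex^'b::finite \<Rightarrow> complex^('a + 'b)" where
  "vpair v w = (\<chi> s. case s of Inl a \<Rightarrow> v $ a | Inr b \<Rightarrow> w $ b)"

definition vfst :: "complex^('a::finite + 'b::finite) \<Rightarrow> complex^'a" where
  "vfst w = (\<chi> a. w $ Inl a)"

definition vsnd :: "complex^('a::finite + 'b::finite) \<Rightarrow> complex^'b" where
  "vsnd w = (\<chi> b. w $ Inr b)"

definition pair_fibre :: "(real^'d::finite \<Rightarrow> (complex^'a::finite) set)
    \<Rightarrow> (real^'d \<Rightarrow> (complex^'b::finite) set) \<Rightarrow> real^'d \<Rightarrow> (complex^('a + 'b)) set" where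
  "pair_fibre E F x = {w. vfst w \<in> E x \<and> vsnd w \<in> F x}"

definition block_diag :: "complex^'a::finite^'m::finite \<Rightarrow> complex^'b::finite^'n::finite
    \<Rightarrow> complex^('a + 'b)^('m + 'n)" where
  "block_diag A B = (\<chi> s t. case (s, t) of (Inl m, Inl a) \<Rightarrow> A $ m $ a
     | (Inr n, Inr b) \<Rightarrow> B $ n $ b | _ \<Rightarrow> 0)"


section \<open>The operators and symbols\<close>

definition div_vector :: "(real^'d::finite \<Rightarrow> complex^'d) \<Rightarrow> real^'d \<Rightarrow> complex^1" where
  "div_vector u x = (\<chi> _. \<Sum>j\<in>UNIV. pd j (\<lambda>y. u y $ j) x)"

definition ddiv_tensor :: "(real^'d::finite \<Rightarrow> complex^('d \<times> 'd)) \<Rightarrow> real^'d \<Rightarrow> complex^1" where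
  "ddiv_tensor h x = (\<chi> _. \<Sum>j\<in>UNIV. \<Sum>k\<in>UNIV. pd j (pd k (\<lambda>y. h y $ (j, k))) x)"

definition div_tensor :: "(real^'d::finite \<Rightarrow> complex^('d \<times> 'd)) \<Rightarrow> real^'d \<Rightarrow> complex^'d" where
  "div_tensor h x = (\<chi> j. \<Sum>k\<in>UNIV. pd k (\<lambda>y. h y $ (j, k)) x)"

definition neg_grad :: "(real^'d::finite \<Rightarrow> complex^1) \<Rightarrow> real^'d \<Rightarrow> complex^'d" where
  "neg_grad \<phi> x = (\<chi> j. - pd j (\<lambda>y. \<phi> y $ 1) x)"

definition hessian :: "(real^'d::finite \<Rightarrow> complex^1) \<Rightarrow> real^'d \<Rightarrow> complex^('d \<times> 'd)" where
  "hessian \<phi> x = (\<chi> p. case p of (j, k) \<Rightarrow> pd j (pd k (\<lambda>y. \<phi> y $ 1)) x)"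

definition tracefree_hessian :: "(real^'d \<Rightarrow> real^'d^'d)
    \<Rightarrow> (real^'d::finite \<Rightarrow> complex^1) \<Rightarrow> real^'d \<Rightarrow> complex^('d \<times> 'd)" where
  "tracefree_hessian g \<phi> x = (\<chi> p. case p of (j, k) \<Rightarrow>
     pd j (pd k (\<lambda>y. \<phi> y $ 1)) x
     - 1 / of_nat CARD('d) * of_real (g x $ j $ k) *
       (\<Sum>l\<in>UNIV. \<Sum>m\<in>UNIV. of_real (ginv g x $ l $ m) * pd l (pd m (\<lambda>y. \<phi> y $ 1)) x))"

definition neg_sym_grad :: "(real^'d::finite \<Rightarrow> complex^'d) \<Rightarrow> real^'d \<Rightarrow> complex^('d \<times> 'd)" where
  "neg_sym_grad \<omega> x = (\<chi> p. case p of (j, k) \<Rightarrow>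
     - (1 / 2) * (pd j (\<lambda>y. \<omega> y $ k) x + pd k (\<lambda>y. \<omega> y $ j) x))"

definition neg_tracefree_sym_grad :: "(real^'d \<Rightarrow> real^'d^'d)
    \<Rightarrow> (real^'d::finite \<Rightarrow> complex^'d) \<Rightarrow> real^'d \<Rightarrow> complex^('d \<times> 'd)" where
  "neg_tracefree_sym_grad g \<omega> x = (\<chi> p. case p of (j, k) \<Rightarrow>
     - (1 / 2) * (pd j (\<lambda>y. \<omega> y $ k) x + pd k (\<lambda>y. \<omega> y $ j) x)
     + 1 / of_nat CARD('d) * of_real (g x $ j $ k) *
       (\<Sum>l\<in>UNIV. \<Sum>m\<in>UNIV. of_real (ginv g x $ l $ m) * pd l (\<lambda>y. \<omega> y $ m) x))"

definition symb_grad :: "complex^'d::finite \<Rightarrow> complex^1^'d" where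
  "symb_grad \<xi> = (\<chi> j _. - \<i> * \<xi> $ j)"

definition symb_hess :: "complex^'d::finite \<Rightarrow> complex^1^('d \<times> 'd)" where
  "symb_hess \<xi> = (\<chi> p _. case p of (j, k) \<Rightarrow> - (\<xi> $ j * \<xi> $ k))"

definition symb_tracefree_hess :: "(real^'d \<Rightarrow> real^'d^'d) \<Rightarrow> real^'d::finite \<Rightarrow> complex^'d
    \<Rightarrow> complex^1^('d \<times> 'd)" where
  "symb_tracefree_hess g x \<xi> = (\<chi> p _. case p of (j, k) \<Rightarrow>
     - (\<xi> $ j * \<xi> $ k) + 1 / of_nat CARD('d) * of_real (g x $ j $ k) *
       (\<Sum>l\<in>UNIV. \<Sum>m\<in>UNIV. of_real (ginv g x $ l $ m) * \<xi> $ l * \<xi> $ m))"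

definition kdelta :: "'d \<Rightarrow> 'd \<Rightarrow> complex" where
  "kdelta j k = (if j = k then 1 else 0)"

definition symb_sym_grad :: "complex^'d::finite \<Rightarrow> complex^'d^('d \<times> 'd)" where
  "symb_sym_grad \<xi> = (\<chi> p l. case p of (j, k) \<Rightarrow>
     - (\<i> / 2) * (\<xi> $ j * kdelta k l + \<xi> $ k * kdelta j l))"

definition symb_tracefree_sym_grad :: "(real^'d \<Rightarrow> real^'d^'d) \<Rightarrow> real^'d::finite \<Rightarrow> complex^'d
    \<Rightarrow> complex^'d^('d \<times> 'd)" where
  "symb_tracefree_sym_grad g x \<xi> = (\<chi> p l. case p of (j, k) \<Rightarrow>
     - (\<i> / 2) * (\<xi> $ j * kdelta k l + \<xi> $ k * kdelta j l)
     + \<i> / of_nat CARD('d) * of_real (g x $ j $ k) *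
       (\<Sum>m\<in>UNIV. of_real (ginv g x $ l $ m) * \<xi> $ m))"

end

theory Submission
  imports Defs
begin

text \<open>
Each item asserts three things: the prescribed principal part of \<open>P\<close> and that of its adjoint
determine each other, the principal symbol is the stated one, and it has trivial kernel.

For the first two, let \<open>Q\<close> be the coefficients of the adjoint, \<open>A\<close> those of the model adjoint
(homogeneous of order \<open>ord K\<close> in the component \<open>K\<close>) and \<open>B\<close> the constant coefficients of the model
operator. Model operators are adjoint to each other pointwise:
\<open>\<langle>e, A\<^sub>\<alpha>\<rangle> = (-1)\<^bsup>|\<alpha>|\<^esup> \<langle>e, B\<^sub>\<alpha>\<rangle>\<close> for all \<open>e\<close> in the fibre \<open>E x\<close> of admissible values. The locale
\<open>principal_pair\<close> collects such data, and inside it both prescriptions are shown to be equivalent to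
\<open>has_principal\<close>: the rows of \<open>Q\<close> have the orders \<open>ord K\<close>, and their top order coefficients are those
of \<open>A\<close>.

\<^item> An operator on unconstrained functions shows its coefficients when it is applied to monomials
  centred at a point (\<open>apply_coeffs_monom\<close>). This settles the prescription for the adjoint.

\<^item> Let \<open>C\<close> be coefficients representing \<open>P\<close>. Integration by parts and the Leibniz rule turn \<open>C\<close>
  into an operator whose top order coefficients are, up to sign, the conjugate transposes of those of \<open>C\<close>
  (\<open>adjoint_coeffs_top\<close>). It need not be \<open>Q\<close>, because \<open>P\<close> acts on constrained functions only, but it
  pairs with every \<open>e\<close> in \<open>E x\<close> as \<open>Q\<close> does (\<open>adjoint_coeffs_agree\<close>). As \<open>Q\<close> has values in \<open>E' x\<close>, which
  \<open>E x\<close> separates, this determines the top order coefficients of \<open>Q\<close>. The orders \<open>m\<^sub>K\<close> are not known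
  beforehand: they cannot exceed \<open>ord K\<close>, since the coefficients above this order would pair to zero with
  all of \<open>E x\<close>, and cannot be smaller, since no row of \<open>A\<close> vanishes.

\<^item> Conversely, if \<open>Q\<close> is \<open>A\<close> plus terms of lower order, then on test sections \<open>P\<close> is \<open>B\<close> plus the
  adjoint of these terms, and a cutoff extends this to all sections
  (\<open>has_principal_imp_has_prin\<close>).

Two principal pairs have a direct sum (\<open>principal_pair_direct_sum\<close>), and a principal pair on symmetric
tensors has a trace-free part (\<open>principal_pair_tracefree_part\<close>), so that only the divergence of vector
fields and the simple and double divergence of symmetric tensors have to be treated by hand.

For injectivity, a nonzero element in the kernel of the trace-free Hessian symbol would make
\<open>\<xi> \<otimes> \<xi>\<close> a multiple of the metric, and in the trace-free symmetrized gradient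
\<open>\<xi> \<otimes> \<omega> + \<omega> \<otimes> \<xi>\<close> is such a multiple. Although \<open>\<xi>\<close> is complex, rank still excludes a nonzero multiple:
these tensors have rank at most one and two, while the metric has rank \<open>d\<close>
(\<open>pos_def_matrix.minor_nonzero\<close>, \<open>pos_def_matrix.not_sym_product\<close>). What remains are the equations
\<open>\<xi>\<^sub>j \<xi>\<^sub>k = 0\<close> and \<open>\<xi>\<^sub>j \<omega>\<^sub>k + \<xi>\<^sub>k \<omega>\<^sub>j = 0\<close> of the symbols without trace term.
\<close>

section \<open>Partial derivatives of smooth functions\<close>

lemma pd_eq:
  assumes "(f has_derivative D) (at x)"
  shows "pd i f x = D (axis i 1)"
proof -
  let ?v = "axis i (1::real)"
  have "((\<lambda>t. x + t *\<^sub>R ?v) has_derivative (\<lambda>t. t *\<^sub>R ?v)) (at 0)"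
    by (auto intro!: derivative_eq_intros)
  moreover have "(f has_derivative D) (at (x + 0 *\<^sub>R ?v))" using assms by simp
  ultimately have "((\<lambda>t. f (x + t *\<^sub>R ?v)) has_derivative (\<lambda>t. D (t *\<^sub>R ?v))) (at 0)"
    by (rule has_derivative_compose)
  moreover have "(\<lambda>t. D (t *\<^sub>R ?v)) = (\<lambda>t. t *\<^sub>R D ?v)"
    using has_derivative_linear[OF assms] by (simp add: linear_cmul)
  ultimately show ?thesis
    unfolding pd_def by (intro vector_derivative_at) (simp add: has_vector_derivative_def)
qed

lemma has_vector_derivative_pd:
  assumes "f differentiable (at (x + t *\<^sub>R axis i 1))"
  shows "((\<lambda>t. f (x + t *\<^sub>R axis i 1)) has_vector_derivative pd i f (x + t *\<^sub>R axis i 1)) (at t within T)"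
proof -
  let ?v = "axis i (1::real)"
  obtain D where D: "(f has_derivative D) (at (x + t *\<^sub>R ?v))"
    using assms by (auto simp: differentiable_def)
  have "((\<lambda>t. x + t *\<^sub>R ?v) has_derivative (\<lambda>t. t *\<^sub>R ?v)) (at t within T)"
    by (auto intro!: derivative_eq_intros)
  from has_derivative_compose[OF this D]
  have "((\<lambda>t. f (x + t *\<^sub>R ?v)) has_derivative (\<lambda>t. D (t *\<^sub>R ?v))) (at t within T)" .
  moreover have "(\<lambda>t. D (t *\<^sub>R ?v)) = (\<lambda>t. t *\<^sub>R D ?v)"
    using has_derivative_linear[OF D] by (simp add: linear_cmul)
  ultimately show ?thesis
    by (simp add: has_vector_derivative_def pd_eq[OF D])
qed

lemma pd_cong:
  assumes "open U" "x \<in> U" "\<And>y. y \<in> U \<Longrightarrow> f y = g y"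
  shows "pd i f x = pd i g x"
proof -
  have "continuous_on UNIV (\<lambda>t. x + t *\<^sub>R axis i (1::real))" by (intro continuous_intros)
  then have "open ((\<lambda>t. x + t *\<^sub>R axis i (1::real)) -` U)"
    using assms(1) by (simp add: continuous_on_open_vimage)
  then have "\<forall>\<^sub>F t in nhds 0. x + t *\<^sub>R axis i (1::real) \<in> U"
    using assms(2) eventually_nhds_in_open[of "(\<lambda>t. x + t *\<^sub>R axis i (1::real)) -` U" 0] by simp
  then have "\<forall>\<^sub>F t in nhds 0. t \<in> UNIV \<longrightarrow> f (x + t *\<^sub>R axis i 1) = g (x + t *\<^sub>R axis i 1)"
    by eventually_elim (use assms(3) in auto)
  then show ?thesis
    unfolding pd_def by (intro vector_derivative_cong_eq) auto
qed

lemma foldr_pd_cong: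
  assumes "open U" "\<And>y. y \<in> U \<Longrightarrow> f y = g y" "x \<in> U"
  shows "foldr pd w f x = foldr pd w g x"
  using assms(3)
proof (induction w arbitrary: x)
  case Nil then show ?case using assms(2) by simp
next
  case (Cons i w)
  then show ?case using pd_cong[OF assms(1) Cons.prems, of "foldr pd w f" "foldr pd w g" i] by simp
qed

lemma pd_const [simp]: "pd i (\<lambda>_. c) = (\<lambda>_. 0)"
  by (rule ext, subst pd_eq[where D = "\<lambda>_. 0"]) auto

lemma foldr_pd_zero [simp]: "foldr pd w (\<lambda>_. 0) = (\<lambda>_. 0)"
  by (induction w) auto

lemma pd_linear:
  assumes "bounded_linear L" "f differentiable (at x)"
  shows "pd i (\<lambda>y. L (f y)) x = L (pd i f x)"
proof -
  obtain D where D: "(f has_derivative D) (at x)" using assms by (auto simp: differentiable_def)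
  from bounded_linear.has_derivative[OF assms(1) this] have "((\<lambda>y. L (f y)) has_derivative (\<lambda>h. L (D h))) (at x)" .
  from pd_eq[OF this] pd_eq[OF D] show ?thesis by simp
qed

lemma pd_add:
  assumes "f differentiable (at x)" "g differentiable (at x)"
  shows "pd i (\<lambda>y. f y + g y) x = pd i f x + pd i g x"
proof -
  obtain D D' where D: "(f has_derivative D) (at x)" "(g has_derivative D') (at x)"
    using assms by (auto simp: differentiable_def)
  from pd_eq[OF has_derivative_add[OF this]] pd_eq[OF D(1)] pd_eq[OF D(2)] show ?thesis by simp
qed

lemma pd_bilinear:
  assumes "bounded_bilinear p" "f differentiable (at x)" "g differentiable (at x)"
  shows "pd i (\<lambda>y. p (f y) (g y)) x = p (f x) (pd i g x) + p (pd i f x) (g x)"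
proof -
  obtain D D' where D: "(f has_derivative D) (at x)" "(g has_derivative D') (at x)"
    using assms by (auto simp: differentiable_def)
  from pd_eq[OF bounded_bilinear.FDERIV[OF assms(1) this]] pd_eq[OF D(1)] pd_eq[OF D(2)] show ?thesis by simp
qed

lemma smooth_on_differentiable:
  assumes "smooth_on U f" "open U" "x \<in> U"
  shows "f differentiable (at x)"
proof -
  have "foldr pd [] f differentiable_on U" using assms(1) unfolding smooth_on_def by blast
  then show ?thesis using assms(2,3) by (simp add: differentiable_on_eq_differentiable_at)
qed

lemma smooth_on_foldr_pd:
  assumes "smooth_on U f" shows "smooth_on U (foldr pd w f)"
  unfolding smooth_on_def
proof
  fix v show "foldr pd v (foldr pd w f) differentiable_on U"
    using assms[unfolded smooth_on_def, rule_format, of "v @ w"] by simp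
qed

lemma smooth_on_pd:
  assumes "smooth_on U f" shows "smooth_on U (pd i f)"
  using smooth_on_foldr_pd[OF assms, of "[i]"] by simp

text \<open>Closure properties of smooth functions are proved by induction on the order of
  differentiability, since the derivative of a product, a quotient or a composite is built
  from functions that are one order less regular.\<close>

primrec ndiff :: "nat \<Rightarrow> (real^'d::finite) set \<Rightarrow> (real^'d \<Rightarrow> 'a::real_normed_vector) \<Rightarrow> bool" where
  "ndiff 0 U f \<longleftrightarrow> f differentiable_on U"
| "ndiff (Suc n) U f \<longleftrightarrow> f differentiable_on U \<and> (\<forall>i. ndiff n U (pd i f))"

lemma ndiff_differentiable: "ndiff n U f \<Longrightarrow> f differentiable_on U"
  by (cases n) auto

lemma ndiff_at:
  "ndiff n U f \<Longrightarrow> open U \<Longrightarrow> x \<in> U \<Longrightarrow> f differentiable (at x)"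
  using ndiff_differentiable differentiable_on_eq_differentiable_at by blast

lemma ndiff_Suc_imp: "ndiff (Suc n) U f \<Longrightarrow> ndiff n U f"
  by (induction n arbitrary: f) auto

lemma ndiff_iff: "ndiff n U f \<longleftrightarrow> (\<forall>w. length w \<le> n \<longrightarrow> foldr pd w f differentiable_on U)"
proof (induction n arbitrary: f)
  case 0 then show ?case by auto
next
  case (Suc n)
  have "(\<forall>w. length w \<le> Suc n \<longrightarrow> foldr pd w f differentiable_on U) \<longleftrightarrow>
        f differentiable_on U \<and> (\<forall>i v. length v \<le> n \<longrightarrow> foldr pd v (pd i f) differentiable_on U)"
    (is "?A \<longleftrightarrow> ?B")
  proof
    assume A: ?A
    have "f differentiable_on U" using A[rule_format, of "[]"] by simp
    moreover have "foldr pd v (pd i f) differentiable_on U" if "length v \<le> n" for i v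
      using A[rule_format, of "v @ [i]"] that by simp
    ultimately show ?B by blast
  next
    assume B: ?B
    show ?A
    proof (intro allI impI)
      fix w :: "'a list" assume "length w \<le> Suc n"
      then show "foldr pd w f differentiable_on U"
        using B by (cases w rule: rev_cases) auto
    qed
  qed
  then show ?case using Suc.IH by auto
qed

lemma smooth_on_iff_ndiff: "smooth_on U f \<longleftrightarrow> (\<forall>n. ndiff n U f)"
  unfolding smooth_on_def ndiff_iff by auto

lemma ndiff_cong:
  assumes "open U" "\<And>y. y \<in> U \<Longrightarrow> f y = g y"
  shows "ndiff n U f \<longleftrightarrow> ndiff n U g"
proof -
  have "foldr pd w f differentiable_on U \<longleftrightarrow> foldr pd w g differentiable_on U" for w
    unfolding differentiable_on_def
    using foldr_pd_cong[OF assms] by (auto intro: differentiable_transform_within[where d = 1])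
  then show ?thesis unfolding ndiff_iff by simp
qed

lemma smooth_on_const [simp, intro]: "smooth_on U (\<lambda>_. c)"
proof -
  have "foldr pd w (\<lambda>_. c) differentiable_on U" for w :: "'a list"
    by (cases w rule: rev_cases) auto
  then show ?thesis unfolding smooth_on_def by blast
qed

lemma differentiable_linear_compose:
  "bounded_linear L \<Longrightarrow> f differentiable (at x) \<Longrightarrow> (\<lambda>y. L (f y)) differentiable (at x)"
  unfolding differentiable_def using bounded_linear.has_derivative by blast

lemma differentiable_bilinear:
  "bounded_bilinear p \<Longrightarrow> f differentiable (at x) \<Longrightarrow> g differentiable (at x)
    \<Longrightarrow> (\<lambda>y. p (f y) (g y)) differentiable (at x)"
  unfolding differentiable_def using bounded_bilinear.FDERIV by blast

context
  fixes U :: "(real^'d::finite) set"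
  assumes U: "open U"
begin

lemma ndiff_linear:
  assumes "bounded_linear L"
  shows "ndiff n U f \<Longrightarrow> ndiff n U (\<lambda>y. L (f y))"
proof (induction n arbitrary: f)
  case 0
  then show ?case using assms U
    by (auto simp: differentiable_on_eq_differentiable_at intro: differentiable_linear_compose)
next
  case (Suc n)
  then have "(\<lambda>y. L (f y)) differentiable_on U" using assms U
    by (auto simp: differentiable_on_eq_differentiable_at intro: differentiable_linear_compose)
  moreover have "ndiff n U (pd i (\<lambda>y. L (f y)))" for i
    using Suc ndiff_cong[OF U, of "pd i (\<lambda>y. L (f y))" "\<lambda>y. L (pd i f y)"]
      pd_linear[OF assms ndiff_at[OF Suc.prems U]] by auto
  ultimately show ?case by simp
qed

lemma ndiff_add:
  "ndiff n U f \<Longrightarrow> ndiff n U g \<Longrightarrow> ndiff n U (\<lambda>y. f y + g y)"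
proof (induction n arbitrary: f g)
  case 0
  then show ?case by auto
next
  case (Suc n)
  then have "(\<lambda>y. f y + g y) differentiable_on U" by auto
  moreover have "ndiff n U (pd i (\<lambda>y. f y + g y))" for i
    using Suc ndiff_cong[OF U, of "pd i (\<lambda>y. f y + g y)" "\<lambda>y. pd i f y + pd i g y"]
      pd_add[OF ndiff_at[OF Suc.prems(1) U] ndiff_at[OF Suc.prems(2) U]] by auto
  ultimately show ?case by simp
qed

lemma ndiff_bilinear:
  assumes "bounded_bilinear p"
  shows "ndiff n U f \<Longrightarrow> ndiff n U g \<Longrightarrow> ndiff n U (\<lambda>y. p (f y) (g y))"
proof (induction n arbitrary: f g)
  case 0
  then show ?case using assms U
    by (auto simp: differentiable_on_eq_differentiable_at intro: differentiable_bilinear)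
next
  case (Suc n)
  then have "(\<lambda>y. p (f y) (g y)) differentiable_on U"
    using assms U ndiff_at[OF _ U]
    by (auto simp: differentiable_on_eq_differentiable_at intro: differentiable_bilinear)
  moreover have "ndiff n U (pd i (\<lambda>y. p (f y) (g y)))" for i
  proof -
    have "ndiff n U (\<lambda>y. p (f y) (pd i g y) + p (pd i f y) (g y))"
      using Suc.prems ndiff_Suc_imp[OF Suc.prems(1)] ndiff_Suc_imp[OF Suc.prems(2)]
      by (intro ndiff_add Suc.IH) auto
    then show ?thesis
      using ndiff_cong[OF U, of "pd i (\<lambda>y. p (f y) (g y))" "\<lambda>y. p (f y) (pd i g y) + p (pd i f y) (g y)"]
        pd_bilinear[OF assms ndiff_at[OF Suc.prems(1) U] ndiff_at[OF Suc.prems(2) U]] by auto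
  qed
  ultimately show ?case by simp
qed

lemma smooth_on_linear: "bounded_linear L \<Longrightarrow> smooth_on U f \<Longrightarrow> smooth_on U (\<lambda>y. L (f y))"
  using ndiff_linear unfolding smooth_on_iff_ndiff by blast

lemma smooth_on_add: "smooth_on U f \<Longrightarrow> smooth_on U g \<Longrightarrow> smooth_on U (\<lambda>y. f y + g y)"
  using ndiff_add unfolding smooth_on_iff_ndiff by blast

lemma smooth_on_bilinear:
  "bounded_bilinear p \<Longrightarrow> smooth_on U f \<Longrightarrow> smooth_on U g \<Longrightarrow> smooth_on U (\<lambda>y. p (f y) (g y))"
  using ndiff_bilinear unfolding smooth_on_iff_ndiff by blast

lemma smooth_on_mult:
  fixes f g :: "real^'d \<Rightarrow> 'a::real_normed_algebra"
  shows "smooth_on U f \<Longrightarrow> smooth_on U g \<Longrightarrow> smooth_on U (\<lambda>y. f y * g y)"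
  by (rule smooth_on_bilinear[OF bounded_bilinear_mult])

lemma smooth_on_minus: "smooth_on U f \<Longrightarrow> smooth_on U (\<lambda>y. - f y)"
  by (rule smooth_on_linear[OF bounded_linear_minus[OF bounded_linear_ident]])

lemma smooth_on_diff: "smooth_on U f \<Longrightarrow> smooth_on U g \<Longrightarrow> smooth_on U (\<lambda>y. f y - g y)"
  using smooth_on_add[OF _ smooth_on_minus, of f g] by simp

lemma smooth_on_sum:
  "(\<And>a. a \<in> S \<Longrightarrow> smooth_on U (f a)) \<Longrightarrow> smooth_on U (\<lambda>y. \<Sum>a\<in>S. f a y)"
  by (induction S rule: infinite_finite_induct) (auto intro!: smooth_on_add)

lemma smooth_on_cnj: "smooth_on U f \<Longrightarrow> smooth_on U (\<lambda>y. cnj (f y))"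
  by (rule smooth_on_linear[OF bounded_linear_cnj])

lemma smooth_on_of_real:
  "smooth_on U f \<Longrightarrow> smooth_on U (\<lambda>y. of_real (f y) :: 'a::{real_normed_algebra_1})"
  by (rule smooth_on_linear[OF bounded_linear_of_real])

lemma smooth_on_nth: "smooth_on U f \<Longrightarrow> smooth_on U (\<lambda>y. f y $ k)"
  by (rule smooth_on_linear[OF bounded_linear_vec_nth])

lemma ndiff_id: "ndiff n U (\<lambda>y. y)"
proof -
  have *: "pd i (\<lambda>y::real^'d. y) = (\<lambda>_. axis i 1)" for i
    by (rule ext, subst pd_eq[where D = "\<lambda>h. h"]) auto
  show ?thesis
  proof (cases n)
    case (Suc m)
    then show ?thesis by (simp add: * smooth_on_const[unfolded smooth_on_iff_ndiff, rule_format])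
  qed auto
qed

lemma smooth_on_id: "smooth_on U (\<lambda>y. y)"
  using ndiff_id by (simp add: smooth_on_iff_ndiff)

lemma smooth_on_inverse:
  fixes f :: "real^'d \<Rightarrow> 'a::real_normed_field"
  assumes "smooth_on U f" and nz: "\<And>y. y \<in> U \<Longrightarrow> f y \<noteq> 0"
  shows "smooth_on U (\<lambda>y. inverse (f y))"
proof -
  have d: "(\<lambda>y. inverse (f y)) differentiable_on U"
    using smooth_on_differentiable[OF assms(1) U] nz U
    by (auto simp: differentiable_on_eq_differentiable_at intro!: differentiable_inverse)
  have "ndiff n U (\<lambda>y. inverse (f y))" for n
  proof (induction n)
    case 0 then show ?case using d by simp
  next
    case (Suc n)
    have "pd i (\<lambda>y. inverse (f y)) x = - (inverse (f x) * pd i f x * inverse (f x))" if x: "x \<in> U" for i x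
    proof -
      obtain D where D: "(f has_derivative D) (at x)"
        using smooth_on_differentiable[OF assms(1) U x] unfolding differentiable_def by blast
      from pd_eq[OF Deriv.has_derivative_inverse[OF nz[OF x] D]] pd_eq[OF D] show ?thesis by simp
    qed
    moreover have "ndiff n U (\<lambda>x. - (inverse (f x) * pd i f x * inverse (f x)))" for i
      using smooth_on_pd[OF assms(1)]
      by (intro ndiff_linear[OF bounded_linear_minus[OF bounded_linear_ident]]
          ndiff_bilinear[OF bounded_bilinear_mult] Suc.IH) (auto simp: smooth_on_iff_ndiff)
    ultimately have "ndiff n U (pd i (\<lambda>y. inverse (f y)))" for i
      using ndiff_cong[OF U, of "pd i (\<lambda>y. inverse (f y))"] by auto
    then show ?case using d by simp
  qed
  then show ?thesis by (simp add: smooth_on_iff_ndiff)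
qed

lemma smooth_on_divide:
  fixes f :: "real^'d \<Rightarrow> 'a::real_normed_field"
  assumes "smooth_on U f" "smooth_on U g" and "\<And>y. y \<in> U \<Longrightarrow> g y \<noteq> 0"
  shows "smooth_on U (\<lambda>y. f y / g y)"
  unfolding divide_inverse by (intro smooth_on_mult smooth_on_inverse assms)

lemma smooth_on_axis:
  fixes f :: "real^'d \<Rightarrow> 'b::real_normed_vector"
  assumes "smooth_on U f"
  shows "smooth_on U (\<lambda>y. axis k (f y))"
proof (rule smooth_on_linear[OF _ assms])
  have "norm (axis k z) = norm z" for z :: 'b
  proof -
    have "(\<Sum>i\<in>UNIV. (norm (axis k z $ i))\<^sup>2) = (norm z)\<^sup>2"
      by (subst sum.mono_neutral_right[where S = "{k}"]) (auto simp: axis_def)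
    then show ?thesis by (simp add: norm_vec_def L2_set_def)
  qed
  then show "bounded_linear (\<lambda>z::'b. axis k z)"
    by (intro bounded_linear_intro[where K = 1]) (auto simp: axis_def vec_eq_iff)
qed

lemma smooth_on_vec:
  fixes f :: "real^'d \<Rightarrow> ('a::real_normed_vector)^'k::finite"
  assumes "\<And>k. smooth_on U (\<lambda>y. f y $ k)"
  shows "smooth_on U f"
proof -
  have "f = (\<lambda>y. \<Sum>k\<in>UNIV. axis k (f y $ k))"
    by (simp add: fun_eq_iff vec_eq_iff axis_def)
  moreover have "smooth_on U (\<lambda>y. \<Sum>k\<in>UNIV. axis k (f y $ k))"
    by (intro smooth_on_sum smooth_on_axis assms)
  ultimately show ?thesis by simp
qed

end

lemma smooth_on_continuous:
  assumes "smooth_on U f" shows "continuous_on U f"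
proof -
  have "foldr pd [] f differentiable_on U" using assms(1) unfolding smooth_on_def by blast
  then show ?thesis by (simp add: differentiable_imp_continuous_on)
qed

lemma smooth_on_subset: "smooth_on U f \<Longrightarrow> V \<subseteq> U \<Longrightarrow> smooth_on V f"
  unfolding smooth_on_def using differentiable_on_subset by blast

section \<open>Symmetry of mixed partial derivatives\<close>

lemma pd_real_mean_value:
  fixes f :: "real^'d::finite \<Rightarrow> real"
  assumes s: "0 < s" and d: "\<And>t. 0 \<le> t \<Longrightarrow> t \<le> s \<Longrightarrow> f differentiable (at (x + t *\<^sub>R axis i 1))"
  obtains t where "0 < t" "t < s" "f (x + s *\<^sub>R axis i 1) - f x = s * pd i f (x + t *\<^sub>R axis i 1)"
proof -
  let ?h = "\<lambda>t. f (x + t *\<^sub>R axis i 1)"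
  have der: "(?h has_real_derivative pd i f (x + t *\<^sub>R axis i 1)) (at t)" if "0 \<le> t" "t \<le> s" for t
    using has_vector_derivative_pd[OF d[OF that]] by (simp add: has_real_derivative_iff_has_vector_derivative)
  obtain t where "0 < t" "t < s" "?h s - ?h 0 = (s - 0) * pd i f (x + t *\<^sub>R axis i 1)"
    using MVT2[OF s der] by blast
  then show ?thesis using that by simp
qed

text \<open>The second difference quotient of \<open>f\<close> over a small square is, by two applications of the mean
  value theorem, a value of the mixed derivative in either order; the continuity of both mixed
  derivatives gives their equality.\<close>

lemma second_difference_mean_value:
  fixes f :: "real^'d::finite \<Rightarrow> real"
  assumes "open U" "smooth_on U f" and s: "0 < s"
    and sub: "\<And>a b. 0 \<le> a \<Longrightarrow> a \<le> s \<Longrightarrow> 0 \<le> b \<Longrightarrow> b \<le> s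
      \<Longrightarrow> x + a *\<^sub>R axis i 1 + b *\<^sub>R axis j 1 \<in> U"
  obtains a b where "0 \<le> a" "a \<le> s" "0 \<le> b" "b \<le> s"
    "f (x + s *\<^sub>R axis i 1 + s *\<^sub>R axis j 1) - f (x + s *\<^sub>R axis i 1) - f (x + s *\<^sub>R axis j 1) + f x
      = s * s * pd j (pd i f) (x + a *\<^sub>R axis i 1 + b *\<^sub>R axis j 1)"
proof -
  define v where "v = s *\<^sub>R axis j (1::real)"
  define h where "h = (\<lambda>y. f (y + v) - f y)"
  have dU: "f differentiable (at y)" if "y \<in> U" for y
    using smooth_on_differentiable[OF assms(2,1) that] .
  have shift: "((\<lambda>z. f (z + v)) has_derivative D) (at y)"
    if "(f has_derivative D) (at (y + v))" for y D
  proof -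
    have "((\<lambda>z. z + v) has_derivative (\<lambda>h. h)) (at y)" by (auto intro!: derivative_eq_intros)
    from has_derivative_compose[OF this that] show ?thesis .
  qed
  have h: "h differentiable (at y) \<and> pd i h y = pd i f (y + v) - pd i f y" if "y \<in> U" "y + v \<in> U" for y
  proof -
    have "f differentiable (at y)" "f differentiable (at (y + v))" using dU that by auto
    then obtain D D' where D: "(f has_derivative D) (at y)" "(f has_derivative D') (at (y + v))"
      unfolding differentiable_def by blast
    have "(h has_derivative (\<lambda>z. D' z - D z)) (at y)"
      unfolding h_def by (intro has_derivative_diff shift D)
    then show ?thesis using pd_eq[OF D(1)] pd_eq[OF D(2)] pd_eq[of h _ y i] unfolding differentiable_def by auto
  qed
  have in1: "x + t *\<^sub>R axis i 1 \<in> U" "x + t *\<^sub>R axis i 1 + v \<in> U" if "0 \<le> t" "t \<le> s" for t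
    using sub[OF that, of 0] sub[OF that, of s] s by (auto simp: v_def)
  obtain a where a: "0 < a" "a < s" "h (x + s *\<^sub>R axis i 1) - h x = s * pd i h (x + a *\<^sub>R axis i 1)"
    using pd_real_mean_value[OF s, of h x i] h in1 by blast
  let ?y = "x + a *\<^sub>R axis i 1"
  have "pd i f differentiable (at (?y + t *\<^sub>R axis j 1))" if "0 \<le> t" "t \<le> s" for t
    using smooth_on_differentiable[OF smooth_on_pd[OF assms(2)] assms(1)] sub[of a t] that a by auto
  then obtain b where b: "0 < b" "b < s" "pd i f (?y + v) - pd i f ?y = s * pd j (pd i f) (?y + b *\<^sub>R axis j 1)"
    using pd_real_mean_value[OF s, of "pd i f" ?y j] unfolding v_def by blast
  have "h (x + s *\<^sub>R axis i 1) - h x = s * (s * pd j (pd i f) (?y + b *\<^sub>R axis j 1))"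
    using a b h[OF in1[of a]] by simp
  then show ?thesis using that[of a b] a b by (simp add: h_def v_def algebra_simps)
qed

lemma pd_commute_real:
  fixes f :: "real^'d::finite \<Rightarrow> real"
  assumes U: "open U" and f: "smooth_on U f" and x: "x \<in> U"
  shows "pd i (pd j f) x = pd j (pd i f) x"
proof -
  obtain e where e: "e > 0" "ball x e \<subseteq> U" using U x open_contains_ball by blast
  have inU: "x + a *\<^sub>R axis k 1 + b *\<^sub>R axis l 1 \<in> ball x (3 * s)"
    if "0 < s" "0 \<le> a" "a \<le> s" "0 \<le> b" "b \<le> s" for a b s k l
  proof -
    have "norm (a *\<^sub>R axis k 1 + b *\<^sub>R axis l (1::real) :: real^'d) \<le> a + b"
      using norm_triangle_ineq[of "a *\<^sub>R axis k (1::real)" "b *\<^sub>R axis l 1"] that by simp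
    moreover have "dist x (x + a *\<^sub>R axis k 1 + b *\<^sub>R axis l 1)
        = norm (a *\<^sub>R axis k 1 + b *\<^sub>R axis l (1::real) :: real^'d)"
      by (metis add.assoc add_diff_cancel_left' dist_commute dist_norm)
    ultimately show ?thesis using that by simp
  qed
  have cont: "isCont (pd k (pd l f)) x" for k l
    using smooth_on_continuous[OF smooth_on_pd[OF smooth_on_pd[OF f]]] U x
    by (simp add: continuous_on_eq_continuous_at)
  have "dist (pd i (pd j f) x) (pd j (pd i f) x) < r" if r: "r > 0" for r
  proof -
    obtain d1 where d1: "d1 > 0" "\<And>y. dist y x < d1 \<Longrightarrow> dist (pd i (pd j f) y) (pd i (pd j f) x) < r/2"
      using cont[of i j, unfolded continuous_within_eps_delta, rule_format, of "r/2"] r by auto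
    obtain d2 where d2: "d2 > 0" "\<And>y. dist y x < d2 \<Longrightarrow> dist (pd j (pd i f) y) (pd j (pd i f) x) < r/2"
      using cont[of j i, unfolded continuous_within_eps_delta, rule_format, of "r/2"] r by auto
    define s where "s = min e (min d1 d2) / 3"
    have s: "0 < s" "3 * s \<le> e" "3 * s \<le> d1" "3 * s \<le> d2" using e d1 d2 by (auto simp: s_def)
    have sub: "x + a *\<^sub>R axis k 1 + b *\<^sub>R axis l 1 \<in> U" if "0 \<le> a" "a \<le> s" "0 \<le> b" "b \<le> s" for a b k l
      using inU[OF s(1) that, of k l] e s by (auto simp: dist_commute)
    obtain a b where ab: "0 \<le> a" "a \<le> s" "0 \<le> b" "b \<le> s"
      "f (x + s *\<^sub>R axis i 1 + s *\<^sub>R axis j 1) - f (x + s *\<^sub>R axis i 1) - f (x + s *\<^sub>R axis j 1) + f x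
        = s * s * pd j (pd i f) (x + a *\<^sub>R axis i 1 + b *\<^sub>R axis j 1)"
      using second_difference_mean_value[OF U f s(1) sub] by blast
    obtain a' b' where ab': "0 \<le> a'" "a' \<le> s" "0 \<le> b'" "b' \<le> s"
      "f (x + s *\<^sub>R axis j 1 + s *\<^sub>R axis i 1) - f (x + s *\<^sub>R axis j 1) - f (x + s *\<^sub>R axis i 1) + f x
        = s * s * pd i (pd j f) (x + a' *\<^sub>R axis j 1 + b' *\<^sub>R axis i 1)"
      using second_difference_mean_value[OF U f s(1) sub] by blast
    have sw: "x + s *\<^sub>R axis j 1 + s *\<^sub>R axis i 1 = x + s *\<^sub>R axis i 1 + s *\<^sub>R axis j (1::real)"
      by (simp add: algebra_simps)
    have "s * s * pd i (pd j f) (x + a' *\<^sub>R axis j 1 + b' *\<^sub>R axis i 1)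
        = s * s * pd j (pd i f) (x + a *\<^sub>R axis i 1 + b *\<^sub>R axis j 1)"
      using ab(5) ab'(5)[unfolded sw] by linarith
    then have eq: "pd i (pd j f) (x + a' *\<^sub>R axis j 1 + b' *\<^sub>R axis i 1)
        = pd j (pd i f) (x + a *\<^sub>R axis i 1 + b *\<^sub>R axis j 1)"
      using s(1) by simp
    have "dist (pd j (pd i f) (x + a *\<^sub>R axis i 1 + b *\<^sub>R axis j 1)) (pd j (pd i f) x) < r/2"
    proof (rule d2(2))
      show "dist (x + a *\<^sub>R axis i 1 + b *\<^sub>R axis j 1) x < d2"
        using inU[OF s(1) ab(1-4), of i j] s(4) by (simp add: dist_commute)
    qed
    moreover have "dist (pd i (pd j f) (x + a' *\<^sub>R axis j 1 + b' *\<^sub>R axis i 1)) (pd i (pd j f) x) < r/2"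
    proof (rule d1(2))
      show "dist (x + a' *\<^sub>R axis j 1 + b' *\<^sub>R axis i 1) x < d1"
        using inU[OF s(1) ab'(1-4), of j i] s(3) by (simp add: dist_commute)
    qed
    ultimately show ?thesis
      unfolding eq using dist_triangle_half_r by blast
  qed
  from this[of "dist (pd i (pd j f) x) (pd j (pd i f) x)"] show ?thesis by auto
qed

lemma pd_commute:
  fixes f :: "real^'d::finite \<Rightarrow> complex"
  assumes U: "open U" and f: "smooth_on U f" and x: "x \<in> U"
  shows "pd i (pd j f) x = pd j (pd i f) x"
proof -
  have *: "pd k (pd l (\<lambda>y. L (f y))) x = L (pd k (pd l f) x)"
    if L: "bounded_linear L" for L :: "complex \<Rightarrow> real" and k l
  proof -
    have "pd k (pd l (\<lambda>y. L (f y))) x = pd k (\<lambda>y. L (pd l f y)) x"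
      by (rule pd_cong[OF U x], rule pd_linear[OF L smooth_on_differentiable[OF f U]])
    also have "\<dots> = L (pd k (pd l f) x)"
      by (rule pd_linear[OF L smooth_on_differentiable[OF smooth_on_pd[OF f] U x]])
    finally show ?thesis .
  qed
  show ?thesis
  proof (rule complex_eqI)
    show "Re (pd i (pd j f) x) = Re (pd j (pd i f) x)"
      unfolding *[OF bounded_linear_Re, symmetric]
      by (rule pd_commute_real[OF U smooth_on_linear[OF U bounded_linear_Re f] x])
    show "Im (pd i (pd j f) x) = Im (pd j (pd i f) x)"
      unfolding *[OF bounded_linear_Im, symmetric]
      by (rule pd_commute_real[OF U smooth_on_linear[OF U bounded_linear_Im f] x])
  qed
qed

lemma foldr_pd_move:
  fixes f :: "real^'d::finite \<Rightarrow> complex"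
  assumes U: "open U" and f: "smooth_on U f" and x: "x \<in> U"
  shows "foldr pd (v @ i # w) f x = foldr pd (i # v @ w) f x"
  using x
proof (induction v arbitrary: x)
  case Nil then show ?case by simp
next
  case (Cons j v)
  have "foldr pd ((j # v) @ i # w) f x = pd j (pd i (foldr pd (v @ w) f)) x"
    using Cons.IH by (auto intro!: pd_cong[OF U Cons.prems])
  also have "\<dots> = pd i (pd j (foldr pd (v @ w) f)) x"
    by (rule pd_commute[OF U smooth_on_foldr_pd[OF f] Cons.prems])
  finally show ?case by simp
qed

lemma foldr_pd_mset:
  fixes f :: "real^'d::finite \<Rightarrow> complex"
  assumes U: "open U" and f: "smooth_on U f" and x: "x \<in> U" and "mset v = mset w"
  shows "foldr pd v f x = foldr pd w f x"
  using assms(4) x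
proof (induction v arbitrary: w x)
  case Nil then show ?case by simp
next
  case (Cons i v)
  then have "i \<in> set w" by (metis list.set_intros(1) mset_eq_setD)
  then obtain p q where w: "w = p @ i # q" by (meson split_list)
  have "foldr pd (i # v) f x = foldr pd (i # p @ q) f x"
    using Cons.IH[of "p @ q"] Cons.prems(1) w by (auto intro!: pd_cong[OF U Cons.prems(2)])
  then show ?case using foldr_pd_move[OF U f Cons.prems(2)] w by metis
qed

section \<open>Multi-indices\<close>

lemma coords: "distinct (coords :: 'd::finite list)" "set (coords :: 'd list) = UNIV"
proof -
  have "\<exists>is :: 'd list. distinct is \<and> set is = UNIV"
    using finite_distinct_list[of "UNIV :: 'd set"] by auto
  from someI_ex[OF this] show "distinct (coords :: 'd list)" "set (coords :: 'd list) = UNIV"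
    unfolding coords_def by auto
qed

text \<open>Words of indices allow induction on one derivative at a time, which multi-indices do not, the order of
  differentiation in \<open>mpd\<close> being fixed.\<close>

definition mword :: "'d::finite mindex \<Rightarrow> 'd list" where
  "mword \<alpha> = concat (map (\<lambda>i. replicate (\<alpha> i) i) coords)"

lemma mpd_mword: "mpd \<alpha> f = foldr pd (mword \<alpha>) f"
proof -
  have "foldr (\<lambda>i. pd i ^^ \<alpha> i) is f = foldr pd (concat (map (\<lambda>i. replicate (\<alpha> i) i) is)) f" for "is"
    by (induction "is") (auto simp: foldr_replicate)
  then show ?thesis unfolding mpd_def mword_def .
qed

lemma count_mword: "count (mset (mword \<alpha>)) = \<alpha>"
proof
  fix j
  have "count (mset (concat (map (\<lambda>i. replicate (\<alpha> i) i) is))) j = (if j \<in> set is then \<alpha> j else 0)"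
    if "distinct is" for "is"
    using that by (induction "is") auto
  from this[OF coords(1)] show "count (mset (mword \<alpha>)) j = \<alpha> j"
    by (simp add: mword_def coords)
qed

lemma mabs_count: "mabs (count M) = size M"
  unfolding mabs_def size_multiset_overloaded_eq
  by (rule sum.mono_neutral_right) (auto simp: not_in_iff)

lemma length_mword: "length (mword \<alpha>) = mabs \<alpha>"
  using mabs_count[of "mset (mword \<alpha>)"] by (simp add: count_mword)

text \<open>The bridge from the iterated derivatives in the model operators to multi-indices; it rests on the
  symmetry of mixed derivatives.\<close>

lemma mpd_count:
  fixes f :: "real^'d::finite \<Rightarrow> complex"
  assumes U: "open U" and f: "smooth_on U f" and x: "x \<in> U"
  shows "mpd (count (mset w)) f x = foldr pd w f x"
proof -
  have "mset (mword (count (mset w))) = mset w"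
    by (rule multiset_eqI) (metis count_mword)
  then show ?thesis unfolding mpd_mword by (rule foldr_pd_mset[OF U f x])
qed

lemma finite_mabs_le [simp]: "finite {\<alpha>::'d::finite mindex. mabs \<alpha> \<le> n}"
proof (rule finite_subset)
  show "{\<alpha>::'d mindex. mabs \<alpha> \<le> n} \<subseteq> PiE UNIV (\<lambda>_. {..n})"
  proof
    fix \<alpha> :: "'d mindex" assume "\<alpha> \<in> {\<alpha>. mabs \<alpha> \<le> n}"
    then have "\<alpha> i \<le> n" for i
      using member_le_sum[of i UNIV \<alpha>] by (simp add: mabs_def)
    then show "\<alpha> \<in> PiE UNIV (\<lambda>_. {..n})" by auto
  qed
qed (auto intro: finite_PiE)

lemma finite_mabs_eq [simp]: "finite {\<alpha>::'d::finite mindex. mabs \<alpha> = n}"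
  by (rule finite_subset[OF _ finite_mabs_le[of n]]) auto

lemma mpd_cong:
  assumes "open U" "x \<in> U" "\<And>y. y \<in> U \<Longrightarrow> f y = g y"
  shows "mpd \<alpha> f x = mpd \<alpha> g x"
  unfolding mpd_mword by (rule foldr_pd_cong[OF assms(1,3,2)])

lemma smooth_on_mpd: "smooth_on U f \<Longrightarrow> smooth_on U (mpd \<alpha> f)"
  unfolding mpd_mword by (rule smooth_on_foldr_pd)

lemma mpd_zero [simp]: "mpd \<alpha> (\<lambda>_. 0) = (\<lambda>_. 0)"
  unfolding mpd_mword by simp

context
  fixes U :: "(real^'d::finite) set"
  assumes U: "open U"
begin

lemma foldr_pd_linear:
  assumes "bounded_linear L" "smooth_on U f" "x \<in> U"
  shows "foldr pd w (\<lambda>y. L (f y)) x = L (foldr pd w f x)"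
  using assms(3)
proof (induction w arbitrary: x)
  case Nil then show ?case by simp
next
  case (Cons i w)
  have "foldr pd (i # w) (\<lambda>y. L (f y)) x = pd i (\<lambda>y. L (foldr pd w f y)) x"
    using Cons.IH by (auto intro!: pd_cong[OF U Cons.prems])
  also have "\<dots> = L (foldr pd (i # w) f x)"
    using pd_linear[OF assms(1) smooth_on_differentiable[OF smooth_on_foldr_pd[OF assms(2)] U Cons.prems]]
    by simp
  finally show ?case .
qed

lemma mpd_linear:
  "bounded_linear L \<Longrightarrow> smooth_on U f \<Longrightarrow> x \<in> U \<Longrightarrow> mpd \<alpha> (\<lambda>y. L (f y)) x = L (mpd \<alpha> f x)"
  unfolding mpd_mword by (rule foldr_pd_linear)

lemma mpd_add:
  fixes f g :: "real^'d \<Rightarrow> 'a::real_normed_vector"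
  assumes "smooth_on U f" "smooth_on U g" "x \<in> U"
  shows "mpd \<alpha> (\<lambda>y. f y + g y) x = mpd \<alpha> f x + mpd \<alpha> g x"
proof -
  have "foldr pd w (\<lambda>y. f y + g y) x = foldr pd w f x + foldr pd w g x" for w
    using assms(3)
  proof (induction w arbitrary: x)
    case Nil then show ?case by simp
  next
    case (Cons i w)
    have "foldr pd (i # w) (\<lambda>y. f y + g y) x = pd i (\<lambda>y. foldr pd w f y + foldr pd w g y) x"
      using Cons.IH by (auto intro!: pd_cong[OF U Cons.prems])
    also have "\<dots> = foldr pd (i # w) f x + foldr pd (i # w) g x"
      using pd_add[OF smooth_on_differentiable[OF smooth_on_foldr_pd[OF assms(1)] U Cons.prems]
          smooth_on_differentiable[OF smooth_on_foldr_pd[OF assms(2)] U Cons.prems]]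
      by simp
    finally show ?case .
  qed
  then show ?thesis unfolding mpd_mword .
qed

lemma mpd_sum:
  fixes f :: "'b \<Rightarrow> real^'d \<Rightarrow> 'a::real_normed_vector"
  assumes "\<And>a. a \<in> S \<Longrightarrow> smooth_on U (f a)" "x \<in> U"
  shows "mpd \<alpha> (\<lambda>y. \<Sum>a\<in>S. f a y) x = (\<Sum>a\<in>S. mpd \<alpha> (f a) x)"
  using assms(1)
proof (induction S rule: infinite_finite_induct)
  case (insert a S)
  then show ?case
    using mpd_add[of "f a" "\<lambda>y. \<Sum>a\<in>S. f a y" x \<alpha>] smooth_on_sum[OF U, of S f] assms(2) by simp
qed auto

lemma mpd_cnj:
  fixes f :: "real^'d \<Rightarrow> complex"
  assumes "smooth_on U f" "x \<in> U"
  shows "mpd \<alpha> (\<lambda>y. cnj (f y)) x = cnj (mpd \<alpha> f x)"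
  by (rule mpd_linear[OF bounded_linear_cnj assms])

end

section \<open>The Leibniz rule\<close>

text \<open>The coefficients in the Leibniz rule \<open>\<partial>\<^sup>w (a f) = \<Sum>\<^sub>\<beta> c\<^sub>\<beta> \<partial>\<^sup>\<beta> f\<close>, generated by applying the
  derivatives in \<open>w\<close> one after the other.\<close>
fun leib :: "'d::finite list \<Rightarrow> (real^'d \<Rightarrow> complex) \<Rightarrow> 'd mindex \<Rightarrow> real^'d \<Rightarrow> complex" where
  "leib [] a \<beta> = (if \<beta> = (\<lambda>_. 0) then a else (\<lambda>_. 0))"
| "leib (i # w) a \<beta> = (\<lambda>x. pd i (leib w a \<beta>) x
     + (if \<beta> i = 0 then 0 else leib w a (\<beta>(i := \<beta> i - 1)) x))"

lemma mabs_upd: "mabs (\<beta>(i := n)) + \<beta> i = mabs \<beta> + n"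
  unfolding mabs_def by (simp add: sum.remove[of UNIV i])

lemma leib_above: "mabs \<beta> > length w \<Longrightarrow> leib w a \<beta> = (\<lambda>_. 0)"
proof (induction w arbitrary: \<beta>)
  case Nil then show ?case by (auto simp: mabs_def)
next
  case (Cons i w)
  have "leib w a \<beta> = (\<lambda>_. 0)" using Cons by simp
  moreover have "leib w a (\<beta>(i := \<beta> i - 1)) = (\<lambda>_. 0)" if "\<beta> i \<noteq> 0"
  proof (rule Cons.IH)
    have "Suc (length w) < mabs \<beta>" using Cons.prems by simp
    then show "length w < mabs (\<beta>(i := \<beta> i - 1))"
      using that mabs_upd[of \<beta> i "\<beta> i - 1"] by linarith
  qed
  ultimately show ?case by (cases "\<beta> i = 0") simp_all
qed

lemma count_lowered_eq_iff:
  assumes "\<beta> i \<noteq> 0"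
  shows "\<beta>(i := \<beta> i - 1) = count (mset w) \<longleftrightarrow> \<beta> = count (mset (i # w))"
proof -
  have "(\<forall>j. (\<beta>(i := \<beta> i - 1)) j = count (mset w) j) \<longleftrightarrow> (\<forall>j. \<beta> j = count (mset (i # w)) j)"
  proof (rule all_cong1)
    show "(\<beta>(i := \<beta> i - 1)) j = count (mset w) j \<longleftrightarrow> \<beta> j = count (mset (i # w)) j" for j
      using assms by (cases "j = i") auto
  qed
  then show ?thesis unfolding fun_eq_iff .
qed

text \<open>In the terms of top order no derivative falls on \<open>a\<close>.\<close>

lemma leib_top: "mabs \<beta> = length w \<Longrightarrow> leib w a \<beta> = (if \<beta> = count (mset w) then a else (\<lambda>_. 0))"
proof (induction w arbitrary: \<beta>)
  case Nil
  then show ?case by auto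
next
  case (Cons i w)
  have len: "mabs \<beta> = Suc (length w)" using Cons.prems by simp
  then have z: "leib w a \<beta> = (\<lambda>_. 0)" by (intro leib_above) simp
  show ?case
  proof (cases "\<beta> i = 0")
    case True
    then have "\<beta> \<noteq> count (mset (i # w))" by auto
    then show ?thesis using True z by (simp del: mset.simps)
  next
    case False
    then have "mabs (\<beta>(i := \<beta> i - 1)) = length w"
      using len mabs_upd[of \<beta> i "\<beta> i - 1"] by linarith
    then have "leib w a (\<beta>(i := \<beta> i - 1)) = (if \<beta> = count (mset (i # w)) then a else (\<lambda>_. 0))"
      using Cons.IH count_lowered_eq_iff[of \<beta> i, OF False] by presburger
    then show ?thesis using False z by (auto simp del: mset.simps)
  qed
qed

lemma leib_const: "leib w (\<lambda>_. c) \<beta> = (\<lambda>_. if \<beta> = count (mset w) then c else 0)"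
proof (induction w arbitrary: \<beta>)
  case Nil
  then show ?case by auto
next
  case (Cons i w)
  show ?case
  proof (cases "\<beta> i = 0")
    case True
    then have "\<beta> \<noteq> count (mset (i # w))" by auto
    then show ?thesis using True by (simp add: Cons.IH del: mset.simps)
  next
    case False
    then show ?thesis
      unfolding leib.simps Cons.IH pd_const count_lowered_eq_iff[of \<beta> i, OF False]
      by (simp del: mset.simps)
  qed
qed

lemma smooth_on_leib:
  assumes "open U" "smooth_on U a"
  shows "smooth_on U (leib w a \<beta>)"
  using assms
proof (induction w arbitrary: \<beta>)
  case (Cons i w)
  have "smooth_on U (\<lambda>x. if \<beta> i = 0 then 0 else leib w a (\<beta>(i := \<beta> i - 1)) x)"
    using Cons by (cases "\<beta> i = 0") auto
  then show ?case using Cons by (auto intro!: smooth_on_add smooth_on_pd)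
qed auto

lemma foldr_pd_mult:
  fixes f :: "real^'d::finite \<Rightarrow> complex"
  assumes U: "open U" and a: "smooth_on U a" and f: "smooth_on U f" and x: "x \<in> U"
  shows "foldr pd w (\<lambda>y. a y * f y) x = (\<Sum>\<beta> | mabs \<beta> \<le> length w. leib w a \<beta> x * mpd \<beta> f x)"
  using x
proof (induction w arbitrary: x)
  case Nil
  have "{\<beta>::'d mindex. mabs \<beta> = 0} = {\<lambda>_. 0}" by (auto simp: mabs_def)
  moreover have "count {#} = (\<lambda>_::'d. 0)" by auto
  ultimately show ?case using mpd_count[OF U f Nil, of "[]"] by simp
next
  case (Cons i w)
  let ?S = "{\<beta>::'d mindex. mabs \<beta> \<le> length w}" and ?T = "{\<beta>::'d mindex. mabs \<beta> \<le> Suc (length w)}"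
  note dl = smooth_on_differentiable[OF smooth_on_leib[OF U a] U Cons.prems]
  note df = smooth_on_differentiable[OF smooth_on_mpd[OF f] U Cons.prems]
  have pd_mpd: "pd i (mpd \<beta> f) x = mpd (\<beta>(i := Suc (\<beta> i))) f x" for \<beta>
  proof -
    have "count (mset (i # mword \<beta>)) = \<beta>(i := Suc (\<beta> i))" using count_mword[of \<beta>] by auto
    then show ?thesis using mpd_count[OF U f Cons.prems, of "i # mword \<beta>"] by (simp add: mpd_mword)
  qed
  have "foldr pd (i # w) (\<lambda>y. a y * f y) x = pd i (\<lambda>y. \<Sum>\<beta>\<in>?S. leib w a \<beta> y * mpd \<beta> f y) x"
    using Cons.IH by (auto intro!: pd_cong[OF U Cons.prems])
  also have "\<dots> = (\<Sum>\<beta>\<in>?S. pd i (\<lambda>y. leib w a \<beta> y * mpd \<beta> f y) x)"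
    using mpd_sum[OF U, of ?S "\<lambda>\<beta> y. leib w a \<beta> y * mpd \<beta> f y" x "count (mset [i])"]
      smooth_on_mult[OF U smooth_on_leib[OF U a] smooth_on_mpd[OF f]] Cons.prems
      mpd_count[OF U _ Cons.prems, of _ "[i]"] smooth_on_sum[OF U, of ?S "\<lambda>\<beta> y. leib w a \<beta> y * mpd \<beta> f y"]
    by simp
  also have "\<dots> = (\<Sum>\<beta>\<in>?S. pd i (leib w a \<beta>) x * mpd \<beta> f x)
      + (\<Sum>\<beta>\<in>?S. leib w a \<beta> x * mpd (\<beta>(i := Suc (\<beta> i))) f x)"
    by (simp add: pd_bilinear[OF bounded_bilinear_mult dl df] pd_mpd sum.distrib)
  also have "(\<Sum>\<beta>\<in>?S. pd i (leib w a \<beta>) x * mpd \<beta> f x) = (\<Sum>\<beta>\<in>?T. pd i (leib w a \<beta>) x * mpd \<beta> f x)"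
    by (rule sum.mono_neutral_left) (auto simp: leib_above)
  also have "(\<Sum>\<beta>\<in>?S. leib w a \<beta> x * mpd (\<beta>(i := Suc (\<beta> i))) f x)
      = (\<Sum>\<beta>\<in>{\<beta>\<in>?T. \<beta> i \<noteq> 0}. leib w a (\<beta>(i := \<beta> i - 1)) x * mpd \<beta> f x)"
  proof (rule sum.reindex_bij_witness[where i = "\<lambda>\<beta>. \<beta>(i := \<beta> i - 1)" and j = "\<lambda>\<beta>. \<beta>(i := Suc (\<beta> i))"])
    fix \<beta> :: "'d mindex"
    assume "\<beta> \<in> ?S" then show "\<beta>(i := Suc (\<beta> i)) \<in> {\<beta>\<in>?T. \<beta> i \<noteq> 0}"
      using mabs_upd[of \<beta> i "Suc (\<beta> i)"] by auto
  next
    fix \<beta> :: "'d mindex"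
    assume "\<beta> \<in> {\<beta>\<in>?T. \<beta> i \<noteq> 0}" then show "\<beta>(i := \<beta> i - 1) \<in> ?S"
      using mabs_upd[of \<beta> i "\<beta> i - 1"] by auto
  qed auto
  also have "\<dots> = (\<Sum>\<beta>\<in>?T. (if \<beta> i = 0 then 0 else leib w a (\<beta>(i := \<beta> i - 1)) x) * mpd \<beta> f x)"
    by (rule sum.mono_neutral_cong_left) auto
  finally show ?case by (simp add: sum.distrib[symmetric] distrib_right)
qed

lemma mpd_mult:
  fixes f :: "real^'d::finite \<Rightarrow> complex"
  assumes "open U" "smooth_on U a" "smooth_on U f" "x \<in> U"
  shows "mpd \<alpha> (\<lambda>y. a y * f y) x = (\<Sum>\<beta> | mabs \<beta> \<le> mabs \<alpha>. leib (mword \<alpha>) a \<beta> x * mpd \<beta> f x)"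
  using foldr_pd_mult[OF assms, of "mword \<alpha>"] by (simp add: mpd_mword length_mword)

section \<open>Monomials\<close>

definition monom_at :: "real^'d::finite \<Rightarrow> 'd mindex \<Rightarrow> real^'d \<Rightarrow> complex" where
  "monom_at x \<beta> y = (\<Prod>i\<in>UNIV. of_real (y $ i - x $ i) ^ \<beta> i)"

lemma has_derivative_coord:
  "((\<lambda>y. of_real (y $ i - x $ i) ^ n :: complex) has_derivative
     (\<lambda>h. of_nat n * of_real (h $ i) * of_real (y $ i - x $ i) ^ (n - 1))) (at (y :: real^'d::finite))"
proof -
  have "((\<lambda>y. of_real (y $ i - x $ i) :: complex) has_derivative (\<lambda>h. of_real (h $ i))) (at y)"
    by (auto intro!: derivative_eq_intros bounded_linear_imp_has_derivative[OF bounded_linear_vec_nth])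
  from has_derivative_power[OF this, of n] show ?thesis by simp
qed

lemma monom_at_split:
  "monom_at x \<beta> y = of_real (y $ i - x $ i) ^ \<beta> i * (\<Prod>j\<in>UNIV - {i}. of_real (y $ j - x $ j) ^ \<beta> j)"
  unfolding monom_at_def by (simp add: prod.remove[of UNIV i])

lemma monom_at_differentiable: "monom_at x \<beta> differentiable (at y)"
proof -
  have "(\<lambda>y. of_real (y $ i - x $ i) ^ \<beta> i :: complex) differentiable (at y)" for i
    using has_derivative_coord unfolding differentiable_def by blast
  then have "(\<lambda>y. \<Prod>i\<in>S. of_real (y $ i - x $ i) ^ \<beta> i :: complex) differentiable (at y)" for S
    by (induction S rule: infinite_finite_induct) (simp_all add: differentiable_mult del: of_real_diff)
  then show ?thesis unfolding monom_at_def by (simp add: fun_eq_iff)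
qed

lemma pd_monom_at:
  "pd i (monom_at x \<beta>) y = of_nat (\<beta> i) * monom_at x (\<beta>(i := \<beta> i - 1)) y"
proof -
  let ?r = "\<lambda>t. \<Prod>j\<in>UNIV - {i}. of_real ((y + t *\<^sub>R axis i 1) $ j - x $ j) ^ \<beta> j :: complex"
  have r: "?r t = ?r 0" for t by (rule prod.cong) (auto simp: axis_def)
  have "monom_at x \<beta> (y + t *\<^sub>R axis i 1) = (of_real (y $ i - x $ i) + of_real t) ^ \<beta> i * ?r 0" for t
    unfolding monom_at_split[of x \<beta> _ i] r[of t] by (simp add: axis_def algebra_simps)
  moreover have "((\<lambda>t. (of_real (y $ i - x $ i) + of_real t) ^ \<beta> i * ?r 0) has_vector_derivative
     of_nat (\<beta> i) * of_real (y $ i - x $ i) ^ (\<beta> i - 1) * ?r 0) (at 0)"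
    by (auto intro!: derivative_eq_intros simp: has_vector_derivative_def scaleR_conv_of_real algebra_simps)
  ultimately have "pd i (monom_at x \<beta>) y = of_nat (\<beta> i) * of_real (y $ i - x $ i) ^ (\<beta> i - 1) * ?r 0"
    unfolding pd_def by (simp only: vector_derivative_at)
  also have "\<dots> = of_nat (\<beta> i) * monom_at x (\<beta>(i := \<beta> i - 1)) y"
    unfolding monom_at_split[of x _ y i] by (simp add: mult.assoc)
  finally show ?thesis .
qed

lemma pd_cmult_monom_at:
  "pd i (\<lambda>y. c * monom_at x \<beta> y) y = c * of_nat (\<beta> i) * monom_at x (\<beta>(i := \<beta> i - 1)) y"
  by (simp add: pd_linear[OF bounded_linear_mult_right monom_at_differentiable] pd_monom_at mult.assoc)

lemma smooth_on_monom_at: "smooth_on U (monom_at x \<beta>)"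
proof -
  have "ndiff n UNIV (\<lambda>y. c * monom_at x \<beta> y)" for n c \<beta>
  proof (induction n arbitrary: c \<beta>)
    case 0
    then show ?case
      by (auto simp: differentiable_on_eq_differentiable_at intro!: differentiable_mult monom_at_differentiable)
  next
    case (Suc n)
    have "(\<lambda>y. c * monom_at x \<beta> y) differentiable_on UNIV"
      by (auto simp: differentiable_on_eq_differentiable_at intro!: differentiable_mult monom_at_differentiable)
    moreover have "pd i (\<lambda>y. c * monom_at x \<beta> y)
        = (\<lambda>y. (c * of_nat (\<beta> i)) * monom_at x (\<beta>(i := \<beta> i - 1)) y)" for i
      by (rule ext) (rule pd_cmult_monom_at)
    ultimately show ?case using Suc.IH by simp
  qed
  from this[of _ 1] have "smooth_on UNIV (monom_at x \<beta>)" by (simp add: smooth_on_iff_ndiff)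
  then show ?thesis by (rule smooth_on_subset) simp
qed

definition mfact :: "'d::finite mindex \<Rightarrow> complex" where
  "mfact \<beta> = (\<Prod>i\<in>UNIV. fact (\<beta> i))"

lemma mfact_nonzero [simp]: "mfact \<beta> \<noteq> 0"
  unfolding mfact_def by simp

text \<open>At their centre, monomials are dual to the derivatives, up to factorials. Thus coefficients can be read off
  from values, which also proves their uniqueness.\<close>

lemma mpd_monom_at: "mpd \<alpha> (monom_at x \<beta>) x = (if \<alpha> = \<beta> then mfact \<beta> else 0)"
proof -
  \<comment> \<open>falling factorials; they vanish for \<open>a > b\<close>, although subtraction on \<open>nat\<close> is truncated\<close>
  define ff :: "nat \<Rightarrow> nat \<Rightarrow> complex" where "ff b a = (\<Prod>k<a. of_nat (b - k))" for b a
  have pow: "(pd i ^^ k) (\<lambda>y. c * monom_at x \<gamma> y)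
      = (\<lambda>y. (c * ff (\<gamma> i) k) * monom_at x (\<gamma>(i := \<gamma> i - k)) y)" for i k c \<gamma>
  proof (induction k)
    case 0 show ?case by (simp add: ff_def)
  next
    case (Suc k)
    have "(pd i ^^ Suc k) (\<lambda>y. c * monom_at x \<gamma> y) z
        = (c * ff (\<gamma> i) k) * of_nat (\<gamma> i - k) * monom_at x (\<gamma>(i := \<gamma> i - Suc k)) z" for z
      using pd_cmult_monom_at[of i "c * ff (\<gamma> i) k" x "\<gamma>(i := \<gamma> i - k)" z]
      unfolding funpow.simps o_def Suc by (simp only: fun_upd_same fun_upd_upd diff_diff_left Suc_eq_plus1)
    moreover have "c * ff (\<gamma> i) k * of_nat (\<gamma> i - k) = c * ff (\<gamma> i) (Suc k)"
      by (simp add: ff_def)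
    ultimately show ?case by (simp only: fun_eq_iff) simp
  qed
  have fold: "foldr (\<lambda>i. pd i ^^ \<alpha> i) is (monom_at x \<beta>) = (\<lambda>y. (\<Prod>i\<in>set is. ff (\<beta> i) (\<alpha> i))
      * monom_at x (\<lambda>i. if i \<in> set is then \<beta> i - \<alpha> i else \<beta> i) y)" if "distinct is" for "is"
    using that
  proof (induction "is")
    case Nil then show ?case by simp
  next
    case (Cons i w)
    have "(\<lambda>j. if j \<in> set w then \<beta> j - \<alpha> j else \<beta> j)(i := \<beta> i - \<alpha> i)
        = (\<lambda>j. if j \<in> set (i # w) then \<beta> j - \<alpha> j else \<beta> j)" by auto
    then show ?case using Cons by (simp add: pow mult.commute)
  qed
  have eq: "mpd \<alpha> (monom_at x \<beta>) x = (\<Prod>i\<in>UNIV. ff (\<beta> i) (\<alpha> i)) * monom_at x (\<lambda>i. \<beta> i - \<alpha> i) x"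
    using fold[OF coords(1)] by (simp add: mpd_def coords(2))
  show ?thesis
  proof (cases "\<alpha> = \<beta>")
    case True
    have "ff n n = fact n" for n
    proof -
      have "fact n = (\<Prod>k<n. of_nat (n - k) :: complex)"
        unfolding fact_prod_rev by (simp add: atLeast0LessThan)
      then show ?thesis by (simp add: ff_def)
    qed
    then show ?thesis unfolding eq using True by (simp add: mfact_def monom_at_def)
  next
    case False
    then obtain i where "\<alpha> i \<noteq> \<beta> i" by auto
    then consider "\<alpha> i > \<beta> i" | "\<beta> i - \<alpha> i \<noteq> 0" by linarith
    then show ?thesis
    proof cases
      case 1
      then have "ff (\<beta> i) (\<alpha> i) = 0" by (auto simp: ff_def intro!: bexI[of _ "\<beta> i"])
      then have "(\<Prod>i\<in>UNIV. ff (\<beta> i) (\<alpha> i)) = 0" by (auto intro!: exI[of _ i])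
      then show ?thesis using False by (simp add: eq)
    next
      case 2
      then have "monom_at x (\<lambda>i. \<beta> i - \<alpha> i) x = 0" by (auto simp: monom_at_def intro!: exI[of _ i])
      then show ?thesis using False by (simp add: eq)
    qed
  qed
qed

text \<open>In the Leibniz expansion the terms that differentiate the monomial less than \<open>|\<beta>|\<close> times vanish at its centre.\<close>

lemma mpd_mult_monom_at:
  fixes f :: "real^'d::finite \<Rightarrow> complex"
  assumes U: "open U" and f: "smooth_on U f" and x: "x \<in> U" and le: "mabs \<alpha> \<le> mabs \<beta>"
  shows "mpd \<alpha> (\<lambda>y. f y * monom_at x \<beta> y) x = (if \<alpha> = \<beta> then mfact \<beta> * f x else 0)"
proof -
  have "mpd \<alpha> (\<lambda>y. f y * monom_at x \<beta> y) x
      = (\<Sum>\<gamma> | mabs \<gamma> \<le> mabs \<alpha>. leib (mword \<alpha>) f \<gamma> x * (if \<gamma> = \<beta> then mfact \<beta> else 0))"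
    by (simp add: mpd_mult[OF U f smooth_on_monom_at x] mpd_monom_at)
  also have "\<dots> = (if mabs \<beta> \<le> mabs \<alpha> then leib (mword \<alpha>) f \<beta> x * mfact \<beta> else 0)"
    by (simp add: if_distrib[of "\<lambda>z. _ * z"] sum.delta cong: if_cong)
  also have "\<dots> = (if \<alpha> = \<beta> then mfact \<beta> * f x else 0)"
    using le leib_top[of \<beta> "mword \<alpha>" f] by (auto simp: length_mword count_mword)
  finally show ?thesis .
qed

section \<open>Smooth cutoff functions\<close>

text \<open>The derivatives of \<open>exp (- 1 / t)\<close>, extended by \<open>0\<close> to \<open>t \<le> 0\<close>, are combinations of these
  functions, so that the family is closed under differentiation.\<close>
definition flat :: "nat \<Rightarrow> real \<Rightarrow> real" where
  "flat n t = (if t > 0 then exp (- inverse t) * inverse t ^ n else 0)"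

lemma DERIV_flat: "DERIV (flat n) t :> flat (n + 2) t - real n * flat (n + 1) t"
proof -
  consider "t > 0" | "t < 0" | "t = 0" by linarith
  then show ?thesis
  proof cases
    case 1
    have "DERIV (\<lambda>t. exp (- inverse t) * inverse t ^ n) t :> flat (n + 2) t - real n * flat (n + 1) t"
    proof -
      let ?i = "inverse t"
      have "DERIV (\<lambda>t. exp (- inverse t) * inverse t ^ n) t
          :> exp (- ?i) * (?i * ?i) * ?i ^ n + exp (- ?i) * (real n * (?i ^ (n - 1) * - (?i * ?i)))"
        using 1 by (auto intro!: derivative_eq_intros simp: algebra_simps)
      moreover have "exp (- ?i) * (?i * ?i) * ?i ^ n + exp (- ?i) * (real n * (?i ^ (n - 1) * - (?i * ?i)))
          = flat (n + 2) t - real n * flat (n + 1) t"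
        using 1 by (cases n) (simp_all add: flat_def algebra_simps)
      ultimately show ?thesis by simp
    qed
    then show ?thesis
      by (rule has_field_derivative_transform_within_open[where S = "{0<..}"]) (use 1 in \<open>auto simp: flat_def\<close>)
  next
    case 2
    have "DERIV (\<lambda>t. 0) t :> flat (n + 2) t - real n * flat (n + 1) t"
      using 2 by (auto simp: flat_def)
    then show ?thesis
      by (rule has_field_derivative_transform_within_open[where S = "{..<0}"]) (use 2 in \<open>auto simp: flat_def\<close>)
  next
    case 3
    \<comment> \<open>the difference quotient at \<open>0\<close> is \<open>u\<^bsup>n + 1\<^esup> exp (- u)\<close> with \<open>u = 1 / t\<close>\<close>
    have "((\<lambda>u::real. u ^ (n + 1) / exp u) \<longlongrightarrow> 0) at_top" by (rule tendsto_power_div_exp_0)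
    from filterlim_compose[OF this filterlim_inverse_at_top_right]
    have "((\<lambda>t::real. inverse t ^ (n + 1) / exp (inverse t)) \<longlongrightarrow> 0) (at_right 0)" .
    moreover have "\<forall>\<^sub>F t in at_right 0. inverse t ^ (n + 1) / exp (inverse t) = (flat n t - flat n 0) / (t - 0)"
      by (rule eventually_at_rightI[of 0 1]) (auto simp: flat_def exp_minus field_simps)
    ultimately have "((\<lambda>t. (flat n t - flat n 0) / (t - 0)) \<longlongrightarrow> 0) (at_right 0)"
      by (rule Lim_transform_eventually)
    moreover have "((\<lambda>t. (flat n t - flat n 0) / (t - 0)) \<longlongrightarrow> 0) (at_left 0)"
      by (rule Lim_transform_eventually[OF tendsto_const])
        (auto intro!: eventually_at_leftI[of "-1"] simp: flat_def)
    ultimately have "((\<lambda>t. (flat n t - flat n 0) / (t - 0)) \<longlongrightarrow> 0) (at 0)"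
      by (rule filterlim_split_at_real[rotated])
    then show ?thesis using 3 by (simp add: has_field_derivative_iff flat_def)
  qed
qed

lemma smooth_on_flat:
  fixes s :: "real^'d::finite \<Rightarrow> real"
  assumes U: "open U" and s: "smooth_on U s"
  shows "smooth_on U (\<lambda>y. flat n (s y))"
proof -
  have der: "((\<lambda>y. flat n (s y)) has_derivative (\<lambda>h. D h * (flat (n + 2) (s x) - real n * flat (n + 1) (s x)))) (at x)"
    if "(s has_derivative D) (at x)" for n D x
    by (rule DERIV_compose_FDERIV[OF DERIV_flat that])
  have d: "(\<lambda>y. flat n (s y)) differentiable_on U" for n
    using smooth_on_differentiable[OF s U] der U
    unfolding differentiable_on_eq_differentiable_at[OF U] differentiable_def by blast
  have "ndiff k U (\<lambda>y. flat n (s y))" for k n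
  proof (induction k arbitrary: n)
    case 0 then show ?case using d by simp
  next
    case (Suc k)
    have "pd i (\<lambda>y. flat n (s y)) x = pd i s x * (flat (n + 2) (s x) + (- real n) * flat (n + 1) (s x))"
      if x: "x \<in> U" for i x
    proof -
      have "s differentiable (at x)" by (rule smooth_on_differentiable[OF s U x])
      then obtain D where D: "(s has_derivative D) (at x)" unfolding differentiable_def by blast
      from pd_eq[OF der[OF D]] pd_eq[OF D] show ?thesis by simp
    qed
    moreover have "ndiff k U (\<lambda>x. pd i s x * (flat (n + 2) (s x) + (- real n) * flat (n + 1) (s x)))" for i
      using smooth_on_pd[OF s]
      by (intro ndiff_bilinear[OF U bounded_bilinear_mult] ndiff_add[OF U] Suc.IH
          smooth_on_const[unfolded smooth_on_iff_ndiff, rule_format]) (auto simp: smooth_on_iff_ndiff)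
    ultimately have "ndiff k U (pd i (\<lambda>y. flat n (s y)))" for i
      using ndiff_cong[OF U, of "pd i (\<lambda>y. flat n (s y))"] by auto
    then show ?case using d by simp
  qed
  then show ?thesis by (simp add: smooth_on_iff_ndiff)
qed

text \<open>The cutoff is \<open>p / (p + q)\<close>, where \<open>p\<close> vanishes outside the ball of radius \<open>r\<close> and \<open>q\<close> inside that of
  radius \<open>e < r\<close>, so that the denominator is positive.\<close>

lemma smooth_cutoff_exists:
  fixes x :: "real^'d::finite"
  assumes "open U" "x \<in> U"
  obtains \<theta> :: "real^'d \<Rightarrow> real" and S e where "smooth_on UNIV \<theta>" "\<And>y. 0 \<le> \<theta> y"
    "0 < e" "\<And>y. y \<in> ball x e \<Longrightarrow> \<theta> y = 1" "compact S" "S \<subseteq> U" "\<And>y. y \<notin> S \<Longrightarrow> \<theta> y = 0"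
proof -
  obtain r where r: "r > 0" "cball x r \<subseteq> U" using assms open_contains_cball by blast
  define s where "s y = (y - x) \<bullet> (y - x)" for y
  define e where "e = r / 2"
  have e: "0 < e" "e < r" using r by (auto simp: e_def)
  define p where "p y = flat 0 (r\<^sup>2 - s y)" for y
  define q where "q y = flat 0 (s y - e\<^sup>2)" for y
  define \<theta> where "\<theta> y = p y / (p y + q y)" for y
  have s: "s y = (dist x y)\<^sup>2" for y by (simp add: s_def dist_norm norm_minus_commute[of x y] power2_norm_eq_inner)
  have "smooth_on UNIV (\<lambda>y. y - x)"
    by (intro smooth_on_diff smooth_on_id smooth_on_const open_UNIV)
  then have "smooth_on UNIV s"
    unfolding s_def using smooth_on_bilinear[OF open_UNIV bounded_bilinear_inner] by blast
  then have "smooth_on UNIV p" "smooth_on UNIV q"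
    unfolding p_def q_def by (intro smooth_on_flat smooth_on_diff smooth_on_const open_UNIV; assumption)+
  moreover have e2: "e\<^sup>2 < r\<^sup>2" using e by (intro power_strict_mono) auto
  have pos: "p y + q y > 0" for y
  proof (cases "s y < r\<^sup>2")
    case True then show ?thesis by (simp add: p_def q_def flat_def add_pos_nonneg)
  next
    case False
    then have "s y - e\<^sup>2 > 0" using e2 by linarith
    then show ?thesis by (simp add: p_def q_def flat_def add_nonneg_pos)
  qed
  ultimately have "smooth_on UNIV \<theta>"
    unfolding \<theta>_def by (intro smooth_on_divide smooth_on_add open_UNIV) (auto simp: less_imp_neq[symmetric] pos[THEN less_imp_neq, symmetric])
  moreover have "0 \<le> \<theta> y" for y
    by (auto simp: \<theta>_def p_def q_def flat_def)
  moreover have "\<theta> y = 1" if "y \<in> ball x e" for y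
  proof -
    have "s y < e\<^sup>2" unfolding s using that by (intro power_strict_mono) auto
    then have "q y = 0" by (simp add: q_def flat_def)
    then show ?thesis using pos[of y] by (simp add: \<theta>_def)
  qed
  moreover have "\<theta> y = 0" if "y \<notin> cball x r" for y
  proof -
    have "r\<^sup>2 < s y" unfolding s using that r by (intro power_strict_mono) auto
    then show ?thesis by (simp add: \<theta>_def p_def flat_def)
  qed
  ultimately show ?thesis using that[of \<theta> e "cball x r"] e r compact_cball by blast
qed

section \<open>Integration by parts\<close>

text \<open>Vanishing is required on the whole complement of \<open>S\<close>, also outside \<open>U\<close>. Such a function is smooth on the
  whole space, and integrals over \<open>U\<close> are integrals over the whole space.\<close>

definition ctest :: "(real^'d::finite) set \<Rightarrow> (real^'d \<Rightarrow> 'a::real_normed_vector) \<Rightarrow> bool" where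
  "ctest U f \<longleftrightarrow> smooth_on U f \<and> (\<exists>S. compact S \<and> S \<subseteq> U \<and> (\<forall>x. x \<notin> S \<longrightarrow> f x = 0))"

lemma foldr_pd_eq_0_outside:
  assumes "compact S" "\<And>x. x \<notin> S \<Longrightarrow> f x = 0" "x \<notin> S"
  shows "foldr pd w f x = 0"
  using foldr_pd_cong[of "- S" f "\<lambda>_. 0" x w] assms by (simp add: compact_imp_closed open_Compl)

lemma ctest_foldr_pd: "ctest U f \<Longrightarrow> ctest U (foldr pd w f)"
  unfolding ctest_def using smooth_on_foldr_pd foldr_pd_eq_0_outside by metis

lemma ctest_mpd: "ctest U f \<Longrightarrow> ctest U (mpd \<alpha> f)"
  unfolding mpd_mword by (rule ctest_foldr_pd)

lemma ctest_eq_0: "ctest U f \<Longrightarrow> x \<notin> U \<Longrightarrow> f x = 0"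
  unfolding ctest_def by blast

lemma ctest_smooth_on: "ctest U f \<Longrightarrow> smooth_on U f"
  unfolding ctest_def by blast

lemma ctest_smooth_on_UNIV:
  assumes U: "open U" and f: "ctest U f"
  shows "smooth_on UNIV f"
  unfolding smooth_on_def differentiable_on_eq_differentiable_at[OF open_UNIV]
proof (intro allI ballI)
  fix w x
  obtain S where S: "compact S" "S \<subseteq> U" "\<And>x. x \<notin> S \<Longrightarrow> f x = 0"
    using f unfolding ctest_def by blast
  show "foldr pd w f differentiable at x"
  proof (cases "x \<in> U")
    case True
    then show ?thesis using smooth_on_differentiable[OF smooth_on_foldr_pd[OF ctest_smooth_on[OF f]] U] by blast
  next
    case False
    have "open (- S)" using S(1) by (simp add: compact_imp_closed open_Compl)
    then have "(foldr pd w f has_derivative (\<lambda>_. 0)) (at x)"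
      using foldr_pd_eq_0_outside[OF S(1,3)] False S(2)
      by (intro has_derivative_transform_within_open[OF has_derivative_const]) auto
    then show ?thesis by (rule differentiableI)
  qed
qed

lemma ctest_linear:
  assumes "open U" "bounded_linear L" "ctest U f"
  shows "ctest U (\<lambda>y. L (f y))"
  using assms smooth_on_linear[OF assms(1,2)] linear_simps(3)[OF assms(2)] unfolding ctest_def by metis

lemma ctest_mult:
  fixes f g :: "real^'d::finite \<Rightarrow> 'a::real_normed_algebra"
  assumes "open U" "ctest U f" "smooth_on U g"
  shows "ctest U (\<lambda>y. f y * g y)"
  using assms smooth_on_mult[OF assms(1)] unfolding ctest_def by (metis mult_zero_left)

lemma smooth_on_scale:
  fixes v :: "real^'d::finite \<Rightarrow> complex^'k::finite"
  assumes "open U" "smooth_on U c" "smooth_on U v"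
  shows "smooth_on U (\<lambda>y. c y *s v y)"
proof (rule smooth_on_vec[OF assms(1)])
  show "smooth_on U (\<lambda>y. (c y *s v y) $ k)" for k
    using smooth_on_mult[OF assms(1,2) smooth_on_nth[OF assms(1,3), of k]] by simp
qed

lemma ctest_scale:
  fixes v :: "real^'d::finite \<Rightarrow> complex^'k::finite"
  assumes "open U" "ctest U c" "smooth_on U v"
  shows "ctest U (\<lambda>y. c y *s v y)"
proof -
  obtain S where S: "compact S" "S \<subseteq> U" "\<And>y. y \<notin> S \<Longrightarrow> c y = 0" using assms(2) unfolding ctest_def by blast
  then have "\<forall>y. y \<notin> S \<longrightarrow> c y *s v y = 0" by simp
  then show ?thesis
    using smooth_on_scale[OF assms(1) ctest_smooth_on[OF assms(2)] assms(3)] S(1,2) unfolding ctest_def by blast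
qed

lemma ctest_nth: "open U \<Longrightarrow> ctest U u \<Longrightarrow> ctest U (\<lambda>y. u y $ K)"
  by (rule ctest_linear[OF _ bounded_linear_vec_nth])

lemma ctest_cutoff_exists:
  fixes x :: "real^'d::finite"
  assumes U: "open U" and x: "x \<in> U"
  obtains \<theta> :: "real^'d \<Rightarrow> real" and r where "ctest U (\<lambda>y. complex_of_real (\<theta> y))" "\<And>y. 0 \<le> \<theta> y"
    "0 < r" "\<And>y. y \<in> ball x r \<Longrightarrow> \<theta> y = 1" "\<theta> x \<noteq> 0"
proof -
  obtain \<theta> :: "real^'d \<Rightarrow> real" and S r where \<theta>: "smooth_on UNIV \<theta>" "\<And>y. 0 \<le> \<theta> y"
    "0 < r" "\<And>y. y \<in> ball x r \<Longrightarrow> \<theta> y = 1" "compact S" "S \<subseteq> U" "\<And>y. y \<notin> S \<Longrightarrow> \<theta> y = 0"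
    using smooth_cutoff_exists[OF U x] by metis
  have "ctest U \<theta>" using \<theta> smooth_on_subset unfolding ctest_def by blast
  then have "ctest U (\<lambda>y. complex_of_real (\<theta> y))" by (rule ctest_linear[OF U bounded_linear_of_real])
  then show ?thesis using that[of \<theta> r] \<theta>(2-4) by simp
qed

lemma ctest_integrable:
  fixes f :: "real^'d::finite \<Rightarrow> 'a::{banach, second_countable_topology}"
  assumes "open U" "ctest U f"
  shows "integrable lborel f"
proof -
  obtain S where S: "compact S" "S \<subseteq> U" "\<And>x. x \<notin> S \<Longrightarrow> f x = 0"
    using assms unfolding ctest_def by blast
  have "continuous_on S f"
    using smooth_on_continuous[OF ctest_smooth_on[OF assms(2)]] S(2) continuous_on_subset by blast
  from borel_integrable_compact[OF S(1) this]
  have "integrable lborel (\<lambda>x. indicator S x *\<^sub>R f x)" .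
  moreover have "(\<lambda>x. indicator S x *\<^sub>R f x) = f"
    using S(3) by (auto simp: fun_eq_iff indicator_def)
  ultimately show ?thesis by simp
qed

text \<open>The integral of a derivative of a compactly supported function is the limit of integrals of
  difference quotients, which vanish because Lebesgue measure is translation invariant.\<close>

lemma integral_pd_real_eq_0:
  fixes f :: "real^'d::finite \<Rightarrow> real"
  assumes U: "open U" and f: "ctest U f"
  shows "(LINT x|lborel. pd i f x) = 0"
proof -
  let ?e = "axis i (1::real)"
  obtain S where S: "compact S" "S \<subseteq> U" "\<And>x. x \<notin> S \<Longrightarrow> f x = 0"
    using f unfolding ctest_def by blast
  have sm: "smooth_on UNIV f" by (rule ctest_smooth_on_UNIV[OF U f])
  have cf: "continuous_on UNIV f" and cp: "continuous_on UNIV (pd i f)"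
    using smooth_on_continuous sm smooth_on_pd by blast+
  have [measurable]: "f \<in> borel_measurable borel" "pd i f \<in> borel_measurable borel"
    using cf cp borel_measurable_continuous_onI by blast+
  obtain B where B: "\<And>x. \<bar>pd i f x\<bar> \<le> B"
  proof -
    have "bounded (pd i f ` S)"
      using S(1) cp by (intro compact_imp_bounded compact_continuous_image) (auto intro: continuous_on_subset)
    then obtain b where "\<forall>x\<in>S. \<bar>pd i f x\<bar> \<le> b" unfolding bounded_iff by auto
    moreover have "pd i f x = 0" if "x \<notin> S" for x
      using foldr_pd_eq_0_outside[of S f x "[i]"] S that by simp
    ultimately have "\<bar>pd i f x\<bar> \<le> max b 0" for x by (cases "x \<in> S") (auto simp: le_max_iff_disj)
    then show ?thesis using that by blast
  qed
  define h where "h n = inverse (real (Suc n))" for n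
  have h: "0 < h n" "h n \<le> 1" for n by (auto simp: h_def field_simps)
  define q where "q n x = (f (x + h n *\<^sub>R ?e) - f x) / h n" for n x
  \<comment> \<open>outside \<open>T\<close> all difference quotients vanish\<close>
  define T where "T = (\<lambda>(y, t). y - t *\<^sub>R ?e) ` (S \<times> {0..1})"
  have "compact T"
    unfolding T_def split_def using S(1)
    by (intro compact_continuous_image compact_Times compact_Icc continuous_intros)
  from borel_integrable_compact[OF this, of "\<lambda>_. B"]
  have w: "integrable lborel (\<lambda>x. indicator T x *\<^sub>R B)" by simp
  have le: "norm (q n x) \<le> indicator T x *\<^sub>R B" for n x
  proof (cases "x \<in> T")
    case True
    obtain t where "f (x + h n *\<^sub>R ?e) - f x = h n * pd i f (x + t *\<^sub>R ?e)"
      using pd_real_mean_value[OF h(1), of n f x i] smooth_on_differentiable[OF sm open_UNIV] by blast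
    then show ?thesis using h(1)[of n] B True by (simp add: q_def)
  next
    case False
    have "x \<notin> S" using False by (force simp: T_def)
    moreover have "x + h n *\<^sub>R ?e \<notin> S"
    proof
      assume "x + h n *\<^sub>R ?e \<in> S"
      then have "(x + h n *\<^sub>R ?e) - h n *\<^sub>R ?e \<in> T" using h[of n] unfolding T_def by force
      then show False using False by simp
    qed
    ultimately show ?thesis using S(3) False by (simp add: q_def)
  qed
  have lim: "(\<lambda>n. q n x) \<longlonglongrightarrow> pd i f x" for x
  proof -
    have "((\<lambda>t. f (x + t *\<^sub>R ?e)) has_real_derivative pd i f x) (at 0)"
      using has_vector_derivative_pd[of f x 0 i UNIV] smooth_on_differentiable[OF sm open_UNIV]
      by (simp add: has_real_derivative_iff_has_vector_derivative)
    then have "((\<lambda>t. (f (x + t *\<^sub>R ?e) - f x) / t) \<longlongrightarrow> pd i f x) (at 0)"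
      by (simp add: has_field_derivative_iff)
    moreover have "filterlim h (at 0) sequentially"
      unfolding filterlim_at h_def using LIMSEQ_inverse_real_of_nat by auto
    ultimately show ?thesis unfolding q_def by (rule filterlim_compose)
  qed
  have "(\<lambda>n. LINT x|lborel. q n x) \<longlonglongrightarrow> (LINT x|lborel. pd i f x)"
  proof (rule integral_dominated_convergence[OF _ _ w])
    show "q n \<in> borel_measurable lborel" for n unfolding q_def by measurable
  qed (use lim le in auto)
  moreover have "(LINT x|lborel. q n x) = 0" for n
  proof -
    have int: "integrable lborel f" by (rule ctest_integrable[OF U f])
    have "(LINT x|lborel. f x) = (LINT x|distr lborel borel ((+) (h n *\<^sub>R ?e)). f x)"
      by (simp add: lborel_distr_plus)
    also have "\<dots> = (LINT x|lborel. f (h n *\<^sub>R ?e + x))" by (intro integral_distr) auto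
    finally have eq: "(LINT x|lborel. f (x + h n *\<^sub>R ?e)) = (LINT x|lborel. f x)" by (simp add: add.commute)
    have "integrable (distr lborel borel ((+) (h n *\<^sub>R ?e))) f" using int by (simp add: lborel_distr_plus)
    then have "integrable lborel (\<lambda>x. f (h n *\<^sub>R ?e + x))" by (simp add: integrable_distr_eq)
    then show ?thesis unfolding q_def using int eq by (simp add: add.commute)
  qed
  ultimately show ?thesis by (simp add: LIMSEQ_const_iff)
qed

lemma integral_pd_eq_0:
  fixes f :: "real^'d::finite \<Rightarrow> complex"
  assumes U: "open U" and f: "ctest U f"
  shows "(LINT x|lborel. pd i f x) = 0"
proof -
  have sm: "smooth_on UNIV f" by (rule ctest_smooth_on_UNIV[OF U f])
  have int: "integrable lborel (pd i f)"
    using ctest_integrable[OF U ctest_foldr_pd[OF f, of "[i]"]] by simp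
  have *: "L (LINT x|lborel. pd i f x) = 0" if L: "bounded_linear L" for L :: "complex \<Rightarrow> real"
  proof -
    have "L (LINT x|lborel. pd i f x) = (LINT x|lborel. pd i (\<lambda>y. L (f y)) x)"
      by (simp add: integral_bounded_linear[OF L int] pd_linear[OF L smooth_on_differentiable[OF sm open_UNIV]])
    then show ?thesis using integral_pd_real_eq_0[OF U ctest_linear[OF U L f]] by simp
  qed
  show ?thesis
    using *[OF bounded_linear_Re] *[OF bounded_linear_Im] by (simp add: complex_eq_iff)
qed

lemma integral_pd_by_parts:
  fixes f g :: "real^'d::finite \<Rightarrow> complex"
  assumes U: "open U" and f: "ctest U f" and g: "smooth_on U g"
  shows "(LINT x|lborel. pd i f x * g x) = - (LINT x|lborel. f x * pd i g x)"
proof -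
  have fg: "ctest U (\<lambda>y. f y * g y)" by (rule ctest_mult[OF U f g])
  have pf: "ctest U (pd i f)" using ctest_foldr_pd[OF f, of "[i]"] by simp
  have "pd i (\<lambda>y. f y * g y) x = f x * pd i g x + pd i f x * g x" for x
  proof (cases "x \<in> U")
    case True
    then show ?thesis
      using smooth_on_differentiable[OF ctest_smooth_on[OF f] U] smooth_on_differentiable[OF g U]
      by (intro pd_bilinear[OF bounded_bilinear_mult])
  next
    case False
    then show ?thesis
      using ctest_eq_0[OF f] ctest_eq_0[OF pf] ctest_eq_0[OF ctest_foldr_pd[OF fg, of "[i]"]] by simp
  qed
  then have "0 = (LINT x|lborel. f x * pd i g x + pd i f x * g x)"
    using integral_pd_eq_0[OF U fg, of i] by simp
  also have "\<dots> = (LINT x|lborel. f x * pd i g x) + (LINT x|lborel. pd i f x * g x)"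
    by (intro Bochner_Integration.integral_add ctest_integrable[OF U] ctest_mult[OF U] f pf g smooth_on_pd)
  finally show ?thesis by (simp add: eq_neg_iff_add_eq_0 add.commute)
qed

lemma integral_mpd_by_parts:
  fixes f g :: "real^'d::finite \<Rightarrow> complex"
  assumes U: "open U" and f: "ctest U f" and g: "smooth_on U g"
  shows "(LINT x|lborel. mpd \<alpha> f x * g x) = (- 1) ^ mabs \<alpha> * (LINT x|lborel. f x * mpd \<alpha> g x)"
proof -
  have "(LINT x|lborel. foldr pd w f x * g x) = (- 1) ^ length w * (LINT x|lborel. f x * foldr pd (rev w) g x)"
    if "smooth_on U g" for w g
    using that
  proof (induction w arbitrary: g)
    case Nil then show ?case by simp
  next
    case (Cons i w)
    show ?case
      using integral_pd_by_parts[OF U ctest_foldr_pd[OF f, of w] Cons.prems, of i] Cons.IH[OF smooth_on_pd[OF Cons.prems]]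
      by simp
  qed
  from this[OF g, of "mword \<alpha>"]
  have "(LINT x|lborel. mpd \<alpha> f x * g x)
      = (- 1) ^ mabs \<alpha> * (LINT x|lborel. f x * foldr pd (rev (mword \<alpha>)) g x)"
    by (simp add: mpd_mword length_mword)
  \<comment> \<open>integration by parts reverses the order of the derivatives, which is immaterial on \<open>U\<close>\<close>
  also have "(\<lambda>x. f x * foldr pd (rev (mword \<alpha>)) g x) = (\<lambda>x. f x * mpd \<alpha> g x)"
  proof
    fix x show "f x * foldr pd (rev (mword \<alpha>)) g x = f x * mpd \<alpha> g x"
      using foldr_pd_mset[OF U g, of x "rev (mword \<alpha>)" "mword \<alpha>"] ctest_eq_0[OF f, of x]
      by (cases "x \<in> U") (auto simp: mpd_mword)
  qed
  finally show ?thesis .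
qed

lemma set_integral_eq_integral:
  fixes f :: "real^'d::finite \<Rightarrow> complex"
  assumes "\<And>x. x \<notin> U \<Longrightarrow> f x = 0"
  shows "(LINT x:U|lborel. f x) = (LINT x|lborel. f x)"
  unfolding set_lebesgue_integral_def
  by (rule Bochner_Integration.integral_cong) (use assms in \<open>auto simp: indicator_def\<close>)

lemma continuous_nonneg_integral_zero:
  fixes h :: "real^'d::finite \<Rightarrow> real"
  assumes "continuous_on UNIV h" "integrable lborel h" "\<And>x. 0 \<le> h x" "(LINT x|lborel. h x) = 0"
  shows "h x = 0"
proof -
  have "AE x in lborel. h x = 0"
    using assms integral_nonneg_eq_0_iff_AE[of lborel h] by auto
  moreover have "{x \<in> space lborel. h x \<noteq> 0} \<in> sets lborel"
    using assms(2) by measurable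
  ultimately have "{x. h x \<noteq> 0} \<in> null_sets lborel"
    by (subst (asm) AE_iff_null) auto
  then have "negligible {x. h x \<noteq> 0}"
    by (simp add: negligible_iff_null_sets null_sets_completionI)
  moreover have "open {x. h x \<noteq> 0}"
    by (intro open_Collect_neq assms(1) continuous_on_const)
  ultimately show ?thesis using open_not_negligible by blast
qed

lemma smooth_eq_0_if_weighted_integral_0:
  fixes h :: "real^'d::finite \<Rightarrow> complex" and \<theta> :: "real^'d \<Rightarrow> real"
  assumes U: "open U" and h: "smooth_on U h" and pos: "\<And>y. h y = of_real (q y)" "\<And>y. 0 \<le> q y"
    and \<theta>: "ctest U (\<lambda>y. complex_of_real (\<theta> y))" "\<And>y. 0 \<le> \<theta> y" "\<theta> x \<noteq> 0"
    and 0: "(LINT y|lborel. of_real (\<theta> y) * h y) = 0"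
  shows "h x = 0"
proof -
  let ?f = "\<lambda>y. Re (of_real (\<theta> y) * h y)"
  have eq: "of_real (\<theta> y) * h y = of_real (?f y)" for y
    by (simp add: pos(1))
  have f: "ctest U ?f" by (intro ctest_linear[OF U bounded_linear_Re] ctest_mult[OF U \<theta>(1) h])
  have "(LINT y|lborel. ?f y) = 0"
  proof -
    have "complex_of_real (LINT y|lborel. ?f y) = (LINT y|lborel. complex_of_real (?f y))"
      by (rule integral_complex_of_real[symmetric])
    also have "\<dots> = 0" unfolding eq[symmetric] by (rule 0)
    finally show ?thesis by (simp only: of_real_eq_0_iff)
  qed
  then have "?f x = 0"
    using \<theta>(2) pos(2) by (intro continuous_nonneg_integral_zero[of ?f] ctest_integrable[OF U f]
        smooth_on_continuous[OF ctest_smooth_on_UNIV[OF U f]]) (simp_all add: pos(1))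
  then show ?thesis using \<theta>(3) by (simp add: pos(1))
qed

section \<open>Differential operators and their coefficients\<close>

lemma apply_coeffs_nth:
  assumes "x \<in> U" "finite (active U C)" "finite S" "\<And>\<alpha>. \<alpha> \<notin> S \<Longrightarrow> C \<alpha> x = 0"
  shows "apply_coeffs U C u x $ J = (\<Sum>\<alpha>\<in>S. \<Sum>K\<in>UNIV. C \<alpha> x $ J $ K * mpd \<alpha> (\<lambda>y. u y $ K) x)"
proof -
  let ?t = "\<lambda>\<alpha>. \<Sum>K\<in>UNIV. C \<alpha> x $ J $ K * mpd \<alpha> (\<lambda>y. u y $ K) x"
  have "C \<alpha> x = 0" if "\<alpha> \<notin> active U C" for \<alpha> using that assms(1) by (auto simp: active_def)
  then have z: "?t \<alpha> = 0" if "\<alpha> \<notin> active U C \<inter> S" for \<alpha>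
  proof -
    have "C \<alpha> x = 0" using that assms(4) \<open>\<And>\<alpha>. \<alpha> \<notin> active U C \<Longrightarrow> C \<alpha> x = 0\<close> by auto
    then show ?thesis by simp
  qed
  have "sum ?t (active U C) = sum ?t (active U C \<inter> S)"
    using assms(2) z by (intro sum.mono_neutral_right) auto
  also have "\<dots> = sum ?t S"
    using assms(3) z by (intro sum.mono_neutral_left) auto
  finally show ?thesis by (simp add: apply_coeffs_def)
qed

lemma active_bounded:
  assumes "finite (active U C)"
  obtains N where "\<And>\<alpha> x. x \<in> U \<Longrightarrow> mabs \<alpha> > N \<Longrightarrow> C \<alpha> x = 0"
proof
  show "C \<alpha> x = 0" if "x \<in> U" "mabs \<alpha> > Max (insert 0 (mabs ` active U C))" for \<alpha> x
  proof (rule ccontr)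
    assume "C \<alpha> x \<noteq> 0"
    then have "mabs \<alpha> \<in> insert 0 (mabs ` active U C)" using that(1) by (auto simp: active_def)
    then have "mabs \<alpha> \<le> Max (insert 0 (mabs ` active U C))" using assms by (intro Max_ge) auto
    then show False using that(2) by simp
  qed
qed

lemma active_finiteI:
  assumes "\<And>\<alpha> x. x \<in> U \<Longrightarrow> mabs \<alpha> > N \<Longrightarrow> C \<alpha> x = 0"
  shows "finite (active U C)"
  by (rule finite_subset[OF _ finite_mabs_le[of N]]) (use assms in \<open>force simp: active_def\<close>)

lemma apply_coeffs_nth_le:
  assumes "x \<in> U" "\<And>\<alpha> x. x \<in> U \<Longrightarrow> mabs \<alpha> > N \<Longrightarrow> C \<alpha> x = 0"
  shows "apply_coeffs U C u x $ J
    = (\<Sum>\<alpha> | mabs \<alpha> \<le> N. \<Sum>K\<in>UNIV. C \<alpha> x $ J $ K * mpd \<alpha> (\<lambda>y. u y $ K) x)"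
  using assms by (intro apply_coeffs_nth active_finiteI[of U N]) auto

lemma apply_coeffs_add:
  assumes "x \<in> U" "finite (active U C)" "finite (active U D)"
  shows "apply_coeffs U (\<lambda>\<alpha> x. C \<alpha> x + D \<alpha> x) u x = apply_coeffs U C u x + apply_coeffs U D u x"
proof -
  obtain M where M: "\<And>\<alpha> x. x \<in> U \<Longrightarrow> mabs \<alpha> > M \<Longrightarrow> C \<alpha> x = 0" using active_bounded[OF assms(2)] by blast
  obtain N where N: "\<And>\<alpha> x. x \<in> U \<Longrightarrow> mabs \<alpha> > N \<Longrightarrow> D \<alpha> x = 0" using active_bounded[OF assms(3)] by blast
  have MN: "C \<alpha> x = 0" "D \<alpha> x = 0" if "x \<in> U" "mabs \<alpha> > max M N" for \<alpha> x using M N that by auto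
  have nth: "apply_coeffs U F u x $ J
      = (\<Sum>\<alpha> | mabs \<alpha> \<le> max M N. \<Sum>K\<in>UNIV. F \<alpha> x $ J $ K * mpd \<alpha> (\<lambda>y. u y $ K) x)"
    if "F \<in> {C, D, \<lambda>\<alpha> x. C \<alpha> x + D \<alpha> x}" for F J
    by (rule apply_coeffs_nth_le[OF assms(1)]) (use that MN in auto)
  have "apply_coeffs U (\<lambda>\<alpha> x. C \<alpha> x + D \<alpha> x) u x $ J = apply_coeffs U C u x $ J + apply_coeffs U D u x $ J" for J
    by (simp add: nth sum.distrib distrib_right)
  then show ?thesis by (simp add: vec_eq_iff)
qed

lemma apply_coeffs_cong:
  assumes "open V" "x \<in> V" "\<And>y. y \<in> V \<Longrightarrow> u y = v y"
  shows "apply_coeffs U C u x = apply_coeffs U C v x"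
proof -
  have "mpd \<alpha> (\<lambda>y. u y $ K) x = mpd \<alpha> (\<lambda>y. v y $ K) x" for \<alpha> K
    using assms by (intro mpd_cong) auto
  then show ?thesis by (simp add: apply_coeffs_def)
qed

lemma smooth_on_apply_coeffs:
  assumes U: "open U" and "smooth_coeffs U C" "smooth_on U u"
  shows "smooth_on U (apply_coeffs U C u)"
proof (rule smooth_on_vec[OF U])
  fix J
  have "smooth_on U (\<lambda>x. \<Sum>\<alpha>\<in>active U C. \<Sum>K\<in>UNIV. C \<alpha> x $ J $ K * mpd \<alpha> (\<lambda>y. u y $ K) x)"
    using assms(2,3)
    by (intro smooth_on_sum[OF U] smooth_on_mult[OF U] smooth_on_mpd smooth_on_nth[OF U]) (auto simp: smooth_coeffs_def)
  then show "smooth_on U (\<lambda>x. apply_coeffs U C u x $ J)" by (simp add: apply_coeffs_def)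
qed

text \<open>The coefficients of an operator on unconstrained functions are its values on monomials.\<close>

lemma apply_coeffs_monom:
  assumes "x \<in> U" "finite (active U C)"
  shows "apply_coeffs U C (\<lambda>y. axis K (monom_at x \<beta> y)) x $ J = mfact \<beta> * C \<beta> x $ J $ K"
proof -
  have m: "mpd \<alpha> (\<lambda>y. axis K (monom_at x \<beta> y) $ K') x = (if K' = K \<and> \<alpha> = \<beta> then mfact \<beta> else 0)" for \<alpha> K'
    by (cases "K' = K") (auto simp: axis_def mpd_monom_at)
  have "apply_coeffs U C (\<lambda>y. axis K (monom_at x \<beta> y)) x $ J
      = (\<Sum>\<alpha>\<in>active U C. if \<alpha> = \<beta> then mfact \<beta> * C \<beta> x $ J $ K else 0)"
    unfolding apply_coeffs_def m
    by (simp add: if_distrib[of "\<lambda>z. _ * z"] if_conn cong: if_cong) (auto intro!: sum.cong simp: mult.commute)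
  also have "\<dots> = mfact \<beta> * C \<beta> x $ J $ K"
    using assms by (auto simp: active_def)
  finally show ?thesis .
qed

lemma smooth_on_axis_monom: "open U \<Longrightarrow> smooth_on U (\<lambda>y. axis K (monom_at x \<beta> y))"
  by (intro smooth_on_axis smooth_on_monom_at)

lemma row_orders_subset: "{mabs \<alpha> |\<alpha>. \<exists>x\<in>U. Q \<alpha> x $ K \<noteq> 0} \<subseteq> mabs ` active U Q"
proof -
  have "Q \<alpha> x \<noteq> 0" if "Q \<alpha> x $ K \<noteq> 0" for \<alpha> x using that by auto
  then show ?thesis unfolding active_def by blast
qed

lemma row_order_ge:
  assumes "smooth_coeffs U Q" "x \<in> U" "Q \<alpha> x $ K \<noteq> 0"
  shows "mabs \<alpha> \<le> row_order U Q K"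
proof -
  have "finite {mabs \<alpha> |\<alpha>. \<exists>x\<in>U. Q \<alpha> x $ K \<noteq> 0}"
    using assms(1) finite_surj[OF _ row_orders_subset] unfolding smooth_coeffs_def by blast
  then have "bdd_above {mabs \<alpha> |\<alpha>. \<exists>x\<in>U. Q \<alpha> x $ K \<noteq> 0}" by simp
  then show ?thesis unfolding row_order_def by (rule cSup_upper[rotated]) (use assms in blast)
qed

lemma row_order_attained:
  assumes "smooth_coeffs U Q" "row_order U Q K > 0"
  obtains \<alpha> x where "x \<in> U" "mabs \<alpha> = row_order U Q K" "Q \<alpha> x $ K \<noteq> 0"
proof -
  let ?S = "{mabs \<alpha> |\<alpha>. \<exists>x\<in>U. Q \<alpha> x $ K \<noteq> 0}"
  have "?S \<noteq> {}" using assms(2) unfolding row_order_def by (metis Sup_nat_empty less_irrefl)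
  moreover have "finite ?S"
    using assms(1) finite_surj[OF _ row_orders_subset] unfolding smooth_coeffs_def by blast
  ultimately have "row_order U Q K \<in> ?S" unfolding row_order_def by (metis (lifting) Max_in cSup_eq_Max)
  then obtain \<alpha> x where "x \<in> U" "mabs \<alpha> = row_order U Q K" "Q \<alpha> x $ K \<noteq> 0" by force
  then show ?thesis by (rule that)
qed

section \<open>The pairing\<close>

abbreviation cdot :: "complex^'k::finite \<Rightarrow> complex^'k \<Rightarrow> complex" where
  "cdot v w \<equiv> \<Sum>K\<in>UNIV. v $ K * cnj (w $ K)"

abbreviation pairing :: "(real^'d::finite) set \<Rightarrow> (real^'d \<Rightarrow> complex^'k::finite) \<Rightarrow> (real^'d \<Rightarrow> complex^'k) \<Rightarrow> complex" where
  "pairing U u w \<equiv> (LINT x:U|lborel. cdot (u x) (w x))"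

lemma cdot_cmod: "cdot e e = of_real (\<Sum>K\<in>UNIV. (cmod (e $ K))\<^sup>2)"
  by (simp only: of_real_sum complex_norm_square)

lemma cdot_eq_0_iff: "cdot e e = 0 \<longleftrightarrow> e = 0"
proof
  assume "cdot e e = 0"
  then have "(\<Sum>K\<in>UNIV. (cmod (e $ K))\<^sup>2) = 0" unfolding cdot_cmod by (simp only: of_real_eq_0_iff)
  then have "\<forall>K. (cmod (e $ K))\<^sup>2 = 0" by (subst (asm) sum_nonneg_eq_0_iff) auto
  then show "e = 0" by (simp add: vec_eq_iff)
qed simp

lemma cdot_scale_left: "cdot (c *s v) w = c * cdot v w"
  by (simp add: sum_distrib_left mult.assoc)

lemma cdot_diff_right: "cdot e (v - w) = cdot e v - cdot e w"
  by (simp add: right_diff_distrib sum_subtractf)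

lemma eq_if_cdot_eq:
  assumes "cdot (v - w) v = cdot (v - w) w" shows "v = w"
  using assms cdot_eq_0_iff[of "v - w"] unfolding cdot_diff_right by simp

lemma pairing_cong:
  assumes "open U" "\<And>y. y \<in> U \<Longrightarrow> cdot (u y) (w y) = cdot (u' y) (w' y)"
  shows "pairing U u w = pairing U u' w'"
  using assms by (intro set_lebesgue_integral_cong) auto

lemma pairing_commute: "pairing U w u = cnj (pairing U u w)"
  unfolding set_lebesgue_integral_def Bochner_Integration.integral_cnj[symmetric]
  by (simp add: mult.commute cong: Bochner_Integration.integral_cong)

context
  fixes U :: "(real^'d::finite) set"
  assumes U: "open U"
begin

lemma pairing_UNIV: "ctest U u \<Longrightarrow> pairing U u w = (LINT y|lborel. cdot (u y) (w y))"
  using ctest_eq_0[of U u] by (intro set_integral_eq_integral) auto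

lemma cdot_integrable:
  "ctest U u \<Longrightarrow> smooth_on U w \<Longrightarrow> integrable lborel (\<lambda>y. cdot (u y) (w y))"
  by (intro Bochner_Integration.integrable_sum ctest_integrable[OF U] ctest_mult[OF U] ctest_nth[OF U]
      smooth_on_cnj[OF U] smooth_on_nth[OF U])

lemma pairing_add_right:
  assumes "ctest U u" "smooth_on U v" "smooth_on U w"
  shows "pairing U u (\<lambda>y. v y + w y) = pairing U u v + pairing U u w"
  unfolding pairing_UNIV[OF assms(1)]
    Bochner_Integration.integral_add[OF cdot_integrable[OF assms(1,2)] cdot_integrable[OF assms(1,3)], symmetric]
  by (simp add: distrib_left sum.distrib)

lemma pairing_diff_right:
  assumes "ctest U u" "smooth_on U v" "smooth_on U w"
  shows "pairing U u (\<lambda>y. v y - w y) = pairing U u v - pairing U u w"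
  unfolding pairing_UNIV[OF assms(1)]
    Bochner_Integration.integral_diff[OF cdot_integrable[OF assms(1,2)] cdot_integrable[OF assms(1,3)], symmetric]
  by (simp add: right_diff_distrib sum_subtractf)

lemma pairing_nondegenerate:
  assumes w: "smooth_on U w" and 0: "\<And>p. ctest U p \<Longrightarrow> pairing U w p = 0" and x: "x \<in> U"
  shows "w x = 0"
proof -
  obtain \<theta> :: "real^'d \<Rightarrow> real" and r where \<theta>: "ctest U (\<lambda>y. complex_of_real (\<theta> y))" "\<And>y. 0 \<le> \<theta> y"
    "0 < r" "\<And>y. y \<in> ball x r \<Longrightarrow> \<theta> y = 1" "\<theta> x \<noteq> 0"
    using ctest_cutoff_exists[OF U x] by metis
  \<comment> \<open>testing \<open>w\<close> with a multiple of itself by a cutoff\<close>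
  define p where "p y = of_real (\<theta> y) *s w y" for y
  have p: "ctest U p" unfolding p_def by (rule ctest_scale[OF U \<theta>(1) w])
  have "smooth_on U (\<lambda>y. cdot (w y) (w y))"
    by (intro smooth_on_sum[OF U] smooth_on_mult[OF U] smooth_on_cnj[OF U] smooth_on_nth[OF U] w)
  moreover have "(LINT y|lborel. of_real (\<theta> y) * cdot (w y) (w y)) = 0"
  proof -
    have "cdot (p y) (w y) = of_real (\<theta> y) * cdot (w y) (w y)" for y
      unfolding p_def by (rule cdot_scale_left)
    then have "(LINT y|lborel. of_real (\<theta> y) * cdot (w y) (w y)) = pairing U p w"
      unfolding pairing_UNIV[OF p] by simp
    also have "\<dots> = 0" using 0[OF p] by (simp add: pairing_commute[of U p])
    finally show ?thesis .
  qed
  ultimately have "cdot (w x) (w x) = 0"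
    using \<theta>(1,2,5) by (intro smooth_eq_0_if_weighted_integral_0[OF U _ cdot_cmod]) (auto intro: sum_nonneg)
  then show ?thesis by (simp only: cdot_eq_0_iff)
qed

end

section \<open>Formal adjoints\<close>

lemma leib_cong:
  assumes U: "open U" and "\<And>y. y \<in> U \<Longrightarrow> a y = b y" and "x \<in> U"
  shows "leib w a \<beta> x = leib w b \<beta> x"
  using assms(3)
proof (induction w arbitrary: \<beta> x)
  case Nil then show ?case using assms(2) by simp
next
  case (Cons i w)
  then show ?case using pd_cong[OF U Cons.prems, of "leib w a \<beta>" "leib w b \<beta>"]
    by (simp del: fun_upd_apply)
qed

text \<open>The operator \<open>p \<mapsto> \<Sum>\<^sub>\<alpha> (-1)\<^bsup>|\<alpha>|\<^esup> \<partial>\<^sup>\<alpha> (C\<^sub>\<alpha>\<^sup>* p)\<close>, where \<open>C\<^sub>\<alpha>\<^sup>*\<close> is the conjugate transpose, expanded by the Leibniz rule.\<close>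

definition adjoint_coeffs :: "(real^'d::finite) set \<Rightarrow> ('d, 'k::finite, 'j::finite) coeffs \<Rightarrow> ('d, 'j, 'k) coeffs" where
  "adjoint_coeffs U C \<beta> x = (\<chi> K J. \<Sum>\<alpha>\<in>active U C.
     (- 1) ^ mabs \<alpha> * leib (mword \<alpha>) (\<lambda>y. cnj (C \<alpha> y $ J $ K)) \<beta> x)"

lemma leib_cnj_coeff_eq_0:
  fixes C :: "('d::finite, 'k::finite, 'j::finite) coeffs"
  assumes "open U" "x \<in> U" "\<And>y. y \<in> U \<Longrightarrow> C \<alpha> y $ J $ K = 0"
  shows "leib w (\<lambda>y. cnj (C \<alpha> y $ J $ K)) \<beta> x = 0"
  using leib_cong[OF assms(1), of "\<lambda>y. cnj (C \<alpha> y $ J $ K)" "\<lambda>_. 0" x w \<beta>] assms by (simp add: leib_const)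

text \<open>Integration by parts leaves the coefficients of highest order unchanged up to sign and
  conjugation; everything else is of lower order.\<close>

lemma adjoint_coeffs_top:
  fixes C :: "('d::finite, 'k::finite, 'j::finite) coeffs"
  assumes U: "open U" "x \<in> U" and fin: "finite (active U C)"
    and above: "\<And>\<alpha> y. mabs \<alpha> > mabs \<beta> \<Longrightarrow> y \<in> U \<Longrightarrow> C \<alpha> y $ J $ K = 0"
  shows "adjoint_coeffs U C \<beta> x $ K $ J = (- 1) ^ mabs \<beta> * cnj (C \<beta> x $ J $ K)"
proof -
  have t: "leib (mword \<alpha>) (\<lambda>y. cnj (C \<alpha> y $ J $ K)) \<beta> x = (if \<alpha> = \<beta> then cnj (C \<beta> x $ J $ K) else 0)" for \<alpha>
  proof -
    consider "mabs \<alpha> > mabs \<beta>" | "mabs \<alpha> = mabs \<beta>" | "mabs \<alpha> < mabs \<beta>" by linarith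
    then show ?thesis
    proof cases
      case 1
      then show ?thesis using leib_cnj_coeff_eq_0[OF U, of C \<alpha> J K] above by auto
    next
      case 2
      then show ?thesis
        using leib_top[of \<beta> "mword \<alpha>" "\<lambda>y. cnj (C \<alpha> y $ J $ K)"] by (auto simp: length_mword count_mword)
    next
      case 3
      then show ?thesis using leib_above[of "mword \<alpha>" \<beta>] by (auto simp: length_mword)
    qed
  qed
  show ?thesis
  proof (cases "\<beta> \<in> active U C")
    case True
    then show ?thesis unfolding adjoint_coeffs_def
      by (simp add: t if_distrib[of "\<lambda>z. _ * z"] sum.delta[OF fin] cong: if_cong)
  next
    case False
    then have "C \<beta> x = 0" using U by (auto simp: active_def)
    then show ?thesis using False unfolding adjoint_coeffs_def
      by (simp add: t if_distrib[of "\<lambda>z. _ * z"] sum.delta[OF fin] cong: if_cong)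
  qed
qed

lemma adjoint_coeffs_eq_0:
  fixes C :: "('d::finite, 'k::finite, 'j::finite) coeffs"
  assumes U: "open U" "x \<in> U" and fin: "finite (active U C)"
    and above: "\<And>\<alpha> y. mabs \<alpha> \<ge> mabs \<beta> \<Longrightarrow> y \<in> U \<Longrightarrow> C \<alpha> y $ J $ K = 0"
  shows "adjoint_coeffs U C \<beta> x $ K $ J = 0"
  using adjoint_coeffs_top[OF U fin, of \<beta> J K] above[of \<beta> x] above U by simp

lemma adjoint_coeffs_bounded:
  fixes C :: "('d::finite, 'k::finite, 'j::finite) coeffs"
  assumes U: "open U" and "\<And>\<alpha> x. x \<in> U \<Longrightarrow> mabs \<alpha> > N \<Longrightarrow> C \<alpha> x = 0"
    and "x \<in> U" "mabs \<beta> > N"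
  shows "adjoint_coeffs U C \<beta> x = 0"
proof -
  have "adjoint_coeffs U C \<beta> x $ K $ J = 0" for K J
    using assms by (intro adjoint_coeffs_eq_0 active_finiteI[of U N]) auto
  then show ?thesis by (simp add: vec_eq_iff)
qed

lemma smooth_coeffs_adjoint_coeffs:
  assumes U: "open U" and C: "smooth_coeffs U C"
  shows "smooth_coeffs U (adjoint_coeffs U C)"
proof -
  obtain N where N: "\<And>\<alpha> x. x \<in> U \<Longrightarrow> mabs \<alpha> > N \<Longrightarrow> C \<alpha> x = 0"
    using active_bounded C unfolding smooth_coeffs_def by blast
  have "smooth_on U (\<lambda>x. adjoint_coeffs U C \<beta> x $ K $ J)" for \<beta> K J
    unfolding adjoint_coeffs_def using C
    by (auto simp: smooth_coeffs_def intro!: smooth_on_sum[OF U] smooth_on_mult[OF U] smooth_on_const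
        smooth_on_leib[OF U] smooth_on_cnj[OF U] smooth_on_nth[OF U])
  then have "smooth_on U (adjoint_coeffs U C \<beta>)" for \<beta>
    by (intro smooth_on_vec[OF U])
  moreover have "finite (active U (adjoint_coeffs U C))"
    by (rule active_finiteI[of U N]) (rule adjoint_coeffs_bounded[OF U N])
  ultimately show ?thesis unfolding smooth_coeffs_def by blast
qed

lemma apply_adjoint_coeffs:
  fixes C :: "('d::finite, 'k::finite, 'j::finite) coeffs"
  assumes U: "open U" and x: "x \<in> U" and C: "smooth_coeffs U C" and p: "smooth_on U p"
  shows "cnj (apply_coeffs U (adjoint_coeffs U C) p x $ K)
    = (\<Sum>\<alpha>\<in>active U C. \<Sum>J\<in>UNIV. (- 1) ^ mabs \<alpha> * mpd \<alpha> (\<lambda>y. C \<alpha> y $ J $ K * cnj (p y $ J)) x)"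
proof -
  have fin: "finite (active U C)" and sm: "smooth_on U (\<lambda>y. C \<alpha> y $ J $ K)" for \<alpha> J
    using C by (auto simp: smooth_coeffs_def intro!: smooth_on_nth[OF U])
  obtain N where N: "\<And>\<alpha> x. x \<in> U \<Longrightarrow> mabs \<alpha> > N \<Longrightarrow> C \<alpha> x = 0" using active_bounded[OF fin] by blast
  let ?l = "\<lambda>\<alpha> J \<beta>. leib (mword \<alpha>) (\<lambda>y. cnj (C \<alpha> y $ J $ K)) \<beta> x"
  have smp: "smooth_on U (\<lambda>y. p y $ J)" for J by (rule smooth_on_nth[OF U p])
  have lz: "?l \<alpha> J \<beta> = 0" if "mabs \<beta> > mabs \<alpha>" for \<alpha> J \<beta>
    using leib_above[of "mword \<alpha>" \<beta>] that by (simp add: length_mword)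
  have m: "cnj (mpd \<alpha> (\<lambda>y. C \<alpha> y $ J $ K * cnj (p y $ J)) x)
      = (\<Sum>\<beta> | mabs \<beta> \<le> N. ?l \<alpha> J \<beta> * mpd \<beta> (\<lambda>y. p y $ J) x)" if "\<alpha> \<in> active U C" for \<alpha> J
  proof -
    have aN: "mabs \<alpha> \<le> N" using that N by (force simp: active_def)
    have "cnj (mpd \<alpha> (\<lambda>y. C \<alpha> y $ J $ K * cnj (p y $ J)) x)
        = mpd \<alpha> (\<lambda>y. cnj (C \<alpha> y $ J $ K * cnj (p y $ J))) x"
      by (rule mpd_cnj[OF U _ x, symmetric]) (intro smooth_on_mult[OF U] smooth_on_cnj[OF U] sm smp)
    also have "\<dots> = mpd \<alpha> (\<lambda>y. cnj (C \<alpha> y $ J $ K) * p y $ J) x" by simp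
    also have "\<dots> = (\<Sum>\<beta> | mabs \<beta> \<le> mabs \<alpha>. ?l \<alpha> J \<beta> * mpd \<beta> (\<lambda>y. p y $ J) x)"
      by (rule mpd_mult[OF U smooth_on_cnj[OF U sm] smp x])
    also have "\<dots> = (\<Sum>\<beta> | mabs \<beta> \<le> N. ?l \<alpha> J \<beta> * mpd \<beta> (\<lambda>y. p y $ J) x)"
      using aN lz by (intro sum.mono_neutral_left) auto
    finally show ?thesis .
  qed
  have "apply_coeffs U (adjoint_coeffs U C) p x $ K
      = (\<Sum>\<beta> | mabs \<beta> \<le> N. \<Sum>J\<in>UNIV. \<Sum>\<alpha>\<in>active U C. (- 1) ^ mabs \<alpha> * (?l \<alpha> J \<beta> * mpd \<beta> (\<lambda>y. p y $ J) x))"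
    using adjoint_coeffs_bounded[OF U N]
    by (simp add: apply_coeffs_nth_le[OF x, of N] adjoint_coeffs_def sum_distrib_right mult.assoc)
  also have "\<dots> = (\<Sum>\<alpha>\<in>active U C. \<Sum>J\<in>UNIV. \<Sum>\<beta> | mabs \<beta> \<le> N. (- 1) ^ mabs \<alpha> * (?l \<alpha> J \<beta> * mpd \<beta> (\<lambda>y. p y $ J) x))"
    by (subst sum.swap, subst (2) sum.swap, subst sum.swap) (rule refl)
  also have "\<dots> = (\<Sum>\<alpha>\<in>active U C. \<Sum>J\<in>UNIV. (- 1) ^ mabs \<alpha> * cnj (mpd \<alpha> (\<lambda>y. C \<alpha> y $ J $ K * cnj (p y $ J)) x))"
    by (intro sum.cong refl) (simp add: m sum_distrib_left)
  finally show ?thesis by simp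
qed

lemma integral_adjoint_coeffs:
  fixes C :: "('d::finite, 'k::finite, 'j::finite) coeffs"
  assumes U: "open U" and C: "smooth_coeffs U C" and u: "ctest U u" and p: "ctest U p"
  shows "pairing U (apply_coeffs U C u) p = pairing U u (apply_coeffs U (adjoint_coeffs U C) p)"
proof -
  let ?A = "active U C"
  have sm: "smooth_on U (\<lambda>y. C \<alpha> y $ J $ K)" for \<alpha> J K
    using C by (auto simp: smooth_coeffs_def intro!: smooth_on_nth[OF U])
  note uK = ctest_nth[OF U u]
  have g: "smooth_on U (\<lambda>y. C \<alpha> y $ J $ K * cnj (p y $ J))" for \<alpha> J K
    by (intro smooth_on_mult[OF U] smooth_on_cnj[OF U] sm ctest_smooth_on[OF ctest_nth[OF U p]])
  let ?t = "\<lambda>J \<alpha> K x. mpd \<alpha> (\<lambda>y. u y $ K) x * (C \<alpha> x $ J $ K * cnj (p x $ J))"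
  let ?s = "\<lambda>J \<alpha> K x. u x $ K * mpd \<alpha> (\<lambda>y. C \<alpha> y $ J $ K * cnj (p y $ J)) x"
  have ti: "integrable lborel (?t J \<alpha> K)" for J \<alpha> K
    by (intro ctest_integrable[OF U] ctest_mult[OF U] ctest_mpd uK g)
  have si: "integrable lborel (?s J \<alpha> K)" for J \<alpha> K
    by (intro ctest_integrable[OF U] ctest_mult[OF U] smooth_on_mpd uK g)
  have "pairing U (apply_coeffs U C u) p
      = (LINT x|lborel. (\<Sum>J\<in>UNIV. \<Sum>\<alpha>\<in>?A. \<Sum>K\<in>UNIV. ?t J \<alpha> K x))"
    using ctest_eq_0[OF p]
    by (subst set_integral_eq_integral) (auto simp: apply_coeffs_def sum_distrib_right sum_distrib_left mult_ac)
  also have "\<dots> = (\<Sum>J\<in>UNIV. \<Sum>\<alpha>\<in>?A. \<Sum>K\<in>UNIV. LINT x|lborel. ?t J \<alpha> K x)"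
    by (simp add: ti)
  also have "\<dots> = (\<Sum>J\<in>UNIV. \<Sum>\<alpha>\<in>?A. \<Sum>K\<in>UNIV. (- 1) ^ mabs \<alpha> * (LINT x|lborel. ?s J \<alpha> K x))"
    by (simp only: integral_mpd_by_parts[OF U uK g])
  also have "\<dots> = (LINT x|lborel. (\<Sum>J\<in>UNIV. \<Sum>\<alpha>\<in>?A. \<Sum>K\<in>UNIV. (- 1) ^ mabs \<alpha> * ?s J \<alpha> K x))"
    by (simp add: si)
  also have "\<dots> = (LINT x:U|lborel. (\<Sum>J\<in>UNIV. \<Sum>\<alpha>\<in>?A. \<Sum>K\<in>UNIV. (- 1) ^ mabs \<alpha> * ?s J \<alpha> K x))"
    using ctest_eq_0[OF uK] by (subst set_integral_eq_integral) auto
  also have "\<dots> = pairing U u (apply_coeffs U (adjoint_coeffs U C) p)"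
  proof (rule set_lebesgue_integral_cong)
    show "U \<in> sets lborel" using U by simp
    show "\<forall>x. x \<in> U \<longrightarrow> (\<Sum>J\<in>UNIV. \<Sum>\<alpha>\<in>?A. \<Sum>K\<in>UNIV. (- 1) ^ mabs \<alpha> * ?s J \<alpha> K x)
        = cdot (u x) (apply_coeffs U (adjoint_coeffs U C) p x)"
    proof (intro allI impI)
      fix x assume x: "x \<in> U"
      have "cdot (u x) (apply_coeffs U (adjoint_coeffs U C) p x)
          = (\<Sum>K\<in>UNIV. \<Sum>\<alpha>\<in>?A. \<Sum>J\<in>UNIV. (- 1) ^ mabs \<alpha> * ?s J \<alpha> K x)"
        by (simp add: apply_adjoint_coeffs[OF U x C ctest_smooth_on[OF p]] sum_distrib_left mult_ac)
      also have "\<dots> = (\<Sum>J\<in>UNIV. \<Sum>\<alpha>\<in>?A. \<Sum>K\<in>UNIV. (- 1) ^ mabs \<alpha> * ?s J \<alpha> K x)"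
        by (subst sum.swap, subst (2) sum.swap, subst sum.swap) (rule refl)
      finally show "(\<Sum>J\<in>UNIV. \<Sum>\<alpha>\<in>?A. \<Sum>K\<in>UNIV. (- 1) ^ mabs \<alpha> * ?s J \<alpha> K x)
        = cdot (u x) (apply_coeffs U (adjoint_coeffs U C) p x)" by simp
    qed
  qed
  finally show ?thesis .
qed

lemma adjoint_coeffs_const:
  fixes B :: "'d::finite mindex \<Rightarrow> complex^'k::finite^'j::finite"
  assumes "finite (active U (\<lambda>\<alpha> x. B \<alpha>))" "x \<in> U"
  shows "adjoint_coeffs U (\<lambda>\<alpha> x. B \<alpha>) \<beta> x $ K $ J = (- 1) ^ mabs \<beta> * cnj (B \<beta> $ J $ K)"
proof (cases "\<beta> \<in> active U (\<lambda>\<alpha> x. B \<alpha>)")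
  case True
  then show ?thesis unfolding adjoint_coeffs_def leib_const count_mword
    by (simp add: if_distrib[of "\<lambda>z. _ * z"] sum.delta'[OF assms(1)] cong: if_cong)
next
  case False
  then have "B \<beta> = 0" using assms(2) by (auto simp: active_def)
  then show ?thesis using False unfolding adjoint_coeffs_def leib_const count_mword
    by (simp add: if_distrib[of "\<lambda>z. _ * z"] sum.delta'[OF assms(1)] cong: if_cong)
qed

text \<open>Two operators whose coefficients agree as functionals on \<open>e\<close> agree when they are paired with \<open>e\<close>, whatever
  they do in the directions orthogonal to \<open>e\<close>.\<close>

lemma cdot_apply_coeffs_cong:
  fixes C D :: "('d::finite, 'j::finite, 'k::finite) coeffs"
  assumes x: "x \<in> U" and fin: "finite (active U C)" "finite (active U D)"
    and eq: "\<And>\<beta> J. (\<Sum>K\<in>UNIV. e $ K * cnj (C \<beta> x $ K $ J)) = (\<Sum>K\<in>UNIV. e $ K * cnj (D \<beta> x $ K $ J))"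
  shows "cdot e (apply_coeffs U C p x) = cdot e (apply_coeffs U D p x)"
proof -
  let ?S = "active U C \<union> active U D"
  have "cdot e (apply_coeffs U F p x)
      = (\<Sum>\<beta>\<in>?S. \<Sum>J\<in>UNIV. (\<Sum>K\<in>UNIV. e $ K * cnj (F \<beta> x $ K $ J)) * cnj (mpd \<beta> (\<lambda>y. p y $ J) x))"
    if "F \<in> {C, D}" for F
  proof -
    have "apply_coeffs U F p x $ K = (\<Sum>\<beta>\<in>?S. \<Sum>J\<in>UNIV. F \<beta> x $ K $ J * mpd \<beta> (\<lambda>y. p y $ J) x)" for K
      by (rule apply_coeffs_nth) (use that x fin in \<open>auto simp: active_def\<close>)
    then have "cdot e (apply_coeffs U F p x) = (\<Sum>K\<in>UNIV. \<Sum>\<beta>\<in>?S. \<Sum>J\<in>UNIV.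
        e $ K * cnj (F \<beta> x $ K $ J) * cnj (mpd \<beta> (\<lambda>y. p y $ J) x))"
      by (simp add: sum_distrib_left mult.assoc)
    also have "\<dots> = (\<Sum>\<beta>\<in>?S. \<Sum>J\<in>UNIV. \<Sum>K\<in>UNIV. e $ K * cnj (F \<beta> x $ K $ J) * cnj (mpd \<beta> (\<lambda>y. p y $ J) x))"
      by (subst sum.swap, subst (2) sum.swap) (rule refl)
    finally show ?thesis by (simp only: sum_distrib_right)
  qed
  then show ?thesis using eq by simp
qed

lemma test_sections_iff: "u \<in> test_sections U E \<longleftrightarrow> ctest U u \<and> (\<forall>x\<in>U. u x \<in> E x)"
  unfolding test_sections_def sections_def ctest_def by auto

section \<open>Principal parts of adjoint pairs\<close>

text \<open>The components that have order \<open>n\<close>. In a pair of tensors the orders differ between the two constituents, and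
  each order is treated separately.\<close>

definition block :: "('k \<Rightarrow> nat) \<Rightarrow> nat \<Rightarrow> complex^'k \<Rightarrow> complex^'k::finite" where
  "block ord n e = (\<chi> K. if ord K = n then e $ K else 0)"

lemma block_nth [simp]: "block ord n e $ K = (if ord K = n then e $ K else 0)"
  by (simp add: block_def)

lemma formal_adjointD:
  assumes "formal_adjoint U E E' P Q"
  shows "smooth_coeffs U Q"
    and "smooth_on U p \<Longrightarrow> x \<in> U \<Longrightarrow> apply_coeffs U Q p x \<in> E' x"
    and "u \<in> test_sections U E \<Longrightarrow> p \<in> test_sections U (\<lambda>x. UNIV) \<Longrightarrow>
        pairing U (P u) p = pairing U u (apply_coeffs U Q p)"
  using assms unfolding formal_adjoint_def by simp_all

lemma representsD:
  assumes "represents U E C P"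
  shows "smooth_coeffs U C" and "u \<in> sections U E \<Longrightarrow> x \<in> U \<Longrightarrow> P u x = apply_coeffs U C u x"
  using assms unfolding represents_def by simp_all

text \<open>In \<open>column_op\<close> and \<open>row_op\<close> the component \<open>K\<close> is the one that carries the order: an input of the operator and
  an output of its adjoint.\<close>

definition column_op :: "('k::finite \<Rightarrow> nat) \<Rightarrow> ('d::finite mindex \<Rightarrow> complex^'k^'j::finite)
    \<Rightarrow> (real^'d \<Rightarrow> complex^'k) \<Rightarrow> real^'d \<Rightarrow> complex^'j" where
  "column_op ord B u x = (\<chi> J. \<Sum>K\<in>UNIV. \<Sum>\<alpha> | mabs \<alpha> = ord K. B \<alpha> $ J $ K * mpd \<alpha> (\<lambda>y. u y $ K) x)"

definition row_op :: "('k::finite \<Rightarrow> nat) \<Rightarrow> ('d::finite, 'j::finite, 'k) coeffs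
    \<Rightarrow> (real^'d \<Rightarrow> complex^'j) \<Rightarrow> real^'d \<Rightarrow> complex^'k" where
  "row_op ord A p x = (\<chi> K. \<Sum>\<alpha> | mabs \<alpha> = ord K. \<Sum>J\<in>UNIV. A \<alpha> x $ K $ J * mpd \<alpha> (\<lambda>y. p y $ J) x)"

definition row_symbol :: "('k::finite \<Rightarrow> nat) \<Rightarrow> ('d::finite, 'j::finite, 'k) coeffs
    \<Rightarrow> real^'d \<Rightarrow> complex^'d \<Rightarrow> complex^'j^'k" where
  "row_symbol ord A x \<xi> = (\<chi> K J. \<Sum>\<alpha> | mabs \<alpha> = ord K. A \<alpha> x $ K $ J * \<i> ^ mabs \<alpha> * mpow \<xi> \<alpha>)"

lemma inj_mult_vec_if_kernel_trivial:
  fixes S :: "complex^'j::finite^'k::finite"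
  assumes "\<And>v. S *v v = 0 \<Longrightarrow> v = 0"
  shows "inj (\<lambda>v. S *v v)"
proof (rule injI)
  fix v w assume "S *v v = S *v w"
  then have "S *v (v - w) = 0" by (simp add: matrix_vector_mult_diff_distrib)
  then show "v = w" using assms by fastforce
qed

text \<open>The pointwise data of a model operator with constant coefficients \<open>B\<close> on \<open>E\<close>-valued functions and of its
  model adjoint with coefficients \<open>A\<close>. The model adjoint is the adjoint up to terms of lower order only,
  because its coefficients may depend on \<open>x\<close> through the metric. The assumption \<open>extension\<close> makes every value
  in a fibre accessible to differential operators on sections, and \<open>A_row\<close> makes \<open>ord K\<close> the actual order of
  every component.\<close>

locale principal_pair =
  fixes U :: "(real^'d::finite) set"
    and E E' :: "real^'d \<Rightarrow> (complex^'k::finite) set"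
    and ord :: "'k \<Rightarrow> nat"
    and A :: "('d, 'j::finite, 'k) coeffs"
    and B :: "'d mindex \<Rightarrow> complex^'k^'j"
  assumes U: "open U"
    and E_zero: "\<And>x. x \<in> U \<Longrightarrow> 0 \<in> E x"
    and E_scale: "\<And>x e c. x \<in> U \<Longrightarrow> e \<in> E x \<Longrightarrow> c *s e \<in> E x"
    and E_block: "\<And>x e n. x \<in> U \<Longrightarrow> e \<in> E x \<Longrightarrow> block ord n e \<in> E x"
    and E'_scale: "\<And>x w c. x \<in> U \<Longrightarrow> w \<in> E' x \<Longrightarrow> c *s w \<in> E' x"
    and E'_block: "\<And>x w n. x \<in> U \<Longrightarrow> w \<in> E' x \<Longrightarrow> block ord n w \<in> E' x"
    and separating: "\<And>x w w'. x \<in> U \<Longrightarrow> w \<in> E' x \<Longrightarrow> w' \<in> E' x \<Longrightarrow>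
      (\<And>e. e \<in> E x \<Longrightarrow> cdot e w = cdot e w') \<Longrightarrow> w = w'"
    and extension: "\<And>x e. x \<in> U \<Longrightarrow> e \<in> E x \<Longrightarrow> \<exists>u\<in>sections U E. u x = e"
    and A_order: "\<And>x \<alpha> K. x \<in> U \<Longrightarrow> mabs \<alpha> \<noteq> ord K \<Longrightarrow> A \<alpha> x $ K = 0"
    and B_order: "\<And>\<alpha> J K. mabs \<alpha> \<noteq> ord K \<Longrightarrow> B \<alpha> $ J $ K = 0"
    and A_E': "\<And>x \<alpha> J. x \<in> U \<Longrightarrow> (\<chi> K. A \<alpha> x $ K $ J) \<in> E' x"
    and A_adjoint_B: "\<And>x e \<alpha> J. x \<in> U \<Longrightarrow> e \<in> E x \<Longrightarrow>
      (\<Sum>K\<in>UNIV. e $ K * cnj (A \<alpha> x $ K $ J)) = (- 1) ^ mabs \<alpha> * (\<Sum>K\<in>UNIV. B \<alpha> $ J $ K * e $ K)"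
    and A_row: "\<And>x K. x \<in> U \<Longrightarrow> \<exists>\<alpha>. A \<alpha> x $ K \<noteq> 0"
begin

abbreviation "Bop \<equiv> column_op ord B"

abbreviation "Aop \<equiv> row_op ord A"

abbreviation "Asymb \<equiv> row_symbol ord A"

text \<open>The condition to which both prescriptions of a principal part are reduced.\<close>

definition has_principal :: "('d, 'j, 'k) coeffs \<Rightarrow> bool" where
  "has_principal Q \<longleftrightarrow> (\<forall>K. row_order U Q K = ord K) \<and>
     (\<forall>x\<in>U. \<forall>\<alpha> K. mabs \<alpha> = ord K \<longrightarrow> Q \<alpha> x $ K = A \<alpha> x $ K)"

lemma sum_order_eq:
  assumes "\<And>\<alpha>. mabs \<alpha> \<noteq> ord K \<Longrightarrow> f \<alpha> = 0" "ord K \<le> N"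
  shows "(\<Sum>\<alpha> | mabs \<alpha> = ord K. f \<alpha>) = (\<Sum>\<alpha> | mabs \<alpha> \<le> N. f \<alpha>)"
  using assms by (intro sum.mono_neutral_left) auto

lemma B_bound: "mabs \<alpha> > Max (range ord) \<Longrightarrow> B \<alpha> = 0"
proof -
  assume *: "mabs \<alpha> > Max (range ord)"
  have "B \<alpha> $ J $ K = 0" for J K
    using * Max_ge[of "range ord" "ord K"] by (intro B_order) auto
  then show ?thesis by (simp add: vec_eq_iff)
qed

lemma A_bound: "x \<in> U \<Longrightarrow> mabs \<alpha> > Max (range ord) \<Longrightarrow> A \<alpha> x = 0"
proof -
  assume *: "x \<in> U" "mabs \<alpha> > Max (range ord)"
  have "A \<alpha> x $ K = 0" for K
    using * Max_ge[of "range ord" "ord K"] by (intro A_order) auto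
  then show ?thesis by (simp add: vec_eq_iff)
qed

lemma finite_active_A: "finite (active U A)"
  using A_bound by (rule active_finiteI)

lemma smooth_coeffs_B: "smooth_coeffs U (\<lambda>\<alpha> x. B \<alpha>)"
  unfolding smooth_coeffs_def
  using active_finiteI[of U "Max (range ord)" "\<lambda>\<alpha> x. B \<alpha>"] B_bound by blast

lemma apply_A_nth:
  assumes "x \<in> U"
  shows "apply_coeffs U A p x $ K
    = (\<Sum>\<alpha> | mabs \<alpha> \<le> Max (range ord). \<Sum>J\<in>UNIV. A \<alpha> x $ K $ J * mpd \<alpha> (\<lambda>y. p y $ J) x)"
  by (rule apply_coeffs_nth_le[OF assms]) (rule A_bound)

lemma apply_B_nth:
  assumes "x \<in> U"
  shows "apply_coeffs U (\<lambda>\<alpha> x. B \<alpha>) u x $ J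
    = (\<Sum>\<alpha> | mabs \<alpha> \<le> Max (range ord). \<Sum>K\<in>UNIV. B \<alpha> $ J $ K * mpd \<alpha> (\<lambda>y. u y $ K) x)"
  by (rule apply_coeffs_nth_le[OF assms]) (rule B_bound)

lemma Bop_apply: "x \<in> U \<Longrightarrow> Bop u x = apply_coeffs U (\<lambda>\<alpha> x. B \<alpha>) u x"
proof -
  assume x: "x \<in> U"
  have "Bop u x $ J = apply_coeffs U (\<lambda>\<alpha> x. B \<alpha>) u x $ J" for J
  proof -
    have "Bop u x $ J = (\<Sum>K\<in>UNIV. \<Sum>\<alpha> | mabs \<alpha> \<le> Max (range ord). B \<alpha> $ J $ K * mpd \<alpha> (\<lambda>y. u y $ K) x)"
      unfolding column_op_def by (simp, intro sum.cong refl sum_order_eq) (auto simp: B_order)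
    also have "\<dots> = apply_coeffs U (\<lambda>\<alpha> x. B \<alpha>) u x $ J"
      by (subst sum.swap) (simp only: apply_B_nth[OF x])
    finally show ?thesis .
  qed
  then show ?thesis by (simp add: vec_eq_iff)
qed

lemma Aop_apply: "x \<in> U \<Longrightarrow> Aop p x = apply_coeffs U A p x"
proof -
  assume x: "x \<in> U"
  have "Aop p x $ K = apply_coeffs U A p x $ K" for K
  proof -
    have "Aop p x $ K = (\<Sum>\<alpha> | mabs \<alpha> \<le> Max (range ord). \<Sum>J\<in>UNIV. A \<alpha> x $ K $ J * mpd \<alpha> (\<lambda>y. p y $ J) x)"
      unfolding row_op_def by (simp, rule sum_order_eq) (auto simp: A_order[OF x])
    also have "\<dots> = apply_coeffs U A p x $ K"
      by (simp only: apply_A_nth[OF x])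
    finally show ?thesis .
  qed
  then show ?thesis by (simp add: vec_eq_iff)
qed

lemma Aop_monom: "x \<in> U \<Longrightarrow> Aop (\<lambda>y. axis J (monom_at x \<beta> y)) x $ K = mfact \<beta> * A \<beta> x $ K $ J"
  by (simp add: Aop_apply apply_coeffs_monom finite_active_A)

lemma scale_section:
  assumes "u \<in> sections U E" "smooth_on U c"
  shows "(\<lambda>y. c y *s u y) \<in> sections U E"
proof -
  have "smooth_on U u" "\<forall>x\<in>U. u x \<in> E x" using assms(1) unfolding sections_def by blast+
  then show ?thesis
    using smooth_on_scale[OF U assms(2), of u] E_scale unfolding sections_def by blast
qed

lemma block_section:
  assumes "u \<in> sections U E"
  shows "(\<lambda>y. block ord n (u y)) \<in> sections U E"
proof -
  have "smooth_on U (\<lambda>y. block ord n (u y) $ K)" for K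
    using assms by (cases "ord K = n") (auto simp: sections_def intro!: smooth_on_nth[OF U])
  then show ?thesis using assms E_block by (auto simp: sections_def intro!: smooth_on_vec[OF U])
qed

lemma scale_test_section:
  assumes "u \<in> sections U E" "ctest U c"
  shows "(\<lambda>y. c y *s u y) \<in> test_sections U E"
  using scale_section[OF assms(1) ctest_smooth_on[OF assms(2)]] ctest_scale[OF U assms(2), of u] assms(1)
  unfolding test_sections_iff sections_def by blast

lemma sum_block: "(\<Sum>K\<in>UNIV. block ord n e $ K * f K) = (\<Sum>K | ord K = n. e $ K * f K)"
proof -
  have "(\<Sum>K\<in>UNIV. block ord n e $ K * f K) = (\<Sum>K\<in>UNIV. if ord K = n then e $ K * f K else 0)"
    by (rule sum.cong) simp_all
  then show ?thesis by (simp add: sum.If_cases)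
qed

lemma adjoint_column:
  assumes "formal_adjoint U E E' P Q" "x \<in> U"
  shows "(\<chi> K. Q \<beta> x $ K $ J) \<in> E' x"
proof -
  note Q = formal_adjointD(1)[OF assms(1)] and val = formal_adjointD(2)[OF assms(1)]
  have "inverse (mfact \<beta>) *s apply_coeffs U Q (\<lambda>y. axis J (monom_at x \<beta> y)) x \<in> E' x"
    by (rule E'_scale[OF assms(2) val[OF smooth_on_axis_monom[OF U] assms(2)]])
  also have "inverse (mfact \<beta>) *s apply_coeffs U Q (\<lambda>y. axis J (monom_at x \<beta> y)) x = (\<chi> K. Q \<beta> x $ K $ J)"
    using Q by (simp add: vec_eq_iff apply_coeffs_monom[OF assms(2)] smooth_coeffs_def)
  finally show ?thesis .
qed

text \<open>The two sides of the adjoint relation are compared on test sections of the form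
  \<open>\<theta> \<cdot> cnj s \<cdot> v\<close>, where \<open>s\<close> is the quantity that is to vanish.\<close>

lemma adjoint_coeffs_agree:
  fixes Q :: "('d, 'j, 'k) coeffs"
  assumes rep: "represents U E C P" and adj: "formal_adjoint U E E' P Q"
    and x: "x \<in> U" and e: "e \<in> E x"
  shows "(\<Sum>K\<in>UNIV. e $ K * cnj (Q \<beta> x $ K $ J))
    = (\<Sum>K\<in>UNIV. e $ K * cnj (adjoint_coeffs U C \<beta> x $ K $ J))"
proof -
  let ?L = "adjoint_coeffs U C"
  note C = representsD(1)[OF rep] and PC = representsD(2)[OF rep]
  note Q = formal_adjointD(1)[OF adj] and PQ = formal_adjointD(3)[OF adj]
  have L: "smooth_coeffs U ?L" by (rule smooth_coeffs_adjoint_coeffs[OF U C])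
  obtain v where v: "v \<in> sections U E" "v x = e" using extension[OF x e] by blast
  have vs: "smooth_on U v" using v unfolding sections_def by blast
  obtain \<theta> :: "real^'d \<Rightarrow> real" and r where \<theta>: "ctest U (\<lambda>y. complex_of_real (\<theta> y))" "\<And>y. 0 \<le> \<theta> y"
    "0 < r" "\<And>y. y \<in> ball x r \<Longrightarrow> \<theta> y = 1" "\<theta> x \<noteq> 0"
    using ctest_cutoff_exists[OF U x] by metis
  let ?m = "\<lambda>y. axis J (monom_at x \<beta> y) :: complex^'j"
  define p :: "real^'d \<Rightarrow> complex^'j" where "p y = complex_of_real (\<theta> y) *s ?m y" for y
  have p: "ctest U p" unfolding p_def by (intro ctest_scale U \<theta>(1) smooth_on_axis_monom)
  have local: "apply_coeffs U D p x = apply_coeffs U D ?m x" for D :: "('d, 'j, 'k) coeffs"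
    using \<theta>(3,4) by (intro apply_coeffs_cong[OF open_ball, of x x r]) (auto simp: p_def)
  define w where "w y = apply_coeffs U Q p y - apply_coeffs U ?L p y" for y
  have sQ: "smooth_on U (apply_coeffs U Q p)" and sL: "smooth_on U (apply_coeffs U ?L p)"
    using smooth_on_apply_coeffs[OF U] Q L ctest_smooth_on[OF p] by blast+
  define s where "s y = cdot (v y) (w y)" for y
  have s: "smooth_on U s" unfolding s_def w_def
    by (intro smooth_on_sum[OF U] smooth_on_mult[OF U] smooth_on_cnj[OF U] smooth_on_nth[OF U]
        smooth_on_diff[OF U] vs sQ sL)
  define u where "u y = (complex_of_real (\<theta> y) * cnj (s y)) *s v y" for y
  have u: "u \<in> test_sections U E"
    unfolding u_def by (intro scale_test_section v ctest_mult[OF U \<theta>(1)] smooth_on_cnj[OF U] s)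
  then have us: "u \<in> sections U E" unfolding test_sections_def by blast
  have cu: "ctest U u" using u unfolding test_sections_iff by blast
  have "pairing U u (apply_coeffs U Q p) = pairing U (P u) p"
    using PQ[OF u, of p] p by (simp add: test_sections_iff)
  also have "\<dots> = pairing U (apply_coeffs U C u) p"
    by (rule pairing_cong[OF U]) (simp add: PC[OF us])
  also have "\<dots> = pairing U u (apply_coeffs U ?L p)"
    by (rule integral_adjoint_coeffs[OF U C cu p])
  finally have "0 = pairing U u w"
    unfolding w_def by (simp only: pairing_diff_right[OF U cu sQ sL] diff_self)
  also have "\<dots> = (LINT y|lborel. of_real (\<theta> y) * (s y * cnj (s y)))"
    unfolding pairing_UNIV[OF U cu]
    by (rule arg_cong[where f = "integral\<^sup>L lborel"])
      (simp add: fun_eq_iff u_def cdot_scale_left s_def[symmetric] del: vector_smult_component)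
  finally have 0: "(LINT y|lborel. of_real (\<theta> y) * (s y * cnj (s y))) = 0" by simp
  have "smooth_on U (\<lambda>y. s y * cnj (s y))" by (intro smooth_on_mult[OF U] smooth_on_cnj[OF U] s)
  from smooth_eq_0_if_weighted_integral_0[OF U this complex_norm_square[symmetric] _ \<theta>(1,2,5) 0]
  have "s x = 0" by simp
  moreover have "w x $ K = mfact \<beta> * (Q \<beta> x $ K $ J - ?L \<beta> x $ K $ J)" for K
    using Q L by (simp add: w_def local apply_coeffs_monom[OF x] smooth_coeffs_def right_diff_distrib)
  ultimately have "cnj (mfact \<beta>) * (\<Sum>K\<in>UNIV. e $ K * cnj (Q \<beta> x $ K $ J) - e $ K * cnj (?L \<beta> x $ K $ J)) = 0"
    by (simp add: s_def v(2) sum_distrib_left algebra_simps)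
  then show ?thesis by (simp add: sum_subtractf)
qed

text \<open>A section that is the product of the monomial of exponent \<open>\<beta>\<close> with a section supported in the components
  of one order is differentiated only by the coefficient at \<open>\<beta>\<close>.\<close>

lemma column_op_monom_block:
  assumes v: "smooth_on U v" and x: "x \<in> U" and le: "\<And>K. ord K = n \<Longrightarrow> m K \<le> mabs \<beta>"
    and D: "\<And>K. ord K = n \<Longrightarrow> m K \<noteq> mabs \<beta> \<Longrightarrow> D \<beta> $ J $ K = 0"
  shows "column_op m D (\<lambda>y. monom_at x \<beta> y *s block ord n (v y)) x $ J
    = mfact \<beta> * (\<Sum>K | ord K = n. D \<beta> $ J $ K * v x $ K)"
proof -
  let ?u = "\<lambda>y. monom_at x \<beta> y *s block ord n (v y)"
  have "(\<Sum>\<alpha> | mabs \<alpha> = m K. D \<alpha> $ J $ K * mpd \<alpha> (\<lambda>y. ?u y $ K) x)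
      = (if ord K = n then mfact \<beta> * (D \<beta> $ J $ K * v x $ K) else 0)" for K
  proof (cases "ord K = n")
    case True
    have "mpd \<alpha> (\<lambda>y. ?u y $ K) x = (if \<alpha> = \<beta> then mfact \<beta> * v x $ K else 0)" if "mabs \<alpha> = m K" for \<alpha>
      using mpd_mult_monom_at[OF U smooth_on_nth[OF U v, of K] x, of \<alpha> \<beta>] le[OF True] that True
      by (simp add: mult.commute)
    then have "(\<Sum>\<alpha> | mabs \<alpha> = m K. D \<alpha> $ J $ K * mpd \<alpha> (\<lambda>y. ?u y $ K) x)
        = (\<Sum>\<alpha> | mabs \<alpha> = m K. if \<alpha> = \<beta> then mfact \<beta> * (D \<beta> $ J $ K * v x $ K) else 0)"
      by (intro sum.cong refl) auto
    then show ?thesis using D[OF True] True by (auto simp: sum.delta)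
  qed simp
  then have "column_op m D ?u x $ J = (\<Sum>K\<in>UNIV. if ord K = n then mfact \<beta> * (D \<beta> $ J $ K * v x $ K) else 0)"
    unfolding column_op_def by simp
  then show ?thesis by (simp add: sum.If_cases sum_distrib_left)
qed

text \<open>For each order \<open>n\<close>, the coefficients of \<open>Q\<close> and \<open>A\<close> are first compared at the multi-indices \<open>\<beta>\<close> for which
  \<open>|\<beta>|\<close> is at least \<open>n\<close> and at least the orders of all components in the block of \<open>n\<close>. Since \<open>A\<close> vanishes above the
  order \<open>n\<close>, this bounds the orders by \<open>n\<close>; then \<open>|\<beta>| = n\<close> is allowed.\<close>

lemma has_prin_imp_has_principal:
  assumes adj: "formal_adjoint U E E' P Q" and ne: "U \<noteq> {}"
    and R: "\<And>u x. u \<in> sections U E \<Longrightarrow> x \<in> U \<Longrightarrow> R u x = Bop u x"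
    and prin: "has_prin U E Q P R"
  shows "has_principal Q"
proof -
  obtain C where rep: "represents U E C P"
    and C_le: "\<And>\<alpha> J K x. x \<in> U \<Longrightarrow> C \<alpha> x $ J $ K \<noteq> 0 \<Longrightarrow> mabs \<alpha> \<le> row_order U Q K"
    and RC: "\<And>u x. u \<in> sections U E \<Longrightarrow> x \<in> U \<Longrightarrow> R u x = column_op (row_order U Q) (\<lambda>\<alpha>. C \<alpha> x) u x"
    using prin unfolding has_prin_def column_op_def by blast
  note Q = formal_adjointD(1)[OF adj] and C = representsD(1)[OF rep]
  have agree: "Q \<beta> x $ K $ J = A \<beta> x $ K $ J"
    if x: "x \<in> U" and le: "\<And>K. ord K = n \<Longrightarrow> row_order U Q K \<le> mabs \<beta>" and n: "n \<le> mabs \<beta>" and K: "ord K = n"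
    for x \<beta> n K J
  proof -
    have CB: "(\<Sum>K | ord K = n. C \<beta> x $ J $ K * e $ K) = (\<Sum>K | ord K = n. B \<beta> $ J $ K * e $ K)"
      if e: "e \<in> E x" for e
    proof -
      obtain v where v: "v \<in> sections U E" "v x = e" using extension[OF x e] by blast
      then have vs: "smooth_on U v" unfolding sections_def by blast
      let ?u = "\<lambda>y. monom_at x \<beta> y *s block ord n (v y)"
      have u: "?u \<in> sections U E" by (intro scale_section block_section v smooth_on_monom_at)
      have "C \<beta> x $ J $ K = 0" if "ord K = n" "row_order U Q K \<noteq> mabs \<beta>" for K
        using C_le[OF x, of \<beta> J K] le[of K] that by (meson le_antisym)
      from column_op_monom_block[of v x n "row_order U Q" \<beta> "\<lambda>\<alpha>. C \<alpha> x" J, OF vs x le this]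
      have "R ?u x $ J = mfact \<beta> * (\<Sum>K | ord K = n. C \<beta> x $ J $ K * e $ K)"
        by (simp add: RC[OF u x] v(2))
      moreover have "B \<beta> $ J $ K = 0" if "ord K = n" "ord K \<noteq> mabs \<beta>" for K
        using that by (intro B_order) simp
      with column_op_monom_block[OF vs x, of n ord \<beta> B J] n
      have "R ?u x $ J = mfact \<beta> * (\<Sum>K | ord K = n. B \<beta> $ J $ K * e $ K)"
        by (simp add: R[OF u x] v(2))
      ultimately show ?thesis by simp
    qed
    let ?q = "block ord n (\<chi> K. Q \<beta> x $ K $ J)" and ?a = "block ord n (\<chi> K. A \<beta> x $ K $ J)"
    have "?q = ?a"
    proof (rule separating[OF x])
      show "?q \<in> E' x" by (intro E'_block adjoint_column[OF adj] x)
      show "?a \<in> E' x" by (intro E'_block A_E' x)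
      fix e assume e: "e \<in> E x"
      have be: "block ord n e \<in> E x" by (rule E_block[OF x e])
      have "cdot e ?q = (\<Sum>K\<in>UNIV. block ord n e $ K * cnj (Q \<beta> x $ K $ J))"
        by (rule sum.cong) auto
      also have "\<dots> = (\<Sum>K\<in>UNIV. block ord n e $ K * cnj (adjoint_coeffs U C \<beta> x $ K $ J))"
        by (rule adjoint_coeffs_agree[OF rep adj x be])
      also have "\<dots> = (\<Sum>K | ord K = n. e $ K * cnj (adjoint_coeffs U C \<beta> x $ K $ J))"
        by (rule sum_block)
      also have "\<dots> = (\<Sum>K | ord K = n. (- 1) ^ mabs \<beta> * (C \<beta> x $ J $ K * e $ K))"
      proof (rule sum.cong[OF refl])
        fix K assume K: "K \<in> {K. ord K = n}"
        have "C \<alpha> y $ J $ K = 0" if "mabs \<alpha> > mabs \<beta>" "y \<in> U" for \<alpha> y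
          using C_le[OF that(2), of \<alpha> J K] le[of K] K that(1) by fastforce
        then show "e $ K * cnj (adjoint_coeffs U C \<beta> x $ K $ J) = (- 1) ^ mabs \<beta> * (C \<beta> x $ J $ K * e $ K)"
          using C by (subst adjoint_coeffs_top[OF U x]) (auto simp: smooth_coeffs_def)
      qed
      also have "\<dots> = (- 1) ^ mabs \<beta> * (\<Sum>K | ord K = n. B \<beta> $ J $ K * e $ K)"
        by (simp add: sum_distrib_left[symmetric] CB[OF e])
      also have "\<dots> = (- 1) ^ mabs \<beta> * (\<Sum>K\<in>UNIV. B \<beta> $ J $ K * block ord n e $ K)"
        using sum_block[of n e "\<lambda>K. B \<beta> $ J $ K"] by (simp add: mult.commute)
      also have "\<dots> = (\<Sum>K\<in>UNIV. block ord n e $ K * cnj (A \<beta> x $ K $ J))"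
        by (rule A_adjoint_B[OF x be, symmetric])
      also have "\<dots> = cdot e ?a"
        by (rule sum.cong) auto
      finally show "cdot e ?q = cdot e ?a" .
    qed
    then show ?thesis using K by (auto simp: vec_eq_iff dest: spec[of _ K])
  qed
  have le: "row_order U Q K \<le> ord K" for K
  proof (rule ccontr)
    assume *: "\<not> row_order U Q K \<le> ord K"
    \<comment> \<open>the comparison applies at the greatest order in the block, where \<open>A\<close> vanishes and some row of \<open>Q\<close> does not\<close>
    define M where "M = Max (row_order U Q ` {K'. ord K' = ord K})"
    have M: "row_order U Q K' \<le> M" if "ord K' = ord K" for K'
      unfolding M_def using that by (intro Max_ge) auto
    have "M \<in> row_order U Q ` {K'. ord K' = ord K}" unfolding M_def by (intro Max_in) auto
    then obtain K' where K': "ord K' = ord K" "row_order U Q K' = M" by auto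
    have "M > ord K" using * M[of K] by simp
    then have "row_order U Q K' > 0" using K' by simp
    then obtain \<beta> x where b: "x \<in> U" "mabs \<beta> = M" "Q \<beta> x $ K' \<noteq> 0"
      using row_order_attained[OF Q] K'(2) by metis
    have "Q \<beta> x $ K' $ J = A \<beta> x $ K' $ J" for J
      using M b \<open>M > ord K\<close> K' by (intro agree[of x "ord K"]) auto
    moreover have "A \<beta> x $ K' = 0" using A_order[OF b(1)] b(2) \<open>M > ord K\<close> K'(1) by simp
    ultimately show False using b(3) by (simp add: vec_eq_iff)
  qed
  have eq: "Q \<alpha> x $ K = A \<alpha> x $ K" if "x \<in> U" "mabs \<alpha> = ord K" for x \<alpha> K
  proof -
    have "row_order U Q K' \<le> mabs \<alpha>" if "ord K' = ord K" for K' using le[of K'] that \<open>mabs \<alpha> = ord K\<close> by simp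
    then have "Q \<alpha> x $ K $ J = A \<alpha> x $ K $ J" for J using that by (intro agree[of x "ord K"]) auto
    then show ?thesis by (simp add: vec_eq_iff)
  qed
  have "row_order U Q K = ord K" for K
  proof -
    obtain x where x: "x \<in> U" using ne by blast
    obtain \<alpha> where a: "A \<alpha> x $ K \<noteq> 0" using A_row[OF x] by blast
    then have "mabs \<alpha> = ord K" using A_order[OF x] by blast
    then show ?thesis using row_order_ge[OF Q x, of \<alpha> K] eq[OF x] a le[of K] by simp
  qed
  then show ?thesis unfolding has_principal_def using eq by blast
qed

text \<open>The adjoint acts on unconstrained functions, so its coefficients are compared on monomials.\<close>

lemma adjoint_has_prin_iff_has_principal:
  assumes Q: "smooth_coeffs U Q" and ne: "U \<noteq> {}"
    and R: "\<And>p x. smooth_on U p \<Longrightarrow> x \<in> U \<Longrightarrow> R p x = Aop p x"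
  shows "adjoint_has_prin U Q R \<longleftrightarrow> has_principal Q"
proof
  assume *: "adjoint_has_prin U Q R"
  have nth: "(if mabs \<beta> = row_order U Q K then Q \<beta> x $ K $ J else 0) = A \<beta> x $ K $ J" if x: "x \<in> U" for \<beta> x K J
  proof -
    let ?m = "\<lambda>y. axis J (monom_at x \<beta> y) :: complex^'j"
    have m: "mpd \<alpha> (\<lambda>y. ?m y $ J') x = (if J' = J then if \<alpha> = \<beta> then mfact \<beta> else 0 else 0)" for \<alpha> J'
      by (cases "J' = J") (auto simp: axis_def mpd_monom_at)
    have sm: "smooth_on U ?m" by (rule smooth_on_axis_monom[OF U])
    have "mfact \<beta> * A \<beta> x $ K $ J = adjoint_prin U Q ?m x $ K"
      using * R[OF sm x] Aop_monom[OF x, of J \<beta> K] sm x unfolding adjoint_has_prin_def by simp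
    also have "\<dots> = (\<Sum>\<alpha> | mabs \<alpha> = row_order U Q K. if \<alpha> = \<beta> then mfact \<beta> * Q \<beta> x $ K $ J else 0)"
      unfolding adjoint_prin_def m
      by (simp add: if_distrib[of "\<lambda>z. _ * z"] mult.commute cong: if_cong)
    also have "\<dots> = mfact \<beta> * (if mabs \<beta> = row_order U Q K then Q \<beta> x $ K $ J else 0)"
      by (simp add: sum.delta)
    finally show ?thesis by simp
  qed
  have eq: "(if mabs \<beta> = row_order U Q K then Q \<beta> x $ K else 0) = A \<beta> x $ K" if x: "x \<in> U" for \<beta> x K
    using nth[OF x, of \<beta> K] by (cases "mabs \<beta> = row_order U Q K") (simp_all add: vec_eq_iff)
  have "row_order U Q K = ord K" for K
  proof -
    obtain x where x: "x \<in> U" using ne by blast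
    obtain \<alpha> where a: "A \<alpha> x $ K \<noteq> 0" using A_row[OF x] by blast
    then have "mabs \<alpha> = ord K" using A_order[OF x] by blast
    then show ?thesis using eq[OF x, of \<alpha> K] a by (auto split: if_splits)
  qed
  moreover have "Q \<alpha> x $ K = A \<alpha> x $ K" if "x \<in> U" "mabs \<alpha> = ord K" for x \<alpha> K
    using eq[OF that(1), of \<alpha> K] that(2) calculation by simp
  ultimately show "has_principal Q" unfolding has_principal_def by blast
next
  assume *: "has_principal Q"
  show "adjoint_has_prin U Q R"
    unfolding adjoint_has_prin_def adjoint_prin_def
  proof (intro allI impI ballI)
    fix p :: "real^'d \<Rightarrow> complex^'j" and x assume p: "smooth_on U p" and x: "x \<in> U"
    show "(\<chi> K. \<Sum>\<alpha> | mabs \<alpha> = row_order U Q K. \<Sum>J\<in>UNIV. Q \<alpha> x $ K $ J * mpd \<alpha> (\<lambda>y. p y $ J) x) = R p x"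
      unfolding R[OF p x] row_op_def using * x by (simp add: has_principal_def)
  qed
qed

text \<open>The coefficients \<open>B + L\<close> represent \<open>P\<close>, where \<open>L\<close> is the formal adjoint of the terms \<open>G\<close> of \<open>Q\<close> below the
  principal order. The coefficients that are given for \<open>P\<close> are of a
  different kind: in the directions orthogonal to the fibres they may have any order. They show that \<open>P\<close> is
  local and maps smooth sections to smooth functions.\<close>

lemma has_principal_imp_has_prin:
  assumes diff: "diff_op U E P" and adj: "formal_adjoint U E E' P Q"
    and R: "\<And>u x. u \<in> sections U E \<Longrightarrow> x \<in> U \<Longrightarrow> R u x = Bop u x"
    and prin: "has_principal Q"
  shows "has_prin U E Q P R"
proof -
  note Q = formal_adjointD(1)[OF adj] and PQ = formal_adjointD(3)[OF adj]
  obtain D where repD: "represents U E D P" using diff unfolding diff_op_def by blast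
  note D = representsD(1)[OF repD] and PD = representsD(2)[OF repD]
  have ro: "row_order U Q K = ord K" for K using prin unfolding has_principal_def by blast
  define G :: "('d, 'j, 'k) coeffs" where "G \<alpha> x = (\<chi> K. if mabs \<alpha> < ord K then Q \<alpha> x $ K else 0)" for \<alpha> x
  have G_nth: "G \<alpha> x $ K $ J = (if mabs \<alpha> < ord K then Q \<alpha> x $ K $ J else 0)" for \<alpha> x K J by (simp add: G_def)
  have G: "smooth_coeffs U G"
    unfolding smooth_coeffs_def
  proof (intro conjI allI)
    have "active U G \<subseteq> active U Q" by (auto simp: active_def G_def vec_eq_iff split: if_splits)
    then show "finite (active U G)" using Q finite_subset unfolding smooth_coeffs_def by blast
    have "smooth_on U (\<lambda>x. G \<alpha> x $ K $ J)" for \<alpha> K J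
      using Q by (cases "mabs \<alpha> < ord K") (auto simp: G_nth smooth_coeffs_def intro!: smooth_on_nth[OF U])
    then show "smooth_on U (G \<alpha>)" for \<alpha> by (intro smooth_on_vec[OF U])
  qed
  have QGA: "Q \<alpha> x = G \<alpha> x + A \<alpha> x" if "x \<in> U" for \<alpha> x
  proof -
    have "Q \<alpha> x $ K = G \<alpha> x $ K + A \<alpha> x $ K" for K
    proof -
      consider "mabs \<alpha> < ord K" | "mabs \<alpha> = ord K" | "mabs \<alpha> > ord K" by linarith
      then show ?thesis
      proof cases
        case 1 then show ?thesis using A_order[OF that] by (simp add: G_def)
      next
        case 2 then show ?thesis using prin that by (simp add: G_def has_principal_def)
      next
        case 3 then show ?thesis using A_order[OF that] row_order_ge[OF Q that, of \<alpha> K] ro by (force simp: G_def)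
      qed
    qed
    then show ?thesis by (simp add: vec_eq_iff)
  qed
  have apply_QGA: "apply_coeffs U Q p x = apply_coeffs U G p x + apply_coeffs U A p x" if x: "x \<in> U" for p x
  proof -
    have "apply_coeffs U Q p x = apply_coeffs U (\<lambda>\<alpha> x. G \<alpha> x + A \<alpha> x) p x"
    proof -
      have "active U Q = active U (\<lambda>\<alpha> x. G \<alpha> x + A \<alpha> x)" using QGA by (auto simp: active_def)
      then show ?thesis unfolding apply_coeffs_def using QGA[OF x] by simp
    qed
    then show ?thesis
      using G by (simp add: apply_coeffs_add[OF x] finite_active_A smooth_coeffs_def)
  qed
  define L where "L = adjoint_coeffs U G"
  have L: "smooth_coeffs U L" unfolding L_def by (rule smooth_coeffs_adjoint_coeffs[OF U G])
  have L_low: "L \<alpha> x $ J $ K = 0" if "x \<in> U" "mabs \<alpha> \<ge> ord K" for \<alpha> x J K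
    unfolding L_def using G that by (intro adjoint_coeffs_eq_0[OF U]) (auto simp: smooth_coeffs_def G_nth)
  define C :: "('d, 'k, 'j) coeffs" where "C \<alpha> x = B \<alpha> + L \<alpha> x" for \<alpha> x
  have applyC: "apply_coeffs U C u x = Bop u x + apply_coeffs U L u x" if x: "x \<in> U" for u x
    unfolding C_def using L smooth_coeffs_B by (simp add: apply_coeffs_add[OF x] Bop_apply[OF x] smooth_coeffs_def)
  have C: "smooth_coeffs U C"
    unfolding smooth_coeffs_def
  proof (intro conjI allI)
    have "active U C \<subseteq> active U (\<lambda>\<alpha> x. B \<alpha>) \<union> active U L" by (auto simp: active_def C_def)
    then show "finite (active U C)" using L smooth_coeffs_B finite_subset unfolding smooth_coeffs_def by blast
    show "smooth_on U (C \<alpha>)" for \<alpha>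
      unfolding C_def using L by (intro smooth_on_add[OF U]) (auto simp: smooth_coeffs_def)
  qed
  have test: "P u x = apply_coeffs U C u x" if u: "u \<in> test_sections U E" and x: "x \<in> U" for u x
  proof -
    have us: "u \<in> sections U E" using u unfolding test_sections_def by blast
    have cu: "ctest U u" and uE: "\<And>x. x \<in> U \<Longrightarrow> u x \<in> E x"
      using u unfolding test_sections_iff by blast+
    have su: "smooth_on U (apply_coeffs U F u)" if "smooth_coeffs U F" for F :: "('d, 'k, 'j) coeffs"
      by (rule smooth_on_apply_coeffs[OF U that ctest_smooth_on[OF cu]])
    have weak: "pairing U (apply_coeffs U D u) p = pairing U (apply_coeffs U C u) p" if p: "ctest U p" for p
    proof -
      have sp: "smooth_on U (apply_coeffs U F p)" if "smooth_coeffs U F" for F :: "('d, 'j, 'k) coeffs"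
        by (rule smooth_on_apply_coeffs[OF U that ctest_smooth_on[OF p]])
      let ?B' = "adjoint_coeffs U (\<lambda>\<alpha> x. B \<alpha>)"
      have B': "smooth_coeffs U ?B'" by (rule smooth_coeffs_adjoint_coeffs[OF U smooth_coeffs_B])
      have "pairing U (apply_coeffs U D u) p = pairing U (P u) p"
        by (rule pairing_cong[OF U]) (simp add: PD[OF us])
      also have "\<dots> = pairing U u (apply_coeffs U Q p)"
        using PQ[OF u, of p] p by (simp add: test_sections_iff)
      also have "\<dots> = pairing U u (\<lambda>y. apply_coeffs U G p y + apply_coeffs U ?B' p y)"
      proof (rule pairing_cong[OF U])
        fix y assume y: "y \<in> U"
        \<comment> \<open>\<open>A\<close> and the exact adjoint of \<open>B\<close> differ only in directions orthogonal to the fibre\<close>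
        have "cdot (u y) (apply_coeffs U A p y) = cdot (u y) (apply_coeffs U ?B' p y)"
          using B' smooth_coeffs_B A_adjoint_B[OF y uE[OF y]]
          by (intro cdot_apply_coeffs_cong[OF y finite_active_A])
            (simp_all add: smooth_coeffs_def adjoint_coeffs_const[OF _ y] sum_distrib_left mult_ac)
        then show "cdot (u y) (apply_coeffs U Q p y) = cdot (u y) (apply_coeffs U G p y + apply_coeffs U ?B' p y)"
          by (simp add: apply_QGA[OF y] distrib_left sum.distrib)
      qed
      also have "\<dots> = pairing U u (apply_coeffs U G p) + pairing U u (apply_coeffs U ?B' p)"
        by (rule pairing_add_right[OF U cu sp[OF G] sp[OF B']])
      also have "pairing U u (apply_coeffs U G p) = pairing U (apply_coeffs U L u) p"
        unfolding L_def pairing_commute[of U u] pairing_commute[of U _ p] integral_adjoint_coeffs[OF U G p cu] ..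
      also have "pairing U u (apply_coeffs U ?B' p) = pairing U (apply_coeffs U (\<lambda>\<alpha> x. B \<alpha>) u) p"
        by (rule integral_adjoint_coeffs[OF U smooth_coeffs_B cu p, symmetric])
      also have "pairing U (apply_coeffs U L u) p + \<dots>
          = cnj (pairing U p (\<lambda>y. apply_coeffs U L u y + apply_coeffs U (\<lambda>\<alpha> x. B \<alpha>) u y))"
        unfolding pairing_add_right[OF U p su[OF L] su[OF smooth_coeffs_B]] complex_cnj_add
          pairing_commute[of U _ p, symmetric] ..
      also have "\<dots> = pairing U (apply_coeffs U C u) p"
        unfolding pairing_commute[of U _ p, symmetric]
        by (rule pairing_cong[OF U]) (simp add: applyC Bop_apply add.commute)
      finally show ?thesis .
    qed
    have "pairing U (\<lambda>y. apply_coeffs U D u y - apply_coeffs U C u y) p = 0" if "ctest U p" for p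
      using weak[OF that] unfolding pairing_commute[of U _ p] pairing_diff_right[OF U that su[OF D] su[OF C]]
      by simp
    from pairing_nondegenerate[OF U smooth_on_diff[OF U su[OF D] su[OF C]] this x]
    show ?thesis by (simp add: PD[OF us x])
  qed
  have rep: "represents U E C P"
    unfolding represents_def
  proof (intro conjI ballI C)
    fix u x assume u: "u \<in> sections U E" and x: "x \<in> U"
    obtain \<theta> :: "real^'d \<Rightarrow> real" and r where \<theta>: "ctest U (\<lambda>y. complex_of_real (\<theta> y))" "\<And>y. 0 \<le> \<theta> y"
      "0 < r" "\<And>y. y \<in> ball x r \<Longrightarrow> \<theta> y = 1" "\<theta> x \<noteq> 0"
      using ctest_cutoff_exists[OF U x] by metis
    define v where "v y = complex_of_real (\<theta> y) *s u y" for y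
    have v: "v \<in> test_sections U E" unfolding v_def by (rule scale_test_section[OF u \<theta>(1)])
    have local: "apply_coeffs U F v x = apply_coeffs U F u x" for F :: "('d, 'k, 'j) coeffs"
      using \<theta>(3,4) by (intro apply_coeffs_cong[OF open_ball, of x x r]) (auto simp: v_def)
    have "P u x = P v x"
      using PD[OF u x] PD[of v x] v x local by (simp add: test_sections_def)
    then show "P u x = apply_coeffs U C u x" using test[OF v x] local by simp
  qed
  have C_le: "mabs \<alpha> \<le> ord K" if "x \<in> U" "C \<alpha> x $ J $ K \<noteq> 0" for \<alpha> J K x
    using that B_order[of \<alpha> K J] L_low[of x K \<alpha> J] by (fastforce simp: C_def)
  have RC: "R u x = (\<chi> J. \<Sum>K\<in>UNIV. \<Sum>\<alpha> | mabs \<alpha> = ord K. C \<alpha> x $ J $ K * mpd \<alpha> (\<lambda>y. u y $ K) x)"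
    if "u \<in> sections U E" "x \<in> U" for u x
    unfolding R[OF that] column_op_def using L_low[OF that(2)] by (simp add: C_def)
  show ?thesis
    unfolding has_prin_def ro using rep C_le RC by blast
qed

lemma prin_symbol_if_has_principal:
  assumes "has_principal Q" "x \<in> U"
  shows "prin_symbol U Q x \<xi> = Asymb x \<xi>"
  using assms unfolding prin_symbol_def row_symbol_def has_principal_def by (simp add: vec_eq_iff)

text \<open>On the empty set the row orders are \<open>0\<close> instead of \<open>ord K\<close>, but all claims hold trivially.\<close>

lemma principal_part_equivalence:
  assumes R: "\<And>u x. smooth_on U u \<Longrightarrow> x \<in> U \<Longrightarrow> R u x = Bop u x"
    and R': "\<And>p x. smooth_on U p \<Longrightarrow> x \<in> U \<Longrightarrow> R' p x = Aop p x"
    and S: "\<And>x \<xi>. x \<in> U \<Longrightarrow> Asymb x \<xi> = S x \<xi>"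
    and kernel: "\<And>x \<xi> v. x \<in> U \<Longrightarrow> \<xi> \<noteq> 0 \<Longrightarrow> S x \<xi> *v v = 0 \<Longrightarrow> v = 0"
    and PQ: "diff_op U E P \<and> formal_adjoint U E E' P Q"
  shows "(has_prin U E Q P R \<longleftrightarrow> adjoint_has_prin U Q R') \<and>
    (has_prin U E Q P R \<longrightarrow> (\<forall>x\<in>U. \<forall>\<xi>. prin_symbol U Q x \<xi> = S x \<xi>) \<and> FC U Q)"
proof (cases "U = {}")
  case True
  then show ?thesis using PQ
    unfolding diff_op_def has_prin_def adjoint_has_prin_def FC_def by simp
next
  case False
  have diff: "diff_op U E P" and adj: "formal_adjoint U E E' P Q" using PQ by blast+
  have RE: "R u x = Bop u x" if "u \<in> sections U E" "x \<in> U" for u x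
    using that R unfolding sections_def by blast
  have "has_prin U E Q P R \<longleftrightarrow> has_principal Q"
    using has_prin_imp_has_principal[OF adj False RE] has_principal_imp_has_prin[OF diff adj RE] by blast
  moreover have "adjoint_has_prin U Q R' \<longleftrightarrow> has_principal Q"
    by (rule adjoint_has_prin_iff_has_principal[OF formal_adjointD(1)[OF adj] False R'])
  moreover have "(\<forall>x\<in>U. \<forall>\<xi>. prin_symbol U Q x \<xi> = S x \<xi>) \<and> FC U Q" if "has_principal Q"
  proof -
    have symb: "prin_symbol U Q x \<xi> = S x \<xi>" if "x \<in> U" for x \<xi>
      using prin_symbol_if_has_principal[OF \<open>has_principal Q\<close> that] S[OF that] by simp
    have "inj (\<lambda>v. S x \<xi> *v v)" if "x \<in> U" "\<xi> \<noteq> 0" for x \<xi>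
      by (rule inj_mult_vec_if_kernel_trivial) (rule kernel[OF that])
    then show ?thesis unfolding FC_def using symb by simp
  qed
  ultimately show ?thesis by blast
qed

end

section \<open>Sums and fibres\<close>

lemma sum_UNIV_prod: "(\<Sum>p\<in>UNIV. f p) = (\<Sum>j\<in>UNIV. \<Sum>k\<in>UNIV. f (j, k))" for f :: "'a::finite \<times> 'b::finite \<Rightarrow> 'c::comm_monoid_add"
  unfolding UNIV_Times_UNIV[symmetric] by (simp add: sum.cartesian_product)

lemma sum_UNIV_sum: "(\<Sum>s\<in>UNIV. f s) = (\<Sum>a\<in>UNIV. f (Inl a)) + (\<Sum>b\<in>UNIV. f (Inr b))" for f :: "'a::finite + 'b::finite \<Rightarrow> 'c::comm_monoid_add"
proof -
  have "(UNIV :: ('a + 'b) set) = range Inl \<union> range Inr" by (rule UNIV_sum)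
  moreover have "sum f (range Inl \<union> range Inr) = sum f (range Inl) + sum f (range Inr)"
    by (rule sum.union_disjoint) auto
  ultimately show ?thesis by (simp add: sum.reindex)
qed

text \<open>The part of \<open>principal_pair\<close> that concerns the fibres only and is shared by operators of different order.\<close>

locale dual_fibres =
  fixes U :: "(real^'d::finite) set"
    and E E' :: "real^'d \<Rightarrow> (complex^'k::finite) set"
  assumes U: "open U"
    and E_zero: "\<And>x. x \<in> U \<Longrightarrow> 0 \<in> E x"
    and E_scale: "\<And>x e c. x \<in> U \<Longrightarrow> e \<in> E x \<Longrightarrow> c *s e \<in> E x"
    and E'_scale: "\<And>x w c. x \<in> U \<Longrightarrow> w \<in> E' x \<Longrightarrow> c *s w \<in> E' x"
    and separating: "\<And>x w w'. x \<in> U \<Longrightarrow> w \<in> E' x \<Longrightarrow> w' \<in> E' x \<Longrightarrow>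
      (\<And>e. e \<in> E x \<Longrightarrow> cdot e w = cdot e w') \<Longrightarrow> w = w'"
    and extension: "\<And>x e. x \<in> U \<Longrightarrow> e \<in> E x \<Longrightarrow> \<exists>u\<in>sections U E. u x = e"
begin

text \<open>If all components have the same order, a block is the whole fibre or zero.\<close>

lemma principal_pair_const:
  assumes "\<And>x \<alpha> K. x \<in> U \<Longrightarrow> mabs \<alpha> \<noteq> n \<Longrightarrow> A \<alpha> x $ K = 0"
    and "\<And>\<alpha> J K. mabs \<alpha> \<noteq> n \<Longrightarrow> B \<alpha> $ J $ K = 0"
    and "\<And>x \<alpha> J. x \<in> U \<Longrightarrow> (\<chi> K. A \<alpha> x $ K $ J) \<in> E' x"
    and "\<And>x e \<alpha> J. x \<in> U \<Longrightarrow> e \<in> E x \<Longrightarrow>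
      (\<Sum>K\<in>UNIV. e $ K * cnj (A \<alpha> x $ K $ J)) = (- 1) ^ mabs \<alpha> * (\<Sum>K\<in>UNIV. B \<alpha> $ J $ K * e $ K)"
    and "\<And>x K. x \<in> U \<Longrightarrow> \<exists>\<alpha>. A \<alpha> x $ K \<noteq> 0"
  shows "principal_pair U E E' (\<lambda>_. n) A B"
proof -
  have b: "block (\<lambda>_. n) m e = (if n = m then 1 else 0) *s e" for m and e :: "complex^'k"
    by (simp add: vec_eq_iff)
  show ?thesis
    by unfold_locales (use assms U E_zero E_scale E'_scale separating extension b in auto)
qed

end

lemma sectionsI: "smooth_on U u \<Longrightarrow> (\<And>x. x \<in> U \<Longrightarrow> u x \<in> E x) \<Longrightarrow> u \<in> sections U E"
  unfolding sections_def by blast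

lemma dual_fibres_UNIV: "open U \<Longrightarrow> dual_fibres U (\<lambda>_. UNIV) (\<lambda>_. UNIV)"
proof unfold_locales
  fix w w' :: "complex^'b" assume *: "\<And>e. e \<in> UNIV \<Longrightarrow> cdot e w = cdot e w'"
  show "w = w'" by (rule eq_if_cdot_eq) (rule *[OF UNIV_I])
next
  fix x e show "\<exists>u\<in>sections U (\<lambda>_. UNIV). u x = e"
    by (rule bexI[of _ "\<lambda>_. e"]) (auto intro: sectionsI)
qed auto

lemma dual_fibres_sym_tensors: "open U \<Longrightarrow> dual_fibres U (\<lambda>_. sym_tensors) (\<lambda>_. sym_tensors)"
proof unfold_locales
  fix w w' :: "complex^('b \<times> 'b)"
  assume w: "w \<in> sym_tensors" "w' \<in> sym_tensors"
    and *: "\<And>e. e \<in> sym_tensors \<Longrightarrow> cdot e w = cdot e w'"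
  have "w - w' \<in> sym_tensors" using w by (simp add: sym_tensors_def)
  from *[OF this] show "w = w'" by (rule eq_if_cdot_eq)
next
  fix x and e :: "complex^('b \<times> 'b)" assume "e \<in> sym_tensors"
  then show "\<exists>u\<in>sections U (\<lambda>_. sym_tensors). u x = e"
    by (intro bexI[of _ "\<lambda>_. e"]) (auto intro: sectionsI)
qed (auto simp: sym_tensors_def)

section \<open>Positive definite matrices\<close>

locale pos_def_matrix =
  fixes G :: "real^'d::finite^'d"
  assumes sym: "G $ j $ k = G $ k $ j" and pos: "v \<noteq> 0 \<Longrightarrow> v \<bullet> (G *v v) > 0"
begin

lemma kernel: "G *v v = 0 \<Longrightarrow> v = 0"
  using pos[of v] by auto

lemma complex_kernel:
  fixes \<eta> :: "complex^'d"
  assumes "\<And>j. (\<Sum>k\<in>UNIV. of_real (G $ j $ k) * \<eta> $ k) = 0"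
  shows "\<eta> = 0"
proof -
  have "G *v (\<chi> k. Re (\<eta> $ k)) = 0"
    using arg_cong[OF assms, of Re] by (simp add: vec_eq_iff matrix_vector_mult_def)
  moreover have "G *v (\<chi> k. Im (\<eta> $ k)) = 0"
    using arg_cong[OF assms, of Im] by (simp add: vec_eq_iff matrix_vector_mult_def)
  ultimately have "(\<chi> k. Re (\<eta> $ k)) = 0" "(\<chi> k. Im (\<eta> $ k)) = 0" using kernel by blast+
  then show ?thesis by (simp add: vec_eq_iff complex_eq_iff)
qed

lemma diagonal_pos: "G $ j $ j > 0"
  using pos[of "axis j 1"] by (simp add: matrix_vector_mult_basis column_def inner_axis')

lemma minor_nonzero:
  assumes "j \<noteq> k"
  shows "G $ j $ j * G $ k $ k \<noteq> (G $ j $ k)\<^sup>2"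
proof
  assume *: "G $ j $ j * G $ k $ k = (G $ j $ k)\<^sup>2"
  \<comment> \<open>a kernel vector of the minor, if this is singular\<close>
  define v where "v = (G $ j $ k) *\<^sub>R axis j 1 - (G $ j $ j) *\<^sub>R axis k (1::real)"
  have "v $ k = - G $ j $ j" using assms by (simp add: v_def axis_def)
  then have "v \<noteq> 0" using diagonal_pos[of j] by auto
  moreover have "v \<bullet> (G *v v) = G $ j $ j * (G $ j $ j * G $ k $ k - (G $ j $ k)\<^sup>2)"
    using sym[of k j]
    by (simp add: v_def matrix_vector_mult_diff_distrib matrix_vector_mult_scaleR matrix_vector_mult_basis
        column_def inner_diff_left inner_axis' power2_eq_square algebra_simps)
  ultimately show False using pos[of v] * by simp
qed

lemma inverse: "G ** matrix_inv G = mat 1" "matrix_inv G ** G = mat 1"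
proof -
  have "\<exists>B. B ** G = mat 1" unfolding matrix_left_invertible_ker using kernel by blast
  then have "invertible G" by (simp add: invertible_left_inverse)
  then have "\<exists>H. G ** H = mat 1 \<and> H ** G = mat 1" by (simp add: invertible_def)
  then have "G ** matrix_inv G = mat 1 \<and> matrix_inv G ** G = mat 1"
    unfolding matrix_inv_def by (rule someI_ex)
  then show "G ** matrix_inv G = mat 1" "matrix_inv G ** G = mat 1" by blast+
qed

lemma inverse_sym: "matrix_inv G $ j $ k = matrix_inv G $ k $ j"
proof -
  let ?H = "matrix_inv G"
  have G: "transpose G = G" by (simp add: vec_eq_iff transpose_def sym)
  have "transpose ?H ** G = mat 1"
    using arg_cong[OF inverse(1), of transpose] by (simp add: matrix_transpose_mul G transpose_mat)
  then have "transpose ?H = ?H"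
    by (metis inverse(1) matrix_mul_assoc matrix_mul_lid matrix_mul_rid)
  from arg_cong[OF this, of "\<lambda>M. M $ j $ k"] show ?thesis by (simp add: transpose_def)
qed

lemma inverse_diagonal_pos: "matrix_inv G $ a $ a > 0"
proof -
  let ?v = "matrix_inv G *v axis a 1"
  have Gv: "G *v ?v = axis a 1" by (simp add: matrix_vector_mul_assoc inverse)
  then have "?v \<noteq> 0" by (metis axis_eq_0_iff matrix_vector_mult_0_right zero_neq_one)
  from pos[OF this] show ?thesis
    unfolding Gv by (simp add: matrix_vector_mult_basis column_def inner_axis)
qed

lemma trace_inverse: "(\<Sum>j\<in>UNIV. \<Sum>k\<in>UNIV. matrix_inv G $ j $ k * G $ j $ k) = CARD('d)"
proof -
  have "(\<Sum>k\<in>UNIV. matrix_inv G $ j $ k * G $ j $ k) = 1" for j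
  proof -
    have "(\<Sum>k\<in>UNIV. matrix_inv G $ j $ k * G $ j $ k) = (matrix_inv G ** G) $ j $ j"
      unfolding matrix_matrix_mult_def by (simp add: sym)
    then show ?thesis by (simp add: inverse mat_def)
  qed
  then show ?thesis by simp
qed

end

lemma riemannian_metric_pos_def:
  assumes g: "riemannian_metric U g" and x: "x \<in> U"
  shows "pos_def_matrix (g x)"
proof unfold_locales
  have "transpose (g x) = g x" using g x unfolding riemannian_metric_def by blast
  then have "transpose (g x) $ j $ k = g x $ j $ k" for j k by simp
  then show "g x $ j $ k = g x $ k $ j" for j k by (simp add: transpose_def)
  show "v \<noteq> 0 \<Longrightarrow> v \<bullet> (g x *v v) > 0" for v using g x unfolding riemannian_metric_def by blast
qed

text \<open>Both \<open>tracefree_up\<close> and \<open>tracefree_down\<close> are complements of a line in the symmetric tensors, but not orthogonal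
  ones: the values of the adjoint are determined by the first only because the metric itself is not in the second.
  A trace-free tensor at a point extends to a trace-free section by correcting the trace of its constant extension with a
  multiple of the identity matrix, whose trace is positive in every metric.\<close>

lemma dual_fibres_tracefree:
  fixes g :: "real^'d::finite \<Rightarrow> real^'d^'d"
  assumes U: "open U" and g: "riemannian_metric U g"
  shows "dual_fibres U (tracefree_up g) (tracefree_down g)"
proof unfold_locales
  fix x and w w' :: "complex^('d \<times> 'd)"
  assume x: "x \<in> U" and w: "w \<in> tracefree_down g x" "w' \<in> tracefree_down g x"
    and *: "\<And>e. e \<in> tracefree_up g x \<Longrightarrow> cdot e w = cdot e w'"
  interpret G: pos_def_matrix "g x" by (rule riemannian_metric_pos_def[OF g x])
  define G :: "complex^('d \<times> 'd)" where "G = (\<chi> p. of_real (g x $ fst p $ snd p))"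
  define d where "d = w - w'"
  define gg where "gg = (\<Sum>p\<in>UNIV. G $ p * G $ p)"
  have "gg = of_real (\<Sum>j\<in>UNIV. \<Sum>k\<in>UNIV. (g x $ j $ k)\<^sup>2)"
    by (simp add: gg_def G_def sum_UNIV_prod power2_eq_square)
  moreover have "(\<Sum>j\<in>UNIV. \<Sum>k\<in>UNIV. (g x $ j $ k)\<^sup>2) > 0"
    using G.diagonal_pos[of undefined]
    by (intro sum_pos2[of _ undefined] sum_nonneg) auto
  ultimately have gg: "gg \<noteq> 0" by (simp only: of_real_eq_0_iff)
  \<comment> \<open>\<open>e\<close> is the component of \<open>d\<close> orthogonal to the metric\<close>
  define t where "t = (\<Sum>p\<in>UNIV. G $ p * d $ p) / gg"
  define e where "e = d - t *s G"
  have Gsym: "G $ (j, k) = G $ (k, j)" for j k by (simp add: G_def G.sym)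
  have dsym: "d $ (j, k) = d $ (k, j)" for j k using w by (simp add: d_def tracefree_down_def sym_tensors_def)
  have Ge: "(\<Sum>p\<in>UNIV. G $ p * e $ p) = 0"
  proof -
    have "(\<Sum>p\<in>UNIV. G $ p * e $ p) = (\<Sum>p\<in>UNIV. G $ p * d $ p) - t * gg"
      by (simp add: e_def gg_def right_diff_distrib sum_subtractf sum_distrib_left mult_ac)
    then show ?thesis using gg by (simp add: t_def)
  qed
  then have "e \<in> tracefree_up g x"
  proof -
    have "e $ (j, k) = e $ (k, j)" for j k by (simp add: e_def dsym[of j k] Gsym[of j k])
    then show ?thesis using \<open>(\<Sum>p\<in>UNIV. G $ p * e $ p) = 0\<close>
      by (simp add: tracefree_up_def sym_tensors_def sum_UNIV_prod G_def)
  qed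
  from *[OF this] have ed: "cdot e d = 0"
    by (simp add: d_def right_diff_distrib sum_subtractf)
  have "e = 0"
  proof -
    have "cdot e e = cdot e d - cnj t * (\<Sum>p\<in>UNIV. G $ p * e $ p)"
    proof -
      have "cnj (e $ p) = cnj (d $ p) - cnj t * G $ p" for p by (simp add: e_def G_def)
      then show ?thesis by (simp add: right_diff_distrib sum_subtractf sum_distrib_left mult_ac)
    qed
    then have "cdot e e = 0" using ed Ge by simp
    then show ?thesis by (simp only: cdot_eq_0_iff)
  qed
  then have d: "d = t *s G" by (simp add: e_def)
  have "(\<Sum>j\<in>UNIV. \<Sum>k\<in>UNIV. complex_of_real (ginv g x $ j $ k) * d $ (j, k)) = 0"
    using w by (simp add: d_def tracefree_down_def right_diff_distrib sum_subtractf)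
  moreover have "(\<Sum>j\<in>UNIV. \<Sum>k\<in>UNIV. complex_of_real (ginv g x $ j $ k) * d $ (j, k))
      = t * of_real (\<Sum>j\<in>UNIV. \<Sum>k\<in>UNIV. matrix_inv (g x) $ j $ k * g x $ j $ k)"
    by (simp add: d G_def ginv_def sum_distrib_left mult_ac)
  ultimately have "t = 0" unfolding G.trace_inverse by simp
  then show "w = w'" using d by (simp add: d_def)
next
  fix x and e :: "complex^('d \<times> 'd)" assume x: "x \<in> U" and e: "e \<in> tracefree_up g x"
  define tr where "tr y = (\<Sum>j\<in>UNIV. \<Sum>k\<in>UNIV. complex_of_real (g y $ j $ k) * e $ (j, k))" for y
  define dg where "dg y = (\<Sum>j\<in>UNIV. complex_of_real (g y $ j $ j))" for y
  have sg: "smooth_on U (\<lambda>y. complex_of_real (g y $ j $ k))" for j k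
    using g by (intro smooth_on_of_real[OF U] smooth_on_nth[OF U]) (simp add: riemannian_metric_def)
  have dg: "dg y \<noteq> 0" if "y \<in> U" for y
  proof -
    interpret G: pos_def_matrix "g y" by (rule riemannian_metric_pos_def[OF g that])
    have "(\<Sum>j\<in>UNIV. g y $ j $ j) > 0" by (intro sum_pos G.diagonal_pos) auto
    moreover have "dg y = of_real (\<Sum>j\<in>UNIV. g y $ j $ j)" by (simp add: dg_def)
    ultimately show ?thesis by (simp only: of_real_eq_0_iff)
  qed
  define u :: "real^'d \<Rightarrow> complex^('d \<times> 'd)"
    where "u y = (\<chi> p. e $ p - tr y / dg y * of_bool (fst p = snd p))" for y
  have st: "smooth_on U (\<lambda>y. tr y / dg y)"
    unfolding tr_def[abs_def] dg_def[abs_def]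
    using dg[unfolded dg_def]
    by (intro smooth_on_divide[OF U] smooth_on_sum[OF U] smooth_on_mult[OF U] sg smooth_on_const)
  have "u \<in> sections U (tracefree_up g)"
  proof (rule sectionsI)
    have "smooth_on U (\<lambda>y. e $ p - tr y / dg y * of_bool (fst p = snd p))" for p
      by (intro smooth_on_diff[OF U] smooth_on_mult[OF U] st smooth_on_const)
    then have "smooth_on U (\<lambda>y. u y $ p)" for p unfolding u_def vec_lambda_beta .
    then show "smooth_on U u" by (rule smooth_on_vec[OF U])
    fix y assume y: "y \<in> U"
    have "(\<Sum>j\<in>UNIV. \<Sum>k\<in>UNIV. complex_of_real (g y $ j $ k) * u y $ (j, k)) = tr y - tr y / dg y * dg y"
    proof -
      have "(\<Sum>k\<in>UNIV. complex_of_real (g y $ j $ k) * (tr y / dg y * of_bool (j = k)))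
          = tr y / dg y * complex_of_real (g y $ j $ j)" for j
        by (simp add: of_bool_def if_distrib[of "\<lambda>z. _ * z"] mult.commute cong: if_cong)
      then show ?thesis
        by (simp add: u_def tr_def[of y] dg_def[of y] right_diff_distrib sum_subtractf sum_distrib_left)
    qed
    then show "u y \<in> tracefree_up g y"
      using dg[OF y] e by (auto simp: tracefree_up_def sym_tensors_def u_def)
  qed
  moreover have "u x = e" using e by (simp add: u_def tr_def tracefree_up_def vec_eq_iff)
  ultimately show "\<exists>u\<in>sections U (tracefree_up g). u x = e" by blast
next
  show "open U" by (rule U)
next
  fix x c and e :: "complex^('d \<times> 'd)"
  have s: "(\<Sum>j\<in>UNIV. \<Sum>k\<in>UNIV. a j k * (c * e $ (j, k))) = c * (\<Sum>j\<in>UNIV. \<Sum>k\<in>UNIV. a j k * e $ (j, k))" for a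
    by (simp add: sum_distrib_left mult_ac)
  show "e \<in> tracefree_up g x \<Longrightarrow> c *s e \<in> tracefree_up g x"
    "e \<in> tracefree_down g x \<Longrightarrow> c *s e \<in> tracefree_down g x"
    by (auto simp: tracefree_up_def tracefree_down_def sym_tensors_def s)
  show "0 \<in> tracefree_up g x" by (simp add: tracefree_up_def sym_tensors_def)
qed

section \<open>Direct sums\<close>

lemma vpair_nth [simp]: "vpair v w $ Inl a = v $ a" "vpair v w $ Inr b = w $ b"
  by (simp_all add: vpair_def)

lemma vfst_nth [simp]: "vfst w $ a = w $ Inl a" and vsnd_nth [simp]: "vsnd w $ b = w $ Inr b"
  by (simp_all add: vfst_def vsnd_def)

lemma vfst_vpair [simp]: "vfst (vpair v w) = v" and vsnd_vpair [simp]: "vsnd (vpair v w) = w"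
  by (simp_all add: vec_eq_iff)

lemma vec_sum_eq_iff: "w = w' \<longleftrightarrow> vfst w = vfst w' \<and> vsnd w = vsnd w'"
  by (auto simp: vec_eq_iff split_sum_all)

lemma block_diag_nth [simp]:
  "block_diag A B $ Inl m $ Inl a = A $ m $ a" "block_diag A B $ Inr n $ Inr b = B $ n $ b"
  "block_diag A B $ Inl m $ Inr b = 0" "block_diag A B $ Inr n $ Inl a = 0"
  by (simp_all add: block_diag_def)

text \<open>The fibres pair blockwise, hence so do the coefficients.\<close>

lemma principal_pair_direct_sum:
  fixes U :: "(real^'d::finite) set"
    and A1 :: "('d, 'j1::finite, 'k1::finite) coeffs" and A2 :: "('d, 'j2::finite, 'k2::finite) coeffs"
  assumes "principal_pair U E1 E1' ord1 A1 B1" "principal_pair U E2 E2' ord2 A2 B2"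
  shows "principal_pair U (pair_fibre E1 E2) (pair_fibre E1' E2') (case_sum ord1 ord2)
    (\<lambda>\<alpha> x. block_diag (A1 \<alpha> x) (A2 \<alpha> x)) (\<lambda>\<alpha>. block_diag (B1 \<alpha>) (B2 \<alpha>))"
proof -
  interpret P1: principal_pair U E1 E1' ord1 A1 B1 by fact
  interpret P2: principal_pair U E2 E2' ord2 A2 B2 by fact
  have fs: "vfst (c *s w) = c *s vfst w" "vsnd (c *s w) = c *s vsnd w" "vfst 0 = 0" "vsnd 0 = 0"
    "vfst (block (case_sum ord1 ord2) n w) = block ord1 n (vfst w)"
    "vsnd (block (case_sum ord1 ord2) n w) = block ord2 n (vsnd w)" for c w n
    by (simp_all add: vec_eq_iff)
  have z1: "0 \<in> E1' x" and z2: "0 \<in> E2' x" if "x \<in> U" for x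
    using P1.E'_scale[OF that P1.A_E'[OF that], of 0] P2.E'_scale[OF that P2.A_E'[OF that], of 0] by simp_all
  show ?thesis
  proof unfold_locales
    fix x and w w' assume x: "x \<in> U" and w: "w \<in> pair_fibre E1' E2' x" "w' \<in> pair_fibre E1' E2' x"
      and *: "\<And>e. e \<in> pair_fibre E1 E2 x \<Longrightarrow> cdot e w = cdot e w'"
    have "vfst w = vfst w'"
    proof (rule P1.separating[OF x])
      fix e assume "e \<in> E1 x"
      then show "cdot e (vfst w) = cdot e (vfst w')"
        using *[of "vpair e 0"] P2.E_zero[OF x] by (simp add: pair_fibre_def sum_UNIV_sum)
    qed (use w in \<open>simp_all add: pair_fibre_def\<close>)
    moreover have "vsnd w = vsnd w'"
    proof (rule P2.separating[OF x])
      fix e assume "e \<in> E2 x"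
      then show "cdot e (vsnd w) = cdot e (vsnd w')"
        using *[of "vpair 0 e"] P1.E_zero[OF x] by (simp add: pair_fibre_def sum_UNIV_sum)
    qed (use w in \<open>simp_all add: pair_fibre_def\<close>)
    ultimately show "w = w'" by (simp add: vec_sum_eq_iff)
  next
    fix x e assume x: "x \<in> U" and e: "e \<in> pair_fibre E1 E2 x"
    obtain u1 u2 where u: "u1 \<in> sections U E1" "u1 x = vfst e" "u2 \<in> sections U E2" "u2 x = vsnd e"
      using P1.extension[OF x, of "vfst e"] P2.extension[OF x, of "vsnd e"] e by (auto simp: pair_fibre_def)
    have "(\<lambda>y. vpair (u1 y) (u2 y)) \<in> sections U (pair_fibre E1 E2)"
    proof (rule sectionsI)
      have "smooth_on U (\<lambda>y. vpair (u1 y) (u2 y) $ K)" for K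
        using u P1.U by (cases K) (auto simp: sections_def intro!: smooth_on_nth)
      then show "smooth_on U (\<lambda>y. vpair (u1 y) (u2 y))" by (rule smooth_on_vec[OF P1.U])
    qed (use u in \<open>simp add: pair_fibre_def sections_def\<close>)
    moreover have "vpair (u1 x) (u2 x) = e" using u by (simp add: vec_sum_eq_iff)
    ultimately show "\<exists>u\<in>sections U (pair_fibre E1 E2). u x = e" by (intro bexI[of _ "\<lambda>y. vpair (u1 y) (u2 y)"]) auto
  next
    fix x and \<alpha> :: "'d mindex" and J :: "'j1 + 'j2" assume x: "x \<in> U"
    show "(\<chi> K. block_diag (A1 \<alpha> x) (A2 \<alpha> x) $ K $ J) \<in> pair_fibre E1' E2' x"
    proof (cases J)
      case (Inl a)
      have "vfst (\<chi> K. block_diag (A1 \<alpha> x) (A2 \<alpha> x) $ K $ J) = (\<chi> K. A1 \<alpha> x $ K $ a)"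
        "vsnd (\<chi> K. block_diag (A1 \<alpha> x) (A2 \<alpha> x) $ K $ J) = 0"
        by (simp_all add: Inl vec_eq_iff)
      then show ?thesis using P1.A_E'[OF x] z2[OF x] by (simp add: pair_fibre_def)
    next
      case (Inr b)
      have "vsnd (\<chi> K. block_diag (A1 \<alpha> x) (A2 \<alpha> x) $ K $ J) = (\<chi> K. A2 \<alpha> x $ K $ b)"
        "vfst (\<chi> K. block_diag (A1 \<alpha> x) (A2 \<alpha> x) $ K $ J) = 0"
        by (simp_all add: Inr vec_eq_iff)
      then show ?thesis using P2.A_E'[OF x] z1[OF x] by (simp add: pair_fibre_def)
    qed
  next
    fix x e and \<alpha> :: "'d mindex" and J :: "'j1 + 'j2" assume x: "x \<in> U" and e: "e \<in> pair_fibre E1 E2 x"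
    then show "(\<Sum>K\<in>UNIV. e $ K * cnj (block_diag (A1 \<alpha> x) (A2 \<alpha> x) $ K $ J))
        = (- 1) ^ mabs \<alpha> * (\<Sum>K\<in>UNIV. block_diag (B1 \<alpha>) (B2 \<alpha>) $ J $ K * e $ K)"
      using P1.A_adjoint_B[OF x, of "vfst e"] P2.A_adjoint_B[OF x, of "vsnd e"]
      by (cases J) (simp_all add: pair_fibre_def sum_UNIV_sum)
  next
    fix x and K :: "'k1 + 'k2" assume x: "x \<in> U"
    show "\<exists>\<alpha>. block_diag (A1 \<alpha> x) (A2 \<alpha> x) $ K \<noteq> 0"
    proof (cases K)
      case (Inl k)
      obtain \<alpha> a where "A1 \<alpha> x $ k $ a \<noteq> 0" using P1.A_row[OF x, of k] by (auto simp: vec_eq_iff)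
      then have "block_diag (A1 \<alpha> x) (A2 \<alpha> x) $ K $ Inl a \<noteq> 0" by (simp add: Inl)
      then show ?thesis by (intro exI[of _ \<alpha>]) auto
    next
      case (Inr k)
      obtain \<alpha> b where "A2 \<alpha> x $ k $ b \<noteq> 0" using P2.A_row[OF x, of k] by (auto simp: vec_eq_iff)
      then have "block_diag (A1 \<alpha> x) (A2 \<alpha> x) $ K $ Inr b \<noteq> 0" by (simp add: Inr)
      then show ?thesis by (intro exI[of _ \<alpha>]) auto
    qed
  next
    fix x and \<alpha> :: "'d mindex" and K :: "'k1 + 'k2" assume "x \<in> U" "mabs \<alpha> \<noteq> case_sum ord1 ord2 K"
    then show "block_diag (A1 \<alpha> x) (A2 \<alpha> x) $ K = 0"
      using P1.A_order P2.A_order by (cases K) (auto simp: vec_eq_iff split_sum_all)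
  next
    fix \<alpha> :: "'d mindex" and J :: "'j1 + 'j2" and K :: "'k1 + 'k2" assume "mabs \<alpha> \<noteq> case_sum ord1 ord2 K"
    then show "block_diag (B1 \<alpha>) (B2 \<alpha>) $ J $ K = 0"
      using P1.B_order P2.B_order by (cases K; cases J) auto
  qed (simp_all add: pair_fibre_def fs P1.U P1.E_zero P2.E_zero P1.E_scale P2.E_scale P1.E_block P2.E_block
      P1.E'_scale P2.E'_scale P1.E'_block P2.E'_block)
qed

lemma column_op_direct_sum:
  "column_op (case_sum ord1 ord2) (\<lambda>\<alpha>. block_diag (B1 \<alpha>) (B2 \<alpha>)) u x
    = vpair (column_op ord1 B1 (\<lambda>y. vfst (u y)) x) (column_op ord2 B2 (\<lambda>y. vsnd (u y)) x)"
  by (simp add: vec_eq_iff split_sum_all column_op_def sum_UNIV_sum)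

lemma row_op_direct_sum:
  "row_op (case_sum ord1 ord2) (\<lambda>\<alpha> x. block_diag (A1 \<alpha> x) (A2 \<alpha> x)) p x
    = vpair (row_op ord1 A1 (\<lambda>y. vfst (p y)) x) (row_op ord2 A2 (\<lambda>y. vsnd (p y)) x)"
  by (simp add: vec_eq_iff split_sum_all row_op_def sum_UNIV_sum)

lemma row_symbol_direct_sum:
  "row_symbol (case_sum ord1 ord2) (\<lambda>\<alpha> x. block_diag (A1 \<alpha> x) (A2 \<alpha> x)) x \<xi>
    = block_diag (row_symbol ord1 A1 x \<xi>) (row_symbol ord2 A2 x \<xi>)"
  by (simp add: vec_eq_iff split_sum_all row_symbol_def)

lemma block_diag_kernel:
  fixes S :: "complex^'j1::finite^'k1::finite" and T :: "complex^'j2::finite^'k2::finite"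
  assumes "\<And>v. S *v v = 0 \<Longrightarrow> v = 0" "\<And>v. T *v v = 0 \<Longrightarrow> v = 0" "block_diag S T *v w = 0"
  shows "w = 0"
proof -
  have "vfst (block_diag S T *v w) = S *v vfst w" "vsnd (block_diag S T *v w) = T *v vsnd w"
    by (simp_all add: vec_eq_iff matrix_vector_mult_def sum_UNIV_sum)
  moreover have "vfst (0 :: complex^('k1 + 'k2)) = 0" "vsnd (0 :: complex^('k1 + 'k2)) = 0"
    by (simp_all add: vec_eq_iff)
  ultimately have "S *v vfst w = 0" "T *v vsnd w = 0" using assms(3) by simp_all
  then have "vfst w = 0" "vsnd w = 0" using assms(1,2) by blast+
  then show ?thesis by (simp add: vec_eq_iff split_sum_all)
qed

section \<open>Coefficients of the model operators\<close>

lemma mabs_count_mset [simp]: "mabs (count M) = size M" by (rule mabs_count)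

lemma sum_of_bool_count:
  fixes f :: "'d::finite mindex \<Rightarrow> complex"
  assumes "size M = n"
  shows "(\<Sum>\<alpha> | mabs \<alpha> = n. of_bool (\<alpha> = count M) * f \<alpha>) = f (count M)"
proof -
  have "(\<Sum>\<alpha> | mabs \<alpha> = n. of_bool (\<alpha> = count M) * f \<alpha>) = (\<Sum>\<alpha> | mabs \<alpha> = n. if \<alpha> = count M then f \<alpha> else 0)"
    by (rule sum.cong) auto
  then show ?thesis using assms by (simp add: sum.delta)
qed

lemma mpow_count_empty: "mpow \<xi> (count {#}) = 1"
  by (simp add: mpow_def)

lemma mpow_count_add: "mpow \<xi> (count (add_mset j M)) = \<xi> $ j * mpow \<xi> (count M)"
proof -
  have "mpow \<xi> (count (add_mset j M)) = (\<Prod>i\<in>UNIV. (if i = j then \<xi> $ i else 1) * (\<xi> $ i) ^ count M i)"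
    unfolding mpow_def by (rule prod.cong) auto
  also have "\<dots> = \<xi> $ j * mpow \<xi> (count M)"
    by (simp add: prod.distrib mpow_def)
  finally show ?thesis .
qed

lemmas mpow_count = mpow_count_add mpow_count_empty

lemma mpd_single:
  fixes f :: "real^'d::finite \<Rightarrow> complex"
  assumes "open U" "smooth_on U f" "x \<in> U"
  shows "mpd (count {#j#}) f x = pd j f x" and "mpd (count {#j, k#}) f x = pd j (pd k f) x"
  using mpd_count[OF assms, of "[j]"] mpd_count[OF assms, of "[j, k]"] by simp_all

definition grad_coeffs :: "('d::finite, 1, 'd) coeffs" where
  "grad_coeffs \<alpha> x = (\<chi> j _. - of_bool (\<alpha> = count {#j#}))"

definition hess_coeffs :: "('d::finite, 1, 'd \<times> 'd) coeffs" where
  "hess_coeffs \<alpha> x = (\<chi> p _. of_bool (\<alpha> = count {#fst p, snd p#}))"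

definition sym_grad_coeffs :: "('d::finite, 'd, 'd \<times> 'd) coeffs" where
  "sym_grad_coeffs \<alpha> x = (\<chi> p J. - (1 / 2) *
     (of_bool (\<alpha> = count {#fst p#}) * of_bool (snd p = J) + of_bool (\<alpha> = count {#snd p#}) * of_bool (fst p = J)))"

text \<open>Projection of the output \<open>(j, k)\<close> to the tensors that are trace-free with respect to the inverse metric.\<close>

definition tracefree_part :: "(real^'d \<Rightarrow> real^'d^'d) \<Rightarrow> ('d::finite, 'j::finite, 'd \<times> 'd) coeffs
    \<Rightarrow> ('d, 'j, 'd \<times> 'd) coeffs" where
  "tracefree_part g A \<alpha> x = (\<chi> p J. A \<alpha> x $ p $ J - of_real (g x $ fst p $ snd p) *
     ((\<Sum>j\<in>UNIV. \<Sum>k\<in>UNIV. of_real (ginv g x $ j $ k) * A \<alpha> x $ (j, k) $ J) / of_nat CARD('d)))"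

definition div_vector_coeffs :: "'d::finite mindex \<Rightarrow> complex^'d^1" where
  "div_vector_coeffs \<alpha> = (\<chi> _ j. of_bool (\<alpha> = count {#j#}))"

definition ddiv_coeffs :: "'d::finite mindex \<Rightarrow> complex^('d \<times> 'd)^1" where
  "ddiv_coeffs \<alpha> = (\<chi> _ p. of_bool (\<alpha> = count {#fst p, snd p#}))"

definition div_coeffs :: "'d::finite mindex \<Rightarrow> complex^('d \<times> 'd)^'d" where
  "div_coeffs \<alpha> = (\<chi> J p. of_bool (\<alpha> = count {#snd p#}) * of_bool (fst p = J))"

lemma sum_of_bool_eq [simp]:
  fixes f :: "'a::finite \<Rightarrow> complex"
  shows "(\<Sum>j\<in>UNIV. f j * of_bool (j = a)) = f a" "(\<Sum>j\<in>UNIV. of_bool (j = a) * f j) = f a"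
    "(\<Sum>j\<in>UNIV. f j * of_bool (a = j)) = f a" "(\<Sum>j\<in>UNIV. of_bool (a = j) * f j) = f a"
  by (simp_all add: of_bool_def if_distrib[of "\<lambda>z. _ * z"] if_distrib[of "\<lambda>z. z * _"] cong: if_cong)

lemma column_op_div_vector:
  fixes u :: "real^'d::finite \<Rightarrow> complex^'d"
  assumes U: "open U" and u: "smooth_on U u" and x: "x \<in> U"
  shows "div_vector u x = column_op (\<lambda>_. 1) div_vector_coeffs u x"
  using mpd_single[OF U smooth_on_nth[OF U u] x]
  by (simp add: vec_eq_iff div_vector_def column_op_def div_vector_coeffs_def sum_of_bool_count)

lemma column_op_ddiv_tensor:
  fixes u :: "real^'d::finite \<Rightarrow> complex^('d \<times> 'd)"
  assumes U: "open U" and u: "smooth_on U u" and x: "x \<in> U"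
  shows "ddiv_tensor u x = column_op (\<lambda>_. 2) ddiv_coeffs u x"
  using mpd_single[OF U smooth_on_nth[OF U u] x]
  by (simp add: vec_eq_iff ddiv_tensor_def column_op_def ddiv_coeffs_def sum_of_bool_count sum_UNIV_prod)

lemma column_op_div_tensor:
  fixes u :: "real^'d::finite \<Rightarrow> complex^('d \<times> 'd)"
  assumes U: "open U" and u: "smooth_on U u" and x: "x \<in> U"
  shows "div_tensor u x = column_op (\<lambda>_. 1) div_coeffs u x"
proof -
  have "column_op (\<lambda>_. 1) div_coeffs u x $ J = div_tensor u x $ J" for J
  proof -
    have "div_coeffs \<alpha> $ J $ p * c = of_bool (fst p = J) * (of_bool (\<alpha> = count {#snd p#}) * c)" for \<alpha> p c
      by (simp add: div_coeffs_def)
    then have "(\<Sum>\<alpha> | mabs \<alpha> = 1. div_coeffs \<alpha> $ J $ p * mpd \<alpha> (\<lambda>y. u y $ p) x)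
        = of_bool (fst p = J) * pd (snd p) (\<lambda>y. u y $ p) x" for p
      using mpd_single(1)[OF U smooth_on_nth[OF U u] x]
        sum_of_bool_count[of "{#snd p#}" 1 "\<lambda>\<alpha>. mpd \<alpha> (\<lambda>y. u y $ p) x"]
      by (simp only: sum_distrib_left[symmetric]) simp
    then have "column_op (\<lambda>_. 1) div_coeffs u x $ J = (\<Sum>p\<in>UNIV. of_bool (fst p = J) * pd (snd p) (\<lambda>y. u y $ p) x)"
      by (simp only: column_op_def vec_lambda_beta)
    also have "\<dots> = div_tensor u x $ J"
      by (simp add: sum_UNIV_prod div_tensor_def sum_distrib_left[symmetric])
    finally show ?thesis .
  qed
  then show ?thesis by (simp add: vec_eq_iff)
qed

text \<open>Both the action of a principal part and its symbol are obtained by pairing its coefficients with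
  a function of the multi-index, which is evaluated once and for all here.\<close>

lemma sum_grad_coeffs:
  "(\<Sum>\<alpha> | mabs \<alpha> = 1. grad_coeffs \<alpha> x $ j $ J * f \<alpha>) = - f (count {#j#})"
  by (simp add: grad_coeffs_def sum_negf sum_of_bool_count)

lemma sum_hess_coeffs:
  "(\<Sum>\<alpha> | mabs \<alpha> = 2. hess_coeffs \<alpha> x $ (j, k) $ J * f \<alpha>) = f (count {#j, k#})"
  by (simp add: hess_coeffs_def sum_of_bool_count)

lemma sum_sym_grad_coeffs:
  "(\<Sum>\<alpha> | mabs \<alpha> = 1. sym_grad_coeffs \<alpha> x $ (j, k) $ J * f \<alpha>)
    = - (1 / 2) * (f (count {#j#}) * of_bool (k = J) + f (count {#k#}) * of_bool (j = J))"
proof -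
  have "(\<Sum>\<alpha> | mabs \<alpha> = 1. sym_grad_coeffs \<alpha> x $ (j, k) $ J * f \<alpha>)
      = - (1 / 2) * ((\<Sum>\<alpha> | mabs \<alpha> = 1. of_bool (\<alpha> = count {#j#}) * f \<alpha>) * of_bool (k = J)
         + (\<Sum>\<alpha> | mabs \<alpha> = 1. of_bool (\<alpha> = count {#k#}) * f \<alpha>) * of_bool (j = J))"
    unfolding sum_distrib_right sum.distrib[symmetric] sum_distrib_left
    by (rule sum.cong) (auto simp: sym_grad_coeffs_def)
  then show ?thesis by (simp add: sum_of_bool_count)
qed

lemma sum_tracefree_part:
  fixes A :: "('d::finite, 'j::finite, 'd \<times> 'd) coeffs"
  shows "(\<Sum>\<alpha> | mabs \<alpha> = n. tracefree_part g A \<alpha> x $ p $ J * f \<alpha>)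
    = (\<Sum>\<alpha> | mabs \<alpha> = n. A \<alpha> x $ p $ J * f \<alpha>) - of_real (g x $ fst p $ snd p) *
      ((\<Sum>j\<in>UNIV. \<Sum>k\<in>UNIV. of_real (ginv g x $ j $ k) * (\<Sum>\<alpha> | mabs \<alpha> = n. A \<alpha> x $ (j, k) $ J * f \<alpha>)) / of_nat CARD('d))"
proof -
  let ?t = "\<lambda>\<alpha>. \<Sum>j\<in>UNIV. \<Sum>k\<in>UNIV. of_real (ginv g x $ j $ k) * A \<alpha> x $ (j, k) $ J"
  let ?c = "of_real (g x $ fst p $ snd p) / of_nat CARD('d) :: complex"
  have "tracefree_part g A \<alpha> x $ p $ J * f \<alpha> = A \<alpha> x $ p $ J * f \<alpha> - ?c * (?t \<alpha> * f \<alpha>)" for \<alpha>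
    by (simp add: tracefree_part_def left_diff_distrib)
  then have "(\<Sum>\<alpha> | mabs \<alpha> = n. tracefree_part g A \<alpha> x $ p $ J * f \<alpha>)
      = (\<Sum>\<alpha> | mabs \<alpha> = n. A \<alpha> x $ p $ J * f \<alpha>) - ?c * (\<Sum>\<alpha> | mabs \<alpha> = n. ?t \<alpha> * f \<alpha>)"
    by (simp only: sum_subtractf sum_distrib_left)
  also have "(\<Sum>\<alpha> | mabs \<alpha> = n. ?t \<alpha> * f \<alpha>)
      = (\<Sum>j\<in>UNIV. \<Sum>k\<in>UNIV. \<Sum>\<alpha> | mabs \<alpha> = n. of_real (ginv g x $ j $ k) * A \<alpha> x $ (j, k) $ J * f \<alpha>)"
    unfolding sum_distrib_right by (subst sum.swap, subst (2) sum.swap) (rule refl)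
  finally show ?thesis by (simp only: mult.assoc sum_distrib_left[symmetric]) simp
qed

lemma sum_symmetrized_delta:
  fixes h :: "'d::finite \<Rightarrow> 'd \<Rightarrow> complex"
  shows "(\<Sum>j\<in>UNIV. \<Sum>k\<in>UNIV. h j k * (- (1 / 2) * (f j * of_bool (k = J) + f k * of_bool (j = J))))
    = - (1 / 2) * ((\<Sum>j\<in>UNIV. h j J * f j) + (\<Sum>k\<in>UNIV. h J k * f k))"
proof -
  have "h j k * (- (1 / 2) * (f j * of_bool (k = J) + f k * of_bool (j = J)))
      = - (1 / 2) * (h j k * f j * of_bool (k = J) + h j k * f k * of_bool (j = J))" for j k
    by (simp only: distrib_left mult.assoc mult.left_commute[of "h j k"])
  then have "(\<Sum>j\<in>UNIV. \<Sum>k\<in>UNIV. h j k * (- (1 / 2) * (f j * of_bool (k = J) + f k * of_bool (j = J))))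
      = - (1 / 2) * ((\<Sum>j\<in>UNIV. \<Sum>k\<in>UNIV. h j k * f j * of_bool (k = J)) + (\<Sum>j\<in>UNIV. \<Sum>k\<in>UNIV. h j k * f k * of_bool (j = J)))"
    by (simp only: sum_distrib_left[symmetric] sum.distrib)
  moreover have "(\<Sum>j\<in>UNIV. \<Sum>k\<in>UNIV. h j k * f j * of_bool (k = J)) = (\<Sum>j\<in>UNIV. h j J * f j)"
    by (simp only: sum_of_bool_eq)
  moreover have "(\<Sum>j\<in>UNIV. \<Sum>k\<in>UNIV. h j k * f k * of_bool (j = J)) = (\<Sum>k\<in>UNIV. h J k * f k)"
    by (simp only: sum_distrib_right[symmetric] sum_of_bool_eq)
  ultimately show ?thesis by simp
qed

text \<open>The trace of the symmetrized gradient is a divergence.\<close>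

lemma metric_symmetrized_delta:
  assumes "riemannian_metric U g" "x \<in> U"
  shows "(\<Sum>j\<in>UNIV. \<Sum>k\<in>UNIV. of_real (ginv g x $ j $ k) * (- (1 / 2) * (f j * of_bool (k = J) + f k * of_bool (j = J))))
    = - (\<Sum>l\<in>UNIV. complex_of_real (ginv g x $ l $ J) * f l)"
proof -
  interpret G: pos_def_matrix "g x" by (rule riemannian_metric_pos_def[OF assms])
  have "(\<Sum>k\<in>UNIV. complex_of_real (ginv g x $ J $ k) * f k) = (\<Sum>k\<in>UNIV. of_real (ginv g x $ k $ J) * f k)"
    by (rule sum.cong) (simp_all only: ginv_def G.inverse_sym[of J])
  then show ?thesis unfolding sum_symmetrized_delta[of "\<lambda>j k. of_real (ginv g x $ j $ k)"] by simp
qed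

lemma row_op_nth:
  "row_op ord A p x $ K = (\<Sum>J\<in>UNIV. \<Sum>\<alpha> | mabs \<alpha> = ord K. A \<alpha> x $ K $ J * mpd \<alpha> (\<lambda>y. p y $ J) x)"
  unfolding row_op_def by (simp, rule sum.swap)

lemma row_symbol_nth:
  "row_symbol ord A x \<xi> $ K $ J = (\<Sum>\<alpha> | mabs \<alpha> = ord K. A \<alpha> x $ K $ J * (\<i> ^ mabs \<alpha> * mpow \<xi> \<alpha>))"
  unfolding row_symbol_def by (simp add: mult.assoc)

context
  fixes U :: "(real^'d::finite) set"
  assumes U: "open U"
begin

lemma row_op_grad:
  fixes p :: "real^'d \<Rightarrow> complex^1"
  assumes p: "smooth_on U p" and x: "x \<in> U"
  shows "neg_grad p x = row_op (\<lambda>_. 1) grad_coeffs p x"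
  using mpd_single[OF U smooth_on_nth[OF U p] x]
  by (simp only: vec_eq_iff row_op_nth sum_grad_coeffs) (simp add: neg_grad_def UNIV_1)

lemma row_op_hess:
  fixes p :: "real^'d \<Rightarrow> complex^1"
  assumes p: "smooth_on U p" and x: "x \<in> U"
  shows "hessian p x = row_op (\<lambda>_. 2) hess_coeffs p x"
  using mpd_single[OF U smooth_on_nth[OF U p] x]
  by (simp only: vec_eq_iff split_paired_All row_op_nth sum_hess_coeffs) (simp add: hessian_def UNIV_1)

lemma row_op_tracefree_hess:
  fixes p :: "real^'d \<Rightarrow> complex^1"
  assumes p: "smooth_on U p" and x: "x \<in> U"
  shows "tracefree_hessian g p x = row_op (\<lambda>_. 2) (tracefree_part g hess_coeffs) p x"
  using mpd_single[OF U smooth_on_nth[OF U p] x]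
  by (simp only: vec_eq_iff split_paired_All row_op_nth sum_tracefree_part sum_hess_coeffs)
    (simp add: tracefree_hessian_def UNIV_1)

lemma row_op_sym_grad:
  fixes p :: "real^'d \<Rightarrow> complex^'d"
  assumes p: "smooth_on U p" and x: "x \<in> U"
  shows "neg_sym_grad p x = row_op (\<lambda>_. 1) sym_grad_coeffs p x"
  using mpd_single[OF U smooth_on_nth[OF U p] x]
  by (simp only: vec_eq_iff split_paired_All row_op_nth sum_sym_grad_coeffs sum_distrib_left[symmetric] sum.distrib)
    (simp add: neg_sym_grad_def)

lemma row_op_tracefree_sym_grad:
  fixes p :: "real^'d \<Rightarrow> complex^'d"
  assumes g: "riemannian_metric U g" and p: "smooth_on U p" and x: "x \<in> U"
  shows "neg_tracefree_sym_grad g p x = row_op (\<lambda>_. 1) (tracefree_part g sym_grad_coeffs) p x"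
proof -
  let ?c = "\<lambda>j k. of_real (g x $ j $ k) :: complex"
  let ?s = "\<lambda>J. (\<Sum>l\<in>UNIV. of_real (ginv g x $ l $ J) * pd l (\<lambda>y. p y $ J) x) / of_nat CARD('d)"
  have "row_op (\<lambda>_. 1) (tracefree_part g sym_grad_coeffs) p x $ (j, k)
      = row_op (\<lambda>_. 1) sym_grad_coeffs p x $ (j, k) + ?c j k * (\<Sum>J\<in>UNIV. ?s J)" for j k
    using mpd_single(1)[OF U smooth_on_nth[OF U p] x]
    by (simp only: row_op_nth sum_tracefree_part sum_sym_grad_coeffs metric_symmetrized_delta[OF g x])
      (simp add: sum.distrib sum_subtractf sum_distrib_left sum_negf)
  moreover have "(\<Sum>J\<in>UNIV. ?s J)
      = (\<Sum>l\<in>UNIV. \<Sum>J\<in>UNIV. of_real (ginv g x $ l $ J) * pd l (\<lambda>y. p y $ J) x) / of_nat CARD('d)"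
    unfolding sum_divide_distrib[symmetric] by (subst sum.swap) (rule refl)
  ultimately show ?thesis
    unfolding vec_eq_iff split_paired_All row_op_sym_grad[OF p x, symmetric]
    by (simp add: neg_tracefree_sym_grad_def neg_sym_grad_def)
qed

end

lemma row_symbol_grad: "row_symbol (\<lambda>_. 1) grad_coeffs x \<xi> = symb_grad \<xi>"
  by (simp only: vec_eq_iff row_symbol_nth sum_grad_coeffs) (simp add: symb_grad_def mpow_count)

lemma row_symbol_hess: "row_symbol (\<lambda>_. 2) hess_coeffs x \<xi> = symb_hess \<xi>"
  by (simp only: vec_eq_iff split_paired_All row_symbol_nth sum_hess_coeffs) (simp add: symb_hess_def mpow_count)

lemma row_symbol_tracefree_hess:
  "row_symbol (\<lambda>_. 2) (tracefree_part g hess_coeffs) x \<xi> = symb_tracefree_hess g x \<xi>"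
  by (simp only: vec_eq_iff split_paired_All row_symbol_nth sum_tracefree_part sum_hess_coeffs)
    (simp add: symb_tracefree_hess_def mpow_count sum_negf mult.assoc)

lemma row_symbol_sym_grad: "row_symbol (\<lambda>_. 1) sym_grad_coeffs x \<xi> = symb_sym_grad \<xi>"
  by (simp only: vec_eq_iff split_paired_All row_symbol_nth sum_sym_grad_coeffs)
    (simp add: symb_sym_grad_def mpow_count kdelta_def of_bool_def)

lemma row_symbol_tracefree_sym_grad:
  assumes g: "riemannian_metric U g" and x: "x \<in> U"
  shows "row_symbol (\<lambda>_. 1) (tracefree_part g sym_grad_coeffs) x \<xi> = symb_tracefree_sym_grad g x \<xi>"
proof -
  interpret G: pos_def_matrix "g x" by (rule riemannian_metric_pos_def[OF assms])
  have "(\<Sum>l\<in>UNIV. of_real (ginv g x $ l $ J) * (\<i> * \<xi> $ l)) = \<i> * (\<Sum>m\<in>UNIV. of_real (ginv g x $ J $ m) * \<xi> $ m)" for J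
    by (simp add: ginv_def G.inverse_sym[of _ J] sum_distrib_left mult_ac)
  then show ?thesis
    by (simp only: vec_eq_iff split_paired_All row_symbol_nth sum_tracefree_part sum_sym_grad_coeffs metric_symmetrized_delta[OF g x])
      (simp add: symb_tracefree_sym_grad_def mpow_count kdelta_def of_bool_def)
qed

section \<open>The model operators and their adjoints\<close>

context
  fixes U :: "(real^'d::finite) set"
  assumes U: "open U"
begin

lemma principal_pair_grad:
  "principal_pair U (\<lambda>_. UNIV) (\<lambda>_. UNIV) (\<lambda>_. 1) (grad_coeffs :: ('d, 1, 'd) coeffs) div_vector_coeffs"
proof (rule dual_fibres.principal_pair_const[OF dual_fibres_UNIV[OF U]])
  fix x :: "real^'d" and e :: "complex^'d" and \<alpha> :: "'d mindex" and J :: 1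
  show "(\<Sum>K\<in>UNIV. e $ K * cnj (grad_coeffs \<alpha> x $ K $ J)) = (- 1) ^ mabs \<alpha> * (\<Sum>K\<in>UNIV. div_vector_coeffs \<alpha> $ J $ K * e $ K)"
    unfolding sum_distrib_left
    by (rule sum.cong) (auto simp: grad_coeffs_def div_vector_coeffs_def)
next
  fix x :: "real^'d" and j :: 'd
  have "grad_coeffs (count {#j#}) x $ j $ 1 \<noteq> 0" by (simp add: grad_coeffs_def)
  then show "\<exists>\<alpha>. grad_coeffs \<alpha> x $ j \<noteq> 0" by (intro exI[of _ "count {#j#}"]) auto
qed (auto simp: grad_coeffs_def div_vector_coeffs_def vec_eq_iff)

lemma principal_pair_hess:
  "principal_pair U (\<lambda>_. sym_tensors) (\<lambda>_. sym_tensors) (\<lambda>_. 2) (hess_coeffs :: ('d, 1, 'd \<times> 'd) coeffs) ddiv_coeffs"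
proof (rule dual_fibres.principal_pair_const[OF dual_fibres_sym_tensors[OF U]])
  fix x :: "real^'d" and e :: "complex^('d \<times> 'd)" and \<alpha> :: "'d mindex" and J :: 1
  show "(\<Sum>K\<in>UNIV. e $ K * cnj (hess_coeffs \<alpha> x $ K $ J)) = (- 1) ^ mabs \<alpha> * (\<Sum>K\<in>UNIV. ddiv_coeffs \<alpha> $ J $ K * e $ K)"
    unfolding sum_distrib_left
    by (rule sum.cong) (auto simp: hess_coeffs_def ddiv_coeffs_def)
next
  fix x :: "real^'d" and p :: "'d \<times> 'd"
  have "hess_coeffs (count {#fst p, snd p#}) x $ p $ 1 \<noteq> 0" by (simp add: hess_coeffs_def)
  then show "\<exists>\<alpha>. hess_coeffs \<alpha> x $ p \<noteq> 0" by (intro exI[of _ "count {#fst p, snd p#}"]) auto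
qed (auto simp: hess_coeffs_def ddiv_coeffs_def vec_eq_iff sym_tensors_def add_mset_commute)

lemma sum_sym_grad_tensor:
  fixes h :: "'d \<Rightarrow> 'd \<Rightarrow> complex"
  shows "(\<Sum>j\<in>UNIV. \<Sum>k\<in>UNIV. h j k * sym_grad_coeffs \<alpha> x $ (j, k) $ J)
    = - (1 / 2) * ((\<Sum>j\<in>UNIV. h j J * of_bool (\<alpha> = count {#j#})) + (\<Sum>k\<in>UNIV. h J k * of_bool (\<alpha> = count {#k#})))"
  unfolding sym_grad_coeffs_def vec_lambda_beta fst_conv snd_conv by (rule sum_symmetrized_delta)

lemma sym_grad_adjoint_div:
  fixes e :: "complex^('d \<times> 'd)"
  assumes e: "e \<in> sym_tensors"
  shows "(\<Sum>K\<in>UNIV. e $ K * cnj (sym_grad_coeffs \<alpha> x $ K $ J)) = (- 1) ^ mabs \<alpha> * (\<Sum>K\<in>UNIV. div_coeffs \<alpha> $ J $ K * e $ K)"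
proof -
  let ?b = "\<lambda>k. of_bool (\<alpha> = count {#k#}) :: complex"
  have "cnj (of_bool P) = of_bool P" for P by simp
  then have "cnj (sym_grad_coeffs \<alpha> x $ K $ J) = sym_grad_coeffs \<alpha> x $ K $ J" for K
    by (simp only: sym_grad_coeffs_def vec_lambda_beta complex_cnj_mult complex_cnj_add complex_cnj_minus
        complex_cnj_divide complex_cnj_one complex_cnj_numeral)
  then have "(\<Sum>K\<in>UNIV. e $ K * cnj (sym_grad_coeffs \<alpha> x $ K $ J))
      = - (1 / 2) * ((\<Sum>j\<in>UNIV. e $ (j, J) * ?b j) + (\<Sum>k\<in>UNIV. e $ (J, k) * ?b k))"
    by (simp only: sum_UNIV_prod sum_sym_grad_tensor[of "\<lambda>j k. e $ (j, k)"])
  also have "(\<Sum>j\<in>UNIV. e $ (j, J) * ?b j) = (\<Sum>k\<in>UNIV. e $ (J, k) * ?b k)"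
  proof (rule sum.cong[OF refl])
    fix j
    have "e $ (j, J) = e $ (J, j)" using e unfolding sym_tensors_def by blast
    then show "e $ (j, J) * ?b j = e $ (J, j) * ?b j" by (rule arg_cong)
  qed
  also have "- (1 / 2) * ((\<Sum>k\<in>UNIV. e $ (J, k) * ?b k) + (\<Sum>k\<in>UNIV. e $ (J, k) * ?b k)) = (\<Sum>k\<in>UNIV. - (e $ (J, k) * ?b k))"
    by (simp only: sum_negf) simp
  also have "\<dots> = (\<Sum>k\<in>UNIV. (- 1) ^ mabs \<alpha> * (?b k * e $ (J, k)))"
    by (rule sum.cong) auto
  also have "\<dots> = (- 1) ^ mabs \<alpha> * (\<Sum>k\<in>UNIV. ?b k * e $ (J, k))"
    by (simp only: sum_distrib_left)
  also have "(\<Sum>k\<in>UNIV. ?b k * e $ (J, k)) = (\<Sum>j\<in>UNIV. of_bool (j = J) * (\<Sum>k\<in>UNIV. ?b k * e $ (j, k)))"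
    by (simp only: sum_of_bool_eq)
  also have "\<dots> = (\<Sum>K\<in>UNIV. div_coeffs \<alpha> $ J $ K * e $ K)"
    unfolding sum_UNIV_prod sum_distrib_left
    by (intro sum.cong refl) (simp add: div_coeffs_def)
  finally show ?thesis .
qed

lemma sym_grad_coeffs_eq_0: "mabs \<alpha> \<noteq> 1 \<Longrightarrow> sym_grad_coeffs \<alpha> x $ K = 0"
  by (auto simp: sym_grad_coeffs_def vec_eq_iff)

lemma div_coeffs_eq_0: "mabs \<alpha> \<noteq> 1 \<Longrightarrow> div_coeffs \<alpha> $ J $ K = 0"
  by (auto simp: div_coeffs_def)

lemma sym_grad_coeffs_sym: "sym_grad_coeffs \<alpha> x $ (j, k) $ J = sym_grad_coeffs \<alpha> x $ (k, j) $ J"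
  unfolding sym_grad_coeffs_def vec_lambda_beta fst_conv snd_conv by (subst add.commute) (rule refl)

lemma principal_pair_sym_grad:
  "principal_pair U (\<lambda>_. sym_tensors) (\<lambda>_. sym_tensors) (\<lambda>_. 1) (sym_grad_coeffs :: ('d, 'd, 'd \<times> 'd) coeffs) div_coeffs"
proof (rule dual_fibres.principal_pair_const[OF dual_fibres_sym_tensors[OF U]])
  fix x :: "real^'d" and p :: "'d \<times> 'd"
  have "sym_grad_coeffs (count {#fst p#}) x $ p $ snd p \<noteq> 0"
    by (cases "fst p = snd p") (auto simp: sym_grad_coeffs_def)
  then show "\<exists>\<alpha>. sym_grad_coeffs \<alpha> x $ p \<noteq> 0" by (intro exI[of _ "count {#fst p#}"]) auto
next
  fix x :: "real^'d" and \<alpha> :: "'d mindex" and J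
  show "(\<chi> K. sym_grad_coeffs \<alpha> x $ K $ J) \<in> sym_tensors"
    unfolding sym_tensors_def mem_Collect_eq vec_lambda_beta by (intro allI) (rule sym_grad_coeffs_sym)
next
  fix x :: "real^'d" and e :: "complex^('d \<times> 'd)" and \<alpha> :: "'d mindex" and J
  assume "e \<in> sym_tensors"
  then show "(\<Sum>K\<in>UNIV. e $ K * cnj (sym_grad_coeffs \<alpha> x $ K $ J)) = (- 1) ^ mabs \<alpha> * (\<Sum>K\<in>UNIV. div_coeffs \<alpha> $ J $ K * e $ K)"
    by (rule sym_grad_adjoint_div)
qed (rule sym_grad_coeffs_eq_0 div_coeffs_eq_0, assumption)+

context
  fixes g :: "real^'d \<Rightarrow> real^'d^'d"
  assumes g: "riemannian_metric U g"
begin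

lemma metric_trace:
  assumes "x \<in> U"
  shows "(\<Sum>j\<in>UNIV. \<Sum>k\<in>UNIV. complex_of_real (ginv g x $ j $ k) * of_real (g x $ j $ k)) = of_nat CARD('d)"
proof -
  interpret G: pos_def_matrix "g x" by (rule riemannian_metric_pos_def[OF g assms])
  have "(\<Sum>j\<in>UNIV. \<Sum>k\<in>UNIV. complex_of_real (ginv g x $ j $ k) * of_real (g x $ j $ k))
      = of_real (\<Sum>j\<in>UNIV. \<Sum>k\<in>UNIV. matrix_inv (g x) $ j $ k * g x $ j $ k)"
    by (simp add: ginv_def)
  then show ?thesis unfolding G.trace_inverse by simp
qed

text \<open>The trace term is a multiple of the metric, so it pairs to zero with trace-free tensors, and \<open>B\<close> remains the
  adjoint. That no row vanishes has to be checked in each case, since it depends on the dimension.\<close>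

lemma principal_pair_tracefree_part:
  fixes A :: "('d, 'j::finite, 'd \<times> 'd) coeffs"
  assumes "principal_pair U (\<lambda>_. sym_tensors) (\<lambda>_. sym_tensors) (\<lambda>_. n) A B"
    and row: "\<And>x p. x \<in> U \<Longrightarrow> \<exists>\<alpha> J. tracefree_part g A \<alpha> x $ p $ J \<noteq> 0"
  shows "principal_pair U (tracefree_up g) (tracefree_down g) (\<lambda>_. n) (tracefree_part g A) B"
proof -
  interpret P: principal_pair U "\<lambda>_. sym_tensors" "\<lambda>_. sym_tensors" "\<lambda>_. n" A B by fact
  let ?H = "\<lambda>x j k. complex_of_real (ginv g x $ j $ k)"
  let ?q = "\<lambda>\<alpha> x J. (\<Sum>j\<in>UNIV. \<Sum>k\<in>UNIV. ?H x j k * A \<alpha> x $ (j, k) $ J) / of_nat CARD('d)"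
  have nth: "tracefree_part g A \<alpha> x $ p $ J = A \<alpha> x $ p $ J - of_real (g x $ fst p $ snd p) * ?q \<alpha> x J" for \<alpha> x p J
    by (simp add: tracefree_part_def)
  show ?thesis
  proof (rule dual_fibres.principal_pair_const[OF dual_fibres_tracefree[OF U g]])
    fix x and \<alpha> :: "'d mindex" and p :: "'d \<times> 'd" assume "x \<in> U" "mabs \<alpha> \<noteq> n"
    then show "tracefree_part g A \<alpha> x $ p = 0"
      unfolding vec_eq_iff nth by (simp add: P.A_order)
  next
    fix x and \<alpha> :: "'d mindex" and J :: 'j assume x: "x \<in> U"
    interpret G: pos_def_matrix "g x" by (rule riemannian_metric_pos_def[OF g x])
    let ?w = "(\<chi> p. tracefree_part g A \<alpha> x $ p $ J) :: complex^('d \<times> 'd)"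
    have "A \<alpha> x $ (j, k) $ J = A \<alpha> x $ (k, j) $ J" for j k
      using P.A_E'[OF x, of \<alpha> J] unfolding sym_tensors_def mem_Collect_eq vec_lambda_beta by blast
    then have "?w $ (j, k) = ?w $ (k, j)" for j k
      unfolding vec_lambda_beta nth fst_conv snd_conv G.sym[of j k] by simp
    then have "?w \<in> sym_tensors" unfolding sym_tensors_def by blast
    moreover have "(\<Sum>j\<in>UNIV. \<Sum>k\<in>UNIV. ?H x j k * ?w $ (j, k))
        = (\<Sum>j\<in>UNIV. \<Sum>k\<in>UNIV. ?H x j k * A \<alpha> x $ (j, k) $ J)
          - (\<Sum>j\<in>UNIV. \<Sum>k\<in>UNIV. ?H x j k * of_real (g x $ j $ k)) * ?q \<alpha> x J"
      unfolding sum_distrib_right vec_lambda_beta nth fst_conv snd_conv right_diff_distrib sum_subtractf mult.assoc[symmetric] ..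
    then have "(\<Sum>j\<in>UNIV. \<Sum>k\<in>UNIV. ?H x j k * ?w $ (j, k)) = 0" unfolding metric_trace[OF x] by simp
    ultimately show "?w \<in> tracefree_down g x" by (simp add: tracefree_down_def)
  next
    fix x e and \<alpha> :: "'d mindex" and J :: 'j assume x: "x \<in> U" and e: "e \<in> tracefree_up g x"
    have tr: "(\<Sum>p\<in>UNIV. e $ p * of_real (g x $ fst p $ snd p)) = 0" and sym: "e \<in> sym_tensors"
      using e by (simp_all add: tracefree_up_def sum_UNIV_prod mult.commute)
    have "(\<Sum>K\<in>UNIV. e $ K * cnj (tracefree_part g A \<alpha> x $ K $ J))
        = (\<Sum>K\<in>UNIV. e $ K * cnj (A \<alpha> x $ K $ J)) - (\<Sum>p\<in>UNIV. e $ p * of_real (g x $ fst p $ snd p)) * cnj (?q \<alpha> x J)"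
      unfolding nth sum_distrib_right sum_subtractf[symmetric]
      by (rule sum.cong) (auto simp: right_diff_distrib)
    then show "(\<Sum>K\<in>UNIV. e $ K * cnj (tracefree_part g A \<alpha> x $ K $ J)) = (- 1) ^ mabs \<alpha> * (\<Sum>K\<in>UNIV. B \<alpha> $ J $ K * e $ K)"
      unfolding tr P.A_adjoint_B[OF x sym] by simp
  next
    fix x p assume "x \<in> U"
    then obtain \<alpha> J where "tracefree_part g A \<alpha> x $ p $ J \<noteq> 0" using row by blast
    then show "\<exists>\<alpha>. tracefree_part g A \<alpha> x $ p \<noteq> 0" by (intro exI[of _ \<alpha>]) auto
  qed (rule P.B_order)
qed

text \<open>A row \<open>(j, k)\<close> with \<open>g\<^sub>j\<^sub>k \<noteq> 0\<close> contains the trace term at \<open>\<partial>\<^sub>a\<^sup>2\<close> for every \<open>a\<close>; in dimension at least two it is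
  not cancelled by \<open>\<partial>\<^sub>j \<partial>\<^sub>k\<close> for all of them.\<close>

lemma principal_pair_tracefree_hess:
  assumes d: "CARD('d) \<ge> 2"
  shows "principal_pair U (tracefree_up g) (tracefree_down g) (\<lambda>_. 2) (tracefree_part g hess_coeffs) ddiv_coeffs"
proof (rule principal_pair_tracefree_part[OF principal_pair_hess])
  fix x :: "real^'d" and p :: "'d \<times> 'd" assume x: "x \<in> U"
  interpret G: pos_def_matrix "g x" by (rule riemannian_metric_pos_def[OF g x])
  obtain j k where p: "p = (j, k)" by (cases p)
  show "\<exists>\<alpha> J. tracefree_part g hess_coeffs \<alpha> x $ p $ J \<noteq> 0"
  proof (cases "g x $ j $ k = 0")
    case True
    then show ?thesis by (intro exI[of _ "count {#j, k#}"]) (simp add: tracefree_part_def hess_coeffs_def p)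
  next
    case False
    have "\<exists>a. a \<noteq> j"
    proof (rule ccontr)
      assume "\<nexists>a. a \<noteq> j"
      then have "(UNIV :: 'd set) = {j}" by auto
      then have "CARD('d) = card {j}" by (rule arg_cong)
      then show False using d by simp
    qed
    then obtain a where a: "\<not> (j = a \<and> k = a)" by metis
    have "count {#a, a#} = count {#l, m#} \<longleftrightarrow> l = a \<and> m = a" for l m :: 'd
      by (auto simp: count_inject add_eq_conv_ex)
    then have c: "of_bool (count {#a, a#} = count {#l, m#}) = (of_bool (l = a) * of_bool (m = a) :: complex)" for l m
      by simp
    have "(\<Sum>l\<in>UNIV. \<Sum>m\<in>UNIV. of_real (ginv g x $ l $ m) * hess_coeffs (count {#a, a#}) x $ (l, m) $ 1)
        = complex_of_real (ginv g x $ a $ a)"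
      unfolding hess_coeffs_def vec_lambda_beta fst_conv snd_conv c mult.assoc[symmetric]
      by (simp only: sum_of_bool_eq)
    then have "tracefree_part g hess_coeffs (count {#a, a#}) x $ p $ 1
        = of_bool (j = a) * of_bool (k = a) - of_real (g x $ j $ k) * (of_real (ginv g x $ a $ a) / of_nat CARD('d))"
      by (simp only: tracefree_part_def vec_lambda_beta p fst_conv snd_conv) (simp only: hess_coeffs_def vec_lambda_beta fst_conv snd_conv c)
    then show ?thesis using False G.inverse_diagonal_pos[of a] a
      by (intro exI[of _ "count {#a, a#}"] exI[of _ 1]) (auto simp: ginv_def)
  qed
qed

text \<open>A row \<open>(j, k)\<close> with \<open>g\<^sub>j\<^sub>k \<noteq> 0\<close> contains the trace term at \<open>\<partial>\<^sub>a \<omega>\<^sub>a\<close> with a third index \<open>a\<close>.\<close>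

lemma principal_pair_tracefree_sym_grad:
  assumes d: "CARD('d) \<ge> 3"
  shows "principal_pair U (tracefree_up g) (tracefree_down g) (\<lambda>_. 1) (tracefree_part g sym_grad_coeffs) div_coeffs"
proof (rule principal_pair_tracefree_part[OF principal_pair_sym_grad])
  fix x :: "real^'d" and p :: "'d \<times> 'd" assume x: "x \<in> U"
  interpret G: pos_def_matrix "g x" by (rule riemannian_metric_pos_def[OF g x])
  obtain j k where p: "p = (j, k)" by (cases p)
  show "\<exists>\<alpha> J. tracefree_part g sym_grad_coeffs \<alpha> x $ p $ J \<noteq> 0"
  proof (cases "g x $ j $ k = 0")
    case True
    then have "j \<noteq> k" using G.diagonal_pos[of j] by auto
    then show ?thesis using True
      by (intro exI[of _ "count {#j#}"] exI[of _ k]) (simp add: tracefree_part_def p, simp add: sym_grad_coeffs_def)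
  next
    case False
    have "card {j, k} < CARD('d)" using d by (intro le_less_trans[OF card_insert_le_m1[of 2]]) (auto simp: card_insert_if)
    then have "{j, k} \<noteq> UNIV" by auto
    then obtain a where a: "a \<noteq> j" "a \<noteq> k" by auto
    have "count {#a#} = count {#l#} \<longleftrightarrow> l = a" for l by (auto simp: count_inject)
    then have c: "of_bool (count {#a#} = count {#l#}) = (of_bool (l = a) :: complex)" for l by simp
    have "(\<Sum>l\<in>UNIV. \<Sum>m\<in>UNIV. of_real (ginv g x $ l $ m) * sym_grad_coeffs (count {#a#}) x $ (l, m) $ a)
        = - complex_of_real (ginv g x $ a $ a)"
      unfolding sum_sym_grad_tensor[of "\<lambda>l m. of_real (ginv g x $ l $ m)"] c by (simp only: sum_of_bool_eq) simp
    moreover have "sym_grad_coeffs (count {#a#}) x $ p $ a = 0" using a by (simp add: sym_grad_coeffs_def p)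
    ultimately have "tracefree_part g sym_grad_coeffs (count {#a#}) x $ p $ a
        = of_real (g x $ j $ k) * (of_real (ginv g x $ a $ a) / of_nat CARD('d))"
      by (simp only: tracefree_part_def vec_lambda_beta p fst_conv snd_conv) simp
    then show ?thesis using False G.inverse_diagonal_pos[of a]
      by (intro exI[of _ "count {#a#}"] exI[of _ a]) (simp add: ginv_def)
  qed
qed

end

end

section \<open>Injectivity of the symbols\<close>

lemma symb_grad_kernel:
  assumes "\<xi> \<noteq> 0" "symb_grad \<xi> *v v = 0"
  shows "v = 0"
proof -
  obtain j where j: "\<xi> $ j \<noteq> 0" using assms(1) by (auto simp: vec_eq_iff)
  have "(symb_grad \<xi> *v v) $ j = 0" using assms(2) by simp
  then show ?thesis using j by (simp add: symb_grad_def matrix_vector_mult_def UNIV_1 vec_eq_iff forall_1)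
qed

lemma symb_hess_kernel:
  assumes "\<xi> \<noteq> 0" "symb_hess \<xi> *v v = 0"
  shows "v = 0"
proof -
  obtain j where j: "\<xi> $ j \<noteq> 0" using assms(1) by (auto simp: vec_eq_iff)
  have "(symb_hess \<xi> *v v) $ (j, j) = 0" using assms(2) by simp
  then show ?thesis using j by (simp add: symb_hess_def matrix_vector_mult_def UNIV_1 vec_eq_iff forall_1)
qed

text \<open>A nonzero kernel element gives \<open>\<xi>\<^sub>j \<xi>\<^sub>k = c g\<^sub>j\<^sub>k\<close>. The minors of the left hand side vanish, those of the metric do not.\<close>

lemma symb_tracefree_hess_kernel:
  fixes \<xi> :: "complex^'d::finite"
  assumes "riemannian_metric U g" "x \<in> U" and d: "CARD('d) \<ge> 2"
    and \<xi>: "\<xi> \<noteq> 0" and v: "symb_tracefree_hess g x \<xi> *v v = 0"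
  shows "v = 0"
proof (rule ccontr)
  assume "v \<noteq> 0"
  then have v1: "v $ 1 \<noteq> 0" by (simp add: vec_eq_iff forall_1)
  interpret G: pos_def_matrix "g x" by (rule riemannian_metric_pos_def[OF assms(1,2)])
  define c where "c = (\<Sum>l\<in>UNIV. \<Sum>m\<in>UNIV. of_real (ginv g x $ l $ m) * \<xi> $ l * \<xi> $ m) / of_nat CARD('d)"
  have eq: "\<xi> $ j * \<xi> $ k = c * of_real (g x $ j $ k)" for j k
  proof -
    have "(symb_tracefree_hess g x \<xi> *v v) $ (j, k) = 0" using v by simp
    then have "(- (\<xi> $ j * \<xi> $ k) + c * of_real (g x $ j $ k)) * v $ 1 = 0"
      by (simp add: symb_tracefree_hess_def matrix_vector_mult_def UNIV_1 c_def mult.commute)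
    then show ?thesis using v1 by (simp add: add_eq_0_iff)
  qed
  have c: "c \<noteq> 0"
  proof
    assume "c = 0"
    then have "\<xi> $ j = 0" for j using eq[of j j] by simp
    then show False using \<xi> by (simp add: vec_eq_iff)
  qed
  have "\<not> is_singleton (UNIV :: 'd set)" using d by (auto simp: is_singleton_altdef)
  then obtain j k :: 'd where jk: "j \<noteq> k" by (metis UNIV_I is_singletonI' empty_iff)
  have "c\<^sup>2 * of_real (g x $ j $ j * g x $ k $ k) = (\<xi> $ j * \<xi> $ j) * (\<xi> $ k * \<xi> $ k)"
    unfolding eq by (simp add: power2_eq_square)
  also have "\<dots> = (\<xi> $ j * \<xi> $ k) * (\<xi> $ j * \<xi> $ k)" by (simp add: mult_ac)
  also have "\<dots> = c\<^sup>2 * of_real ((g x $ j $ k)\<^sup>2)" unfolding eq by (simp add: power2_eq_square)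
  finally have "complex_of_real (g x $ j $ j * g x $ k $ k) = of_real ((g x $ j $ k)\<^sup>2)" using c by simp
  then show False using G.minor_nonzero[OF jk] by (simp only: of_real_eq_iff)
qed

lemma sym_product_kernel:
  fixes \<xi> \<omega> :: "complex^'d::finite"
  assumes "\<xi> \<noteq> 0" and eq: "\<And>j k. \<xi> $ j * \<omega> $ k + \<xi> $ k * \<omega> $ j = 0"
  shows "\<omega> = 0"
proof -
  obtain a where a: "\<xi> $ a \<noteq> 0" using assms(1) by (auto simp: vec_eq_iff)
  have "\<omega> $ a = 0" using eq[of a a] a by simp
  then have "\<omega> $ k = 0" for k using eq[of a k] a by simp
  then show ?thesis by (simp add: vec_eq_iff)
qed

lemma symb_sym_grad_nth:
  "(symb_sym_grad \<xi> *v \<omega>) $ (j, k) = - (\<i> / 2) * (\<xi> $ j * \<omega> $ k + \<xi> $ k * \<omega> $ j)"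
proof -
  have "(symb_sym_grad \<xi> *v \<omega>) $ (j, k)
      = (\<Sum>l\<in>UNIV. - (\<i> / 2) * (\<xi> $ j * (of_bool (k = l) * \<omega> $ l) + \<xi> $ k * (of_bool (j = l) * \<omega> $ l)))"
    unfolding matrix_vector_mult_def vec_lambda_beta
    by (rule sum.cong) (auto simp: symb_sym_grad_def kdelta_def algebra_simps)
  then show ?thesis by (simp only: sum_distrib_left[symmetric] sum.distrib sum_of_bool_eq)
qed

lemma symb_sym_grad_kernel:
  assumes "\<xi> \<noteq> 0" "symb_sym_grad \<xi> *v \<omega> = 0"
  shows "\<omega> = 0"
proof (rule sym_product_kernel[OF assms(1)])
  fix j k
  have "(symb_sym_grad \<xi> *v \<omega>) $ (j, k) = 0" using assms(2) by simp
  then show "\<xi> $ j * \<omega> $ k + \<xi> $ k * \<omega> $ j = 0" unfolding symb_sym_grad_nth by simp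
qed

text \<open>In dimension at least three there is \<open>\<eta> \<noteq> 0\<close> orthogonal to \<open>\<xi>\<close> and \<open>\<omega>\<close> for the bilinear product, namely their cross
  product in three of the coordinates, and then \<open>\<eta>\<close> is in the kernel of the matrix. If the cross product is zero, the left
  hand side has rank one on two of these coordinates, where the matrix has a nonzero minor.\<close>

lemma (in pos_def_matrix) not_sym_product:
  fixes \<xi> \<omega> :: "complex^'d"
  assumes d: "CARD('d) \<ge> 3" and eq: "\<And>j k. \<xi> $ j * \<omega> $ k + \<xi> $ k * \<omega> $ j = c * of_real (G $ j $ k)"
  shows "c = 0"
proof (rule ccontr)
  assume c: "c \<noteq> 0"
  obtain S :: "'d set" where "card S = 3" using obtain_subset_with_card_n[OF d] by blast
  then obtain a b e :: 'd where ne: "a \<noteq> b" "b \<noteq> e" "a \<noteq> e" by (metis card_3_iff)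
  define M where "M p q = \<xi> $ p * \<omega> $ q - \<xi> $ q * \<omega> $ p" for p q
  define \<eta> :: "complex^'d" where "\<eta> = (\<chi> k. if k = a then M b e else if k = b then M e a else if k = e then M a b else 0)"
  have sum3: "(\<Sum>k\<in>UNIV. f k * \<eta> $ k) = f a * M b e + f b * M e a + f e * M a b" for f :: "'d \<Rightarrow> complex"
  proof -
    have "(\<Sum>k\<in>UNIV. f k * \<eta> $ k) = (\<Sum>k\<in>{a, b, e}. f k * \<eta> $ k)"
      by (rule sum.mono_neutral_right) (auto simp: \<eta>_def)
    then show ?thesis using ne by (simp add: \<eta>_def)
  qed
  have orth: "(\<Sum>k\<in>UNIV. \<xi> $ k * \<eta> $ k) = 0" "(\<Sum>k\<in>UNIV. \<omega> $ k * \<eta> $ k) = 0"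
    unfolding sum3 by (simp_all add: M_def algebra_simps)
  have "\<eta> = 0"
  proof (rule complex_kernel)
    fix j
    have "c * (\<Sum>k\<in>UNIV. of_real (G $ j $ k) * \<eta> $ k) = (\<Sum>k\<in>UNIV. (\<xi> $ j * \<omega> $ k + \<xi> $ k * \<omega> $ j) * \<eta> $ k)"
      unfolding eq by (simp add: sum_distrib_left mult.assoc)
    also have "\<dots> = \<xi> $ j * (\<Sum>k\<in>UNIV. \<omega> $ k * \<eta> $ k) + \<omega> $ j * (\<Sum>k\<in>UNIV. \<xi> $ k * \<eta> $ k)"
      unfolding sum_distrib_left sum.distrib[symmetric] by (rule sum.cong) (auto simp: algebra_simps)
    finally show "(\<Sum>k\<in>UNIV. of_real (G $ j $ k) * \<eta> $ k) = 0" using c by (simp add: orth)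
  qed
  then have "\<eta> $ e = 0" by simp
  then have M: "\<xi> $ a * \<omega> $ b = \<xi> $ b * \<omega> $ a" using ne by (simp add: \<eta>_def M_def)
  have "c\<^sup>2 * of_real (G $ a $ a * G $ b $ b) = (c * of_real (G $ a $ a)) * (c * of_real (G $ b $ b))"
    by (simp add: power2_eq_square)
  also have "\<dots> = 4 * ((\<xi> $ a * \<omega> $ b) * (\<xi> $ b * \<omega> $ a))"
    unfolding eq[symmetric] by (simp add: algebra_simps)
  also have "\<dots> = (\<xi> $ a * \<omega> $ b + \<xi> $ b * \<omega> $ a)\<^sup>2"
    unfolding M by (simp add: power2_eq_square)
  also have "\<dots> = c\<^sup>2 * of_real ((G $ a $ b)\<^sup>2)" unfolding eq by (simp add: power2_eq_square)
  finally have "complex_of_real (G $ a $ a * G $ b $ b) = of_real ((G $ a $ b)\<^sup>2)" using c by simp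
  then show False using minor_nonzero[OF ne(1)] by (simp only: of_real_eq_iff)
qed

lemma symb_tracefree_sym_grad_kernel:
  fixes \<xi> \<omega> :: "complex^'d::finite"
  assumes "riemannian_metric U g" "x \<in> U" and d: "CARD('d) \<ge> 3"
    and \<xi>: "\<xi> \<noteq> 0" and w: "symb_tracefree_sym_grad g x \<xi> *v \<omega> = 0"
  shows "\<omega> = 0"
proof -
  interpret G: pos_def_matrix "g x" by (rule riemannian_metric_pos_def[OF assms(1,2)])
  define r where "r l = (\<Sum>m\<in>UNIV. of_real (ginv g x $ l $ m) * \<xi> $ m)" for l
  define s where "s = (\<Sum>l\<in>UNIV. r l * \<omega> $ l)"
  define c where "c = 2 * s / of_nat CARD('d)"
  have eq: "\<xi> $ j * \<omega> $ k + \<xi> $ k * \<omega> $ j = c * of_real (g x $ j $ k)" for j k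
  proof -
    have "symb_tracefree_sym_grad g x \<xi> $ (j, k) $ l
        = symb_sym_grad \<xi> $ (j, k) $ l + \<i> / of_nat CARD('d) * of_real (g x $ j $ k) * r l" for l
      by (simp add: symb_tracefree_sym_grad_def symb_sym_grad_def r_def)
    then have "(symb_tracefree_sym_grad g x \<xi> *v \<omega>) $ (j, k)
        = (symb_sym_grad \<xi> *v \<omega>) $ (j, k) + \<i> / of_nat CARD('d) * of_real (g x $ j $ k) * s"
      unfolding matrix_vector_mult_def vec_lambda_beta s_def
      by (simp only: distrib_right sum.distrib mult.assoc sum_distrib_left)
    then have "- (\<i> / 2) * (\<xi> $ j * \<omega> $ k + \<xi> $ k * \<omega> $ j) + \<i> / of_nat CARD('d) * of_real (g x $ j $ k) * s = 0"
      using w by (simp add: symb_sym_grad_nth)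
    then have "\<i> * ((\<xi> $ j * \<omega> $ k + \<xi> $ k * \<omega> $ j) - c * of_real (g x $ j $ k)) = 0"
      by (simp add: c_def field_simps)
    then show ?thesis by simp
  qed
  then have "c = 0" by (rule G.not_sym_product[OF d])
  then show ?thesis using sym_product_kernel[OF \<xi>] eq by simp
qed

lemma smooth_on_vfst_vsnd:
  fixes u :: "real^'d::finite \<Rightarrow> complex^('a::finite + 'b::finite)"
  assumes "open U" "smooth_on U u"
  shows "smooth_on U (\<lambda>y. vfst (u y))" and "smooth_on U (\<lambda>y. vsnd (u y))"
  by (rule smooth_on_vec[OF assms(1)], simp add: smooth_on_nth[OF assms])+

section \<open>The seven operators\<close>

theorem theorem1p14:
  fixes U :: "(real^'d::finite) set" and g :: "real^'d \<Rightarrow> real^'d^'d"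
  assumes "open U" and "riemannian_metric U g"
  shows "((\<forall>P Q.
         diff_op U (\<lambda>x. UNIV) P \<and>
         formal_adjoint U (\<lambda>x. UNIV) (\<lambda>x. UNIV) P Q \<longrightarrow>
         (has_prin U (\<lambda>x. UNIV) Q P div_vector \<longleftrightarrow>
            adjoint_has_prin U Q neg_grad) \<and>
         (has_prin U (\<lambda>x. UNIV) Q P div_vector \<longrightarrow>
            (\<forall>x\<in>U. \<forall>\<xi>. prin_symbol U Q x \<xi> = symb_grad \<xi>) \<and> FC U Q))) \<and>
       ((\<forall>P Q.
         diff_op U (\<lambda>x. sym_tensors) P \<and>
         formal_adjoint U (\<lambda>x. sym_tensors) (\<lambda>x. sym_tensors) P Q \<longrightarrow>
         (has_prin U (\<lambda>x. sym_tensors) Q P ddiv_tensor \<longleftrightarrow>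
            adjoint_has_prin U Q hessian) \<and>
         (has_prin U (\<lambda>x. sym_tensors) Q P ddiv_tensor \<longrightarrow>
            (\<forall>x\<in>U. \<forall>\<xi>. prin_symbol U Q x \<xi> = symb_hess \<xi>) \<and> FC U Q))) \<and>
       (CARD('d) \<ge> 2 \<longrightarrow> (\<forall>P Q.
         diff_op U (tracefree_up g) P \<and>
         formal_adjoint U (tracefree_up g) (tracefree_down g) P Q \<longrightarrow>
         (has_prin U (tracefree_up g) Q P ddiv_tensor \<longleftrightarrow>
            adjoint_has_prin U Q (tracefree_hessian g)) \<and>
         (has_prin U (tracefree_up g) Q P ddiv_tensor \<longrightarrow>
            (\<forall>x\<in>U. \<forall>\<xi>. prin_symbol U Q x \<xi> = symb_tracefree_hess g x \<xi>) \<and> FC U Q))) \<and>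
       ((\<forall>P Q.
         diff_op U (\<lambda>x. sym_tensors) P \<and>
         formal_adjoint U (\<lambda>x. sym_tensors) (\<lambda>x. sym_tensors) P Q \<longrightarrow>
         (has_prin U (\<lambda>x. sym_tensors) Q P div_tensor \<longleftrightarrow>
            adjoint_has_prin U Q neg_sym_grad) \<and>
         (has_prin U (\<lambda>x. sym_tensors) Q P div_tensor \<longrightarrow>
            (\<forall>x\<in>U. \<forall>\<xi>. prin_symbol U Q x \<xi> = symb_sym_grad \<xi>) \<and> FC U Q))) \<and>
       (CARD('d) \<ge> 3 \<longrightarrow> (\<forall>P Q.
         diff_op U (tracefree_up g) P \<and>
         formal_adjoint U (tracefree_up g) (tracefree_down g) P Q \<longrightarrow>
         (has_prin U (tracefree_up g) Q P div_tensor \<longleftrightarrow>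
            adjoint_has_prin U Q (neg_tracefree_sym_grad g)) \<and>
         (has_prin U (tracefree_up g) Q P div_tensor \<longrightarrow>
            (\<forall>x\<in>U. \<forall>\<xi>. prin_symbol U Q x \<xi> = symb_tracefree_sym_grad g x \<xi>) \<and> FC U Q))) \<and>
       ((\<forall>P Q.
         diff_op U (pair_fibre (\<lambda>x. sym_tensors) (\<lambda>x. sym_tensors)) P \<and>
         formal_adjoint U (pair_fibre (\<lambda>x. sym_tensors) (\<lambda>x. sym_tensors)) (pair_fibre (\<lambda>x. sym_tensors) (\<lambda>x. sym_tensors)) P Q \<longrightarrow>
         (has_prin U (pair_fibre (\<lambda>x. sym_tensors) (\<lambda>x. sym_tensors)) Q P
              (\<lambda>w x. vpair (ddiv_tensor (\<lambda>y. vfst (w y)) x) (div_tensor (\<lambda>y. vsnd (w y)) x)) \<longleftrightarrow>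
            adjoint_has_prin U Q (\<lambda>w x. vpair (hessian (\<lambda>y. vfst (w y)) x) (neg_sym_grad (\<lambda>y. vsnd (w y)) x))) \<and>
         (has_prin U (pair_fibre (\<lambda>x. sym_tensors) (\<lambda>x. sym_tensors)) Q P
              (\<lambda>w x. vpair (ddiv_tensor (\<lambda>y. vfst (w y)) x) (div_tensor (\<lambda>y. vsnd (w y)) x)) \<longrightarrow>
            (\<forall>x\<in>U. \<forall>\<xi>. prin_symbol U Q x \<xi> = block_diag (symb_hess \<xi>) (symb_sym_grad \<xi>)) \<and> FC U Q))) \<and>
       (CARD('d) \<ge> 3 \<longrightarrow> (\<forall>P Q.
         diff_op U (pair_fibre (\<lambda>x. sym_tensors) (tracefree_up g)) P \<and>
         formal_adjoint U (pair_fibre (\<lambda>x. sym_tensors) (tracefree_up g)) (pair_fibre (\<lambda>x. sym_tensors) (tracefree_down g)) P Q \<longrightarrow>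
         (has_prin U (pair_fibre (\<lambda>x. sym_tensors) (tracefree_up g)) Q P
              (\<lambda>w x. vpair (ddiv_tensor (\<lambda>y. vfst (w y)) x) (div_tensor (\<lambda>y. vsnd (w y)) x)) \<longrightarrow>
            (\<forall>x\<in>U. \<forall>\<xi>. prin_symbol U Q x \<xi> = block_diag (symb_hess \<xi>) (symb_tracefree_sym_grad g x \<xi>)) \<and> FC U Q)))"
proof -
  note U = assms(1) and g = assms(2)
  note equivalence = principal_pair.principal_part_equivalence
  note columns = column_op_div_vector[OF U] column_op_ddiv_tensor[OF U] column_op_div_tensor[OF U]
  note rows = row_op_grad[OF U] row_op_hess[OF U] row_op_tracefree_hess[OF U] row_op_sym_grad[OF U]
    row_op_tracefree_sym_grad[OF U g]
  note symbols = row_symbol_grad row_symbol_hess row_symbol_tracefree_hess row_symbol_sym_grad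
    row_symbol_tracefree_sym_grad[OF g]
  note direct_sums = column_op_direct_sum row_op_direct_sum row_symbol_direct_sum
  note halves = smooth_on_vfst_vsnd[OF U]
  show ?thesis
  proof (rule conjI[OF _ conjI[OF _ conjI[OF _ conjI[OF _ conjI[OF _ conjI]]]]], goal_cases)
    case 1
    show ?case
    proof (intro allI impI, goal_cases)
      case (1 P Q)
      show ?case
        by (rule equivalence[OF principal_pair_grad[OF U] _ _ _ _ 1])
          (use symb_grad_kernel in \<open>auto simp: columns rows symbols simp del: One_nat_def\<close>)
    qed
  next
    case 2
    show ?case
    proof (intro allI impI, goal_cases)
      case (1 P Q)
      show ?case
        by (rule equivalence[OF principal_pair_hess[OF U] _ _ _ _ 1])
          (use symb_hess_kernel in \<open>auto simp: columns rows symbols simp del: One_nat_def\<close>)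
    qed
  next
    case 3
    show ?case
    proof (intro allI impI, goal_cases)
      case (1 P Q)
      show ?case
        by (rule equivalence[OF principal_pair_tracefree_hess[OF U g 1(1)] _ _ _ _ 1(2)])
          (use symb_tracefree_hess_kernel[OF g _ 1(1)] in \<open>auto simp: columns rows symbols simp del: One_nat_def\<close>)
    qed
  next
    case 4
    show ?case
    proof (intro allI impI, goal_cases)
      case (1 P Q)
      show ?case
        by (rule equivalence[OF principal_pair_sym_grad[OF U] _ _ _ _ 1])
          (use symb_sym_grad_kernel in \<open>auto simp: columns rows symbols simp del: One_nat_def\<close>)
    qed
  next
    case 5
    show ?case
    proof (intro allI impI, goal_cases)
      case (1 P Q)
      show ?case
        by (rule equivalence[OF principal_pair_tracefree_sym_grad[OF U g 1(1)] _ _ _ _ 1(2)])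
          (use symb_tracefree_sym_grad_kernel[OF g _ 1(1)] in \<open>auto simp: columns rows symbols simp del: One_nat_def\<close>)
    qed
  next
    case 6
    show ?case
    proof (intro allI impI, goal_cases)
      case (1 P Q)
      show ?case
        by (rule equivalence[OF principal_pair_direct_sum[OF principal_pair_hess[OF U] principal_pair_sym_grad[OF U]] _ _ _ _ 1])
          (use block_diag_kernel[OF symb_hess_kernel symb_sym_grad_kernel] in
            \<open>auto simp: direct_sums columns rows symbols halves simp del: One_nat_def\<close>)
    qed
  next
    case 7
    show ?case
    proof (intro allI impI, goal_cases)
      case (1 P Q)
      note pair = principal_pair_direct_sum[OF principal_pair_hess[OF U] principal_pair_tracefree_sym_grad[OF U g 1(1)]]
      show ?case
        by (rule equivalence[OF pair _ refl _ _ 1(2), THEN conjunct2, THEN mp, OF _ _ _ 1(3)])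
          (use block_diag_kernel[OF symb_hess_kernel symb_tracefree_sym_grad_kernel[OF g _ 1(1)]] in
            \<open>auto simp: direct_sums columns symbols halves simp del: One_nat_def\<close>)
    qed
  qed
qed

end
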